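(* For any constant integer $\Delta\ge3$ and any constant $\varepsilon>0$, there exists a constant $C$ such that, if $p=p(n)$ satisfies $C/n\le p\le 1-\varepsilon$, then with probability tending to $1$ as $n\to\infty$, $$\lfloor 2\log_q(a_{\Delta}np(1-\varepsilon))+3\rfloor\le \mathbf{F}_{\Delta}\le \lceil 2\log_q(a_{\Delta}np(1+\varepsilon))+3\rceil,$$ where $q=1/(1-p)$.
   Context: $G(n,p)$ is the binomial random graph on vertex set $[n]$ in which each pair of vertices is joined by an edge independently with probability $p$. $\mathbf{F}_{\Delta}$ denotes the maximum number of vertices of an induced subgraph of $G(n,p)$ that is a forest with maximum degree at most $\Delta$. For an integer $\Delta\ge2$ let $\gamma_{\Delta}(x)=\sum_{k=0}^{\Delta-1}x^k/k!$ for $x>0$. For $\Delta\ge3$, $\alpha_{\Delta}\in(1,\infty)$ is the unique solution of $x\gamma_{\Delta-1}(x)/\gamma_{\Delta}(x)=1$, and $a_{\Delta}:=\gamma_{\Delta-1}(\alpha_{\Delta})$. *)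

theory Defs
  imports "HOL-Probability.Probability"
begin

type_synonym 'a ugraph = "'a set \<times> 'a set set"

definition verts :: "'a ugraph \<Rightarrow> 'a set" where
  "verts G = fst G"

definition edges :: "'a ugraph \<Rightarrow> 'a set set" where
  "edges G = snd G"

definition all_pairs :: "'a set \<Rightarrow> 'a set set" where
  "all_pairs V = {e. e \<subseteq> V \<and> card e = 2}"

definition induced_subgraph :: "'a ugraph \<Rightarrow> 'a set \<Rightarrow> 'a ugraph" where
  "induced_subgraph G S = (S, {e \<in> edges G. e \<subseteq> S})"

definition vertex_degree :: "'a ugraph \<Rightarrow> 'a \<Rightarrow> nat" where
  "vertex_degree G v = card {e \<in> edges G. v \<in> e}"

text \<open>A cycle is the list of its vertices in cyclic order; the last vertex is joined to the first.\<close>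

definition is_cycle :: "'a ugraph \<Rightarrow> 'a list \<Rightarrow> bool" where
  "is_cycle G vs \<longleftrightarrow>
     3 \<le> length vs \<and> distinct vs \<and> set vs \<subseteq> verts G \<and>
     (\<forall>i < length vs. {vs ! i, vs ! (Suc i mod length vs)} \<in> edges G)"

definition is_forest :: "'a ugraph \<Rightarrow> bool" where
  "is_forest G \<longleftrightarrow> (\<nexists>vs. is_cycle G vs)"

definition max_degree_le :: "nat \<Rightarrow> 'a ugraph \<Rightarrow> bool" where
  "max_degree_le \<Delta> G \<longleftrightarrow> (\<forall>v \<in> verts G. vertex_degree G v \<le> \<Delta>)"

definition max_induced_forest :: "nat \<Rightarrow> 'a ugraph \<Rightarrow> nat" where
  "max_induced_forest \<Delta> G =
     Max (card ` {S. S \<subseteq> verts G \<and> is_forest (induced_subgraph G S) \<and>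
                     max_degree_le \<Delta> (induced_subgraph G S)})"

definition gnp :: "nat \<Rightarrow> real \<Rightarrow> nat ugraph pmf" where
  "gnp n p =
     map_pmf (\<lambda>f. ({1..n}, {e \<in> all_pairs {1..n}. f e}))
       (Pi_pmf (all_pairs {1..n}) False (\<lambda>_. bernoulli_pmf p))"

definition gamma_poly :: "nat \<Rightarrow> real \<Rightarrow> real" where
  "gamma_poly \<Delta> x = (\<Sum>k<\<Delta>. x ^ k / fact k)"

definition alpha_const :: "nat \<Rightarrow> real" where
  "alpha_const \<Delta> = (THE x. 1 < x \<and> x * gamma_poly (\<Delta> - 1) x / gamma_poly \<Delta> x = 1)"

definition a_const :: "nat \<Rightarrow> real" where
  "a_const \<Delta> = gamma_poly (\<Delta> - 1) (alpha_const \<Delta>)"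

text \<open>The equation defining \<open>alpha_const\<close> has exactly one positive root, and it is greater than 1.\<close>

lemma gamma_pos: "0 < x \<Longrightarrow> 0 < \<Delta> \<Longrightarrow> 0 < gamma_poly \<Delta> x"
  unfolding gamma_poly_def by (intro sum_pos) auto

lemma gamma_diff:
  "x * gamma_poly (Suc m) x - gamma_poly (Suc (Suc m)) x = (\<Sum>k<m. x ^ (k + 2) * real (k + 1) / fact (k + 2)) - 1"
proof (induction m)
  case 0
  then show ?case by (simp add: gamma_poly_def)
next
  case (Suc m)
  have "x * gamma_poly (Suc (Suc m)) x - gamma_poly (Suc (Suc (Suc m))) x =
      (x * gamma_poly (Suc m) x - gamma_poly (Suc (Suc m)) x) +
      (x * (x ^ Suc m / fact (Suc m)) - x ^ (m + 2) / fact (m + 2))"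
    by (simp add: gamma_poly_def algebra_simps)
  also have "x * (x ^ Suc m / fact (Suc m)) - x ^ (m + 2) / fact (m + 2) =
      x ^ (m + 2) * real (m + 1) / fact (m + 2)"
    by (simp add: divide_simps) (simp add: algebra_simps)
  finally show ?case using Suc by simp
qed

lemma alpha_ex1:
  assumes "3 \<le> \<Delta>"
  shows "\<exists>!x. 0 < x \<and> x * gamma_poly (\<Delta> - 1) x / gamma_poly \<Delta> x = 1"
    and "0 < x \<Longrightarrow> x * gamma_poly (\<Delta> - 1) x / gamma_poly \<Delta> x = 1 \<Longrightarrow> 1 < x"
proof -
  obtain m where D: "\<Delta> = Suc (Suc m)" and m: "0 < m"
    using assms by (intro that[of "\<Delta> - 2"]) auto
  define h :: "real \<Rightarrow> real"
    where "h x = (\<Sum>k<m. x ^ (k + 2) * real (k + 1) / fact (k + 2)) - 1" for x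
  have h: "h x = x * gamma_poly (Suc m) x - gamma_poly (Suc (Suc m)) x" for x
    unfolding h_def using gamma_diff[of x m] by simp
  have iff: "x * gamma_poly (\<Delta> - 1) x / gamma_poly \<Delta> x = 1 \<longleftrightarrow> h x = 0" if "0 < x" for x
    using gamma_pos[OF that, of \<Delta>] by (auto simp: h D field_simps)
  have mono: "h x < h y" if "0 < x" "x < y" for x y
    unfolding h_def using that m
    by (intro diff_strict_right_mono sum_strict_mono divide_strict_right_mono
        mult_strict_right_mono power_strict_mono) (auto simp del: power_Suc)
  have h1: "h 1 < 0"
    unfolding h by (simp add: gamma_poly_def)
  have h2: "0 < h 2"
  proof -
    have "(\<Sum>k<1. (2::real) ^ (k + 2) * real (k + 1) / fact (k + 2)) \<le>
        (\<Sum>k<m. 2 ^ (k + 2) * real (k + 1) / fact (k + 2))"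
      using m by (intro sum_mono2) auto
    then show ?thesis by (simp add: h_def)
  qed
  have "continuous_on {1..2} h"
    unfolding h_def by (intro continuous_intros) auto
  then obtain r where r: "1 \<le> r" "r \<le> 2" "h r = 0"
    using IVT'[of h 1 0 2] h1 h2 by auto
  have uniq: "y = r" if "0 < y" "h y = 0" for y
    using mono[of y r] mono[of r y] that r by (cases y r rule: linorder_cases) auto
  show "\<exists>!x. 0 < x \<and> x * gamma_poly (\<Delta> - 1) x / gamma_poly \<Delta> x = 1"
    using r uniq iff by (intro ex1I[of _ r]) auto
  show "1 < x" if "0 < x" "x * gamma_poly (\<Delta> - 1) x / gamma_poly \<Delta> x = 1"
    using uniq[of x] iff[of x] that r h1 by (cases "r = 1") auto
qed

end

theory Submission
  imports Defs "HOL-Real_Asymp.Real_Asymp"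
begin

text \<open>
  Write \<open>w = p / (1 - p)\<close>, \<open>d = n p\<close> and \<open>a = a_const \<Delta>\<close>. A set of \<open>k\<close> vertices induces a given
  forest \<open>F\<close> with probability \<open>w ^ card F * (1 - p) ^ (k choose 2)\<close>. Removing leaves one at a time
  bounds the number of forests with a given degree sequence by a multinomial-type quotient; summing
  over the degrees with weight \<open>\<alpha> = alpha_const \<Delta>\<close> makes the generating function \<open>\<gamma>(\<alpha>) / \<alpha> = a\<close> appear, so the
  expected number of induced forests is at most \<open>(a d q powr (- (k - 3) / 2)) ^ k * exp (O(1 / p))\<close>
  and the upper bound is the first moment method.

  For the lower bound one counts induced trees that are transversal to a partition of the vertices
  into \<open>N\<close> blocks of size \<open>m\<close>. The number of trees on \<open>k\<close> vertices is \<open>k! (a + o(1)) ^ k\<close>, because the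
  degree distribution tilted by \<open>\<alpha>\<close> has mean 1 (for \<open>degree - 1\<close>) and Chebyshev's inequality applies. In the
  second moment two trees overlapping in \<open>l\<close> vertices are treated in two ways: for \<open>2 l \<le> k\<close> a random
  tree contains a fixed forest with \<open>h\<close> edges with probability at most \<open>(\<Delta> e\<^sup>2 / k) ^ h\<close>, and for
  \<open>2 l > k\<close> the second tree is obtained from the first by changing at most \<open>\<Delta> (k - l)\<close> edges.
  If \<open>d \<ge> n powr (9 / 10)\<close>, then \<open>m = 1\<close> gives a quotient tending to 1. Otherwise \<open>m\<close> is about
  \<open>d powr (9 / 10)\<close>; the quotient is only \<open>exp (O(n d powr (- 6 / 5)))\<close>, but the largest transversal
  forest is a 1-Lipschitz function of the \<open>N\<close> blocks, and its concentration beats this loss because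
  replacing \<open>\<epsilon>\<close> by \<open>\<epsilon> / 2\<close> raises the target size by order \<open>1 / p\<close>.
\<close>

text \<open>The exponent \<open>9 / 10\<close> has two separate origins. For small \<open>d\<close>
  the second moment loses a factor \<open>exp (O (n d powr (- 6 / 5)))\<close>, while concentration
  over single vertices would gain only an exponent of order \<open>n / d\<^sup>2\<close>. Blocks of
  size \<open>d powr \<theta>\<close> raise the gain to \<open>n d powr (\<theta> - 2)\<close>. This
  beats the loss if \<theta> > 4/5, and \<theta> < 1 keeps the \<open>k\<close> blocks met by a
  tree, about \<open>n (ln d) / d\<close>, a small fraction of all blocks. The border between the
  ranges of \<open>d\<close> could be any power of \<open>n\<close> with exponent between 20/23,
  above which the overlap terms vanish without concentration, and 10/11, below which the gain
  \<open>n d powr (- 11 / 10)\<close> tends to infinity. The slack in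
  \<open>7 / 5 = 3 / 2 - 1 / 10\<close> and \<open>12 / 5 = 5 / 2 - 1 / 10\<close> pays for all
  powers of \<open>ln d\<close>. The constant \<open>C\<close> serves only to make \<open>d\<close>
  large; all that depends on the target size \<open>k\<close> is left to large \<open>n\<close>,
  uniformly in \<open>p\<close>, because \<open>k\<close> is at least a multiple of
  \<open>ln n\<close>.\<close>

lemma alpha_const_gt_1:
  assumes "3 \<le> \<Delta>"
  shows "1 < alpha_const \<Delta>"
    and alpha_const_eq: "gamma_poly \<Delta> (alpha_const \<Delta>) = alpha_const \<Delta> * a_const \<Delta>"
proof -
  have "\<exists>!x. 1 < x \<and> x * gamma_poly (\<Delta> - 1) x / gamma_poly \<Delta> x = 1"
    using alpha_ex1[OF assms] by (metis less_trans zero_less_one)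
  from theI'[OF this] have *: "1 < alpha_const \<Delta>"
    "alpha_const \<Delta> * gamma_poly (\<Delta> - 1) (alpha_const \<Delta>) / gamma_poly \<Delta> (alpha_const \<Delta>) = 1"
    by (auto simp: alpha_const_def)
  then show "1 < alpha_const \<Delta>"
    by simp
  show "gamma_poly \<Delta> (alpha_const \<Delta>) = alpha_const \<Delta> * a_const \<Delta>"
    using * gamma_pos[of "alpha_const \<Delta>" \<Delta>] assms by (auto simp: a_const_def field_simps)
qed

lemma a_const_gt_1:
  assumes "3 \<le> \<Delta>"
  shows "1 < a_const \<Delta>"
proof -
  obtain m where D: "\<Delta> - 1 = Suc (Suc m)"
    using assms by (metis Suc_diff_Suc Suc_le_D diff_Suc_1 less_eq_Suc_le numeral_3_eq_3 Suc_le_mono)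
  have "0 < alpha_const \<Delta>"
    using alpha_const_gt_1[OF assms] by simp
  \<comment> \<open>The terms for \<open>k = 0\<close> and \<open>k = 1\<close> are both present
    because \<Delta> - 1 \<ge> 2.\<close>
  then have "(\<Sum>k<2. alpha_const \<Delta> ^ k / fact k) \<le> a_const \<Delta>"
    unfolding a_const_def gamma_poly_def D by (intro sum_mono2) auto
  then show ?thesis
    using \<open>0 < alpha_const \<Delta>\<close> by (simp add: numeral_2_eq_2)
qed

section \<open>Acyclic edge sets\<close>

definition degree_in :: "'a set set \<Rightarrow> 'a \<Rightarrow> nat" where
  "degree_in F v = card {e \<in> F. v \<in> e}"

text \<open>Forests are described by leaves instead of cycles: the condition passes to subsets and
  yields a leaf to remove, which is what the counting inductions use.
  \<open>is_forest_iff_acyclic_edges\<close> links it to the definition by cycles.\<close>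

definition acyclic_edges :: "'a set set \<Rightarrow> bool" where
  "acyclic_edges F \<longleftrightarrow> (\<forall>F' \<subseteq> F. F' \<noteq> {} \<longrightarrow> (\<exists>v. degree_in F' v = 1))"

lemma acyclic_edges_empty [simp]: "acyclic_edges {}"
  by (simp add: acyclic_edges_def)

lemma acyclic_edges_mono: "acyclic_edges F \<Longrightarrow> F' \<subseteq> F \<Longrightarrow> acyclic_edges F'"
  by (auto simp: acyclic_edges_def)

lemma finite_all_pairs [intro, simp]: "finite V \<Longrightarrow> finite (all_pairs V)"
  by (rule finite_subset[of _ "Pow V"]) (auto simp: all_pairs_def)

lemma card_all_pairs: "finite V \<Longrightarrow> card (all_pairs V) = card V choose 2"
  by (simp add: all_pairs_def n_subsets)

lemma all_pairs_mono: "V \<subseteq> W \<Longrightarrow> all_pairs V \<subseteq> all_pairs W"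
  by (auto simp: all_pairs_def)

lemma all_pairs_Int: "all_pairs V \<inter> all_pairs W = all_pairs (V \<inter> W)"
  by (auto simp: all_pairs_def)

lemma pair_in_all_pairs: "{v, w} \<in> all_pairs V \<longleftrightarrow> v \<in> V \<and> w \<in> V \<and> v \<noteq> w"
  by (auto simp: all_pairs_def card_insert_if)

lemma all_pairs_edgeE:
  assumes "e \<in> all_pairs V" "v \<in> e"
  obtains w where "w \<in> V" "w \<noteq> v" "e = {v, w}"
proof -
  from assms obtain x y where "e = {x, y}" "x \<noteq> y" "e \<subseteq> V"
    by (auto simp: all_pairs_def card_2_iff)
  with assms(2) show ?thesis
    using that[of x] that[of y] by (auto simp: insert_commute)
qed

lemma degree_in_le_mono: "finite F \<Longrightarrow> F' \<subseteq> F \<Longrightarrow> degree_in F' v \<le> degree_in F v"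
  unfolding degree_in_def by (intro card_mono) auto

lemma degree_in_pos_iff: "finite F \<Longrightarrow> 0 < degree_in F v \<longleftrightarrow> v \<in> \<Union>F"
  by (auto simp: degree_in_def card_gt_0_iff)

lemma degree_in_eq_0: "v \<notin> \<Union>F \<Longrightarrow> degree_in F v = 0"
  unfolding degree_in_def by (subst card_eq_0_iff) auto

lemma degree_in_insert:
  assumes "finite F" "e \<notin> F"
  shows "degree_in (insert e F) v = (if v \<in> e then Suc (degree_in F v) else degree_in F v)"
proof -
  have "{x \<in> insert e F. v \<in> x} = (if v \<in> e then insert e {x \<in> F. v \<in> x} else {x \<in> F. v \<in> x})"
    by auto
  then show ?thesis
    using assms by (simp add: degree_in_def)
qed

lemma degree_in_eq_1_iff: "degree_in F v = 1 \<longleftrightarrow> (\<exists>!e. e \<in> F \<and> v \<in> e)"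
proof -
  have "card {e \<in> F. v \<in> e} = 1 \<longleftrightarrow> (\<exists>x. {e \<in> F. v \<in> e} = {x})"
    by (simp add: card_1_singleton_iff)
  also have "\<dots> \<longleftrightarrow> (\<exists>!e. e \<in> F \<and> v \<in> e)"
    by blast
  finally show ?thesis
    by (simp add: degree_in_def)
qed

lemma acyclic_edges_leaf:
  assumes "acyclic_edges F" "F \<noteq> {}" "F \<subseteq> all_pairs V"
  obtains v w where "v \<in> V" "w \<in> V" "v \<noteq> w" "{v, w} \<in> F" "\<And>e. e \<in> F \<Longrightarrow> v \<in> e \<Longrightarrow> e = {v, w}"
proof -
  from assms obtain v where "degree_in F v = 1"
    by (auto simp: acyclic_edges_def)
  then obtain e where e: "e \<in> F" "v \<in> e" "\<And>e'. e' \<in> F \<Longrightarrow> v \<in> e' \<Longrightarrow> e' = e"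
    unfolding degree_in_eq_1_iff by blast
  moreover obtain w where "w \<in> V" "w \<noteq> v" "e = {v, w}"
    using all_pairs_edgeE[of e V v] e assms(3) by blast
  moreover have "v \<in> V"
    using e assms(3) by (auto simp: all_pairs_def)
  ultimately show ?thesis
    using that by blast
qed

text \<open>A subset with the new edge has \<open>v\<close> as a leaf; any other subset lies in
  \<open>F\<close>.\<close>

lemma acyclic_edges_insert:
  assumes "acyclic_edges F" "v \<notin> \<Union>F"
  shows "acyclic_edges (insert {v, w} F)"
  unfolding acyclic_edges_def
proof (intro allI impI)
  fix F' assume F': "F' \<subseteq> insert {v, w} F" "F' \<noteq> {}"
  show "\<exists>u. degree_in F' u = 1"
  proof (cases "{v, w} \<in> F'")
    case True
    then have "{e \<in> F'. v \<in> e} = {{v, w}}"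
      using F'(1) assms(2) by blast
    then show ?thesis
      by (intro exI[of _ v]) (simp add: degree_in_def)
  next
    case False
    then show ?thesis
      using F' assms(1) by (auto simp: acyclic_edges_def)
  qed
qed

text \<open>Deleting the edge at a leaf \<open>v\<close> also deletes \<open>v\<close> from the
  covered vertices.\<close>

lemma card_acyclic_edges_le:
  assumes "finite V" "F \<subseteq> all_pairs V" "acyclic_edges F"
  shows "card F \<le> card (\<Union>F)"
  using assms(2,3)
proof (induction "card F" arbitrary: F rule: less_induct)
  case (less F)
  have fin: "finite F"
    using less.prems assms(1) finite_subset[of F "all_pairs V"] by auto
  show ?case
  proof (cases "F = {}")
    case False
    obtain v w where "v \<in> V" "w \<in> V" "v \<noteq> w" and vw: "{v, w} \<in> F" "\<And>e. e \<in> F \<Longrightarrow> v \<in> e \<Longrightarrow> e = {v, w}"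
      by (rule acyclic_edges_leaf[OF less.prems(2) False less.prems(1)]) (rule that)
    let ?F = "F - {{v, w}}"
    have *: "card ?F < card F"
      by (rule card_Diff1_less[OF fin vw(1)])
    have "?F \<subseteq> all_pairs V" "acyclic_edges ?F"
      using less.prems by (blast, intro acyclic_edges_mono[of F ?F]) auto
    then have "card ?F \<le> card (\<Union>?F)"
      by (rule less.hyps[OF *])
    moreover have "v \<in> \<Union>F" "v \<notin> \<Union>?F"
      using vw by blast+
    then have "\<Union>?F \<subset> \<Union>F"
      by blast
    moreover have "\<Union>F \<subseteq> V"
      using less.prems(1) by (auto simp: all_pairs_def)
    then have "finite (\<Union>F)"
      using assms(1) finite_subset by blast
    ultimately show ?thesis
      using psubset_card_mono[of "\<Union>F" "\<Union>?F"] card_Diff_singleton[OF vw(1)] by linarith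
  qed simp
qed

text \<open>In a nonempty edge set without leaves the first vertex of a longest path has a second
  edge; it must return to the path and so closes a cycle. Conversely every vertex of a cycle lies on
  two of its edges, so these edges form a set without leaves.\<close>

lemma is_forest_iff_acyclic_edges:
  assumes "finite V" "F \<subseteq> all_pairs V"
  shows "is_forest (V, F) \<longleftrightarrow> acyclic_edges F"
proof
  assume forest: "is_forest (V, F)"
  have finF: "finite F"
    using finite_subset[OF assms(2)] assms(1) by auto
  show "acyclic_edges F"
    unfolding acyclic_edges_def
  proof (intro allI impI, rule ccontr)
    fix F' assume F': "F' \<subseteq> F" "F' \<noteq> {}" and no_leaf: "\<nexists>v. degree_in F' v = 1"
    have finF': "finite F'"
      by (rule finite_subset[OF F'(1) finF])
    have other: "\<exists>e'\<in>F'. u \<in> e' \<and> e' \<noteq> e" if "e \<in> F'" "u \<in> e" for u e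
    proof (rule ccontr)
      assume "\<not> ?thesis"
      then have "{e \<in> F'. u \<in> e} = {e}"
        using that by blast
      then have "degree_in F' u = 1"
        by (simp add: degree_in_def)
      with no_leaf show False by blast
    qed
    \<comment> \<open>\<open>P\<close> describes the paths in \<open>F'\<close>. They have at most
      \<open>card V\<close> vertices, so a longest one exists.\<close>
    define P where "P vs \<longleftrightarrow> distinct vs \<and> set vs \<subseteq> V \<and> 2 \<le> length vs \<and>
      (\<forall>i. Suc i < length vs \<longrightarrow> {vs ! i, vs ! Suc i} \<in> F')" for vs
    obtain e where e: "e \<in> F'"
      using F' by auto
    then have "e \<in> all_pairs V"
      using F'(1) assms(2) by blast
    then obtain x y where xy: "e = {x, y}" "x \<noteq> y" "e \<subseteq> V"
      by (auto simp: all_pairs_def card_2_iff)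
    have "P [x, y]"
      using e xy by (auto simp: P_def)
    moreover have bound: "\<forall>vs. P vs \<longrightarrow> length vs < Suc (card V)"
      unfolding less_Suc_eq_le P_def using assms(1) by (metis card_mono distinct_card)
    ultimately obtain vs where vs: "P vs" and vs_max: "\<And>ws. P ws \<Longrightarrow> length ws \<le> length vs"
      using ex_has_greatest_nat[of P "[x, y]" length "Suc (card V)"] by blast
    have v01: "{vs ! 0, vs ! 1} \<in> F'"
      using vs by (auto simp: P_def)
    then obtain e' where e': "e' \<in> F'" "vs ! 0 \<in> e'" "e' \<noteq> {vs ! 0, vs ! 1}"
      using other[of "{vs ! 0, vs ! 1}" "vs ! 0"] by auto
    then obtain u where u: "u \<in> V" "u \<noteq> vs ! 0" "e' = {vs ! 0, u}"
      using F'(1) assms(2) all_pairs_edgeE[of e' V "vs ! 0"] by blast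
    show False
    proof (cases "u \<in> set vs")
      case False
      have "P (u # vs)"
        using vs u e' False unfolding P_def
        by (auto simp: nth_Cons insert_commute split: nat.splits)
      then show False
        using vs_max[of "u # vs"] by simp
    next
      case True
      then obtain i where i: "i < length vs" "vs ! i = u"
        by (auto simp: in_set_conv_nth)
      \<comment> \<open>With 0 and 1 excluded, the cycle closed by \<open>e'\<close> has at least
        three vertices.\<close>
      have "i \<noteq> 0"
        using u i by (intro notI) simp
      have "i \<noteq> 1"
        using u e' i by (intro notI) simp
      have len: "length (take (Suc i) vs) = Suc i"
        using i by simp
      have "is_cycle (V, F) (take (Suc i) vs)"
        unfolding is_cycle_def
      proof (intro conjI allI impI)
        show "3 \<le> length (take (Suc i) vs)"
          using i \<open>i \<noteq> 0\<close> \<open>i \<noteq> 1\<close> by auto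
        show "distinct (take (Suc i) vs)" "set (take (Suc i) vs) \<subseteq> verts (V, F)"
          using vs set_take_subset[of "Suc i" vs] by (auto simp: P_def verts_def)
        fix j assume j: "j < length (take (Suc i) vs)"
        show "{take (Suc i) vs ! j, take (Suc i) vs ! (Suc j mod length (take (Suc i) vs))}
          \<in> edges (V, F)"
        proof (cases "j = i")
          case True
          then show ?thesis
            unfolding len using i e' u F' by (auto simp: edges_def insert_commute)
        next
          case False
          then have "j < i"
            using j len by simp
          then have "{vs ! j, vs ! Suc j} \<in> F'"
            using vs i by (auto simp: P_def)
          then show ?thesis
            unfolding len using \<open>j < i\<close> i F' by (auto simp: edges_def)
        qed
      qed
      with forest show False
        by (auto simp: is_forest_def)
    qed
  qed
next
  assume ac: "acyclic_edges F"
  show "is_forest (V, F)"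
    unfolding is_forest_def
  proof
    assume "\<exists>vs. is_cycle (V, F) vs"
    then obtain vs where vs: "3 \<le> length vs" "distinct vs" "set vs \<subseteq> V"
      "\<And>i. i < length vs \<Longrightarrow> {vs ! i, vs ! (Suc i mod length vs)} \<in> F"
      by (auto simp: is_cycle_def verts_def edges_def)
    define l where "l = length vs"
    define c where "c i = {vs ! i, vs ! (Suc i mod l)}" for i
    have "0 < l" "3 \<le> l"
      using vs by (auto simp: l_def)
    then have "c ` {..<l} \<subseteq> F" "c ` {..<l} \<noteq> {}"
      using vs by (auto simp: c_def l_def)
    then obtain v where "degree_in (c ` {..<l}) v = 1"
      using ac by (auto simp: acyclic_edges_def)
    then obtain e where e: "e \<in> c ` {..<l}" "v \<in> e"
      and uniq: "\<And>e'. e' \<in> c ` {..<l} \<Longrightarrow> v \<in> e' \<Longrightarrow> e' = e"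
      unfolding degree_in_eq_1_iff by blast
    from e(1) obtain i' where i': "i' < l" "e = c i'"
      by auto
    then have "v = vs ! i' \<or> v = vs ! (Suc i' mod l)" "Suc i' mod l < l"
      using e(2) by (auto simp: c_def)
    then obtain i where i: "i < l" "v = vs ! i"
      using i'(1) by blast
    \<comment> \<open>\<open>j\<close> is the cyclic predecessor of \<open>i\<close>. Both
      \<open>c i\<close> and \<open>c j\<close> contain \<open>v\<close>, and they differ because
      \<open>3 \<le> l\<close>.\<close>
    define j where "j = (if i = 0 then l - 1 else i - 1)"
    have j: "j < l" "Suc j mod l = i"
      using i \<open>0 < l\<close> by (auto simp: j_def)
    have "c i = e" "c j = e"
      using uniq[of "c i"] uniq[of "c j"] i j by (auto simp: c_def)
    then have "{vs ! i, vs ! (Suc i mod l)} = {vs ! j, vs ! i}"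
      using j by (auto simp: c_def)
    moreover have "Suc i mod l \<noteq> i" "Suc i mod l \<noteq> j" "j \<noteq> i" "Suc i mod l < l"
      using j i \<open>3 \<le> l\<close> by (auto simp: j_def mod_if split: if_splits)
    ultimately show False
      using vs(2) i j \<open>0 < l\<close> by (auto simp: l_def doubleton_eq_iff nth_eq_iff_index_eq)
  qed
qed

section \<open>Counting forests of bounded degree\<close>

definition forests_with_degrees :: "'a set \<Rightarrow> ('a \<Rightarrow> nat) \<Rightarrow> 'a set set set" where
  "forests_with_degrees V d =
     {F. F \<subseteq> all_pairs V \<and> acyclic_edges F \<and> (\<forall>v\<in>V. degree_in F v = d v)}"

lemma finite_forests_with_degrees [intro, simp]:
  "finite V \<Longrightarrow> finite (forests_with_degrees V d)"
  by (rule finite_subset[of _ "Pow (all_pairs V)"]) (auto simp: forests_with_degrees_def)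

lemma sum_degree_in:
  assumes "finite V" "F \<subseteq> all_pairs V"
  shows "(\<Sum>v\<in>V. degree_in F v) = 2 * card F"
  unfolding degree_in_def
proof (rule sum_multicount)
  show "finite F"
    using assms finite_subset by blast
  show "\<forall>e\<in>F. card {v \<in> V. v \<in> e} = 2"
  proof
    fix e assume "e \<in> F"
    then have "card e = 2" "{v \<in> V. v \<in> e} = e"
      using assms(2) by (auto simp: all_pairs_def)
    then show "card {v \<in> V. v \<in> e} = 2" by simp
  qed
qed (use assms in auto)

lemma Union_eq_degree_pos:
  assumes "finite V" "F \<subseteq> all_pairs V"
  shows "\<Union>F = {v \<in> V. 0 < degree_in F v}"
proof -
  have "finite F"
    using assms finite_subset by blast
  then show ?thesis
    using assms(2) by (subst degree_in_pos_iff) (auto simp: all_pairs_def)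
qed

lemma forests_with_degrees_remove_leaf:
  assumes "finite V" "v \<in> V" "d v = 1"
  shows "forests_with_degrees V d \<subseteq>
    (\<Union>w \<in> {w \<in> V - {v}. 0 < d w}. insert {v, w} ` forests_with_degrees V (d(v := 0, w := d w - 1)))"
proof
  fix F assume F: "F \<in> forests_with_degrees V d"
  have FV: "F \<subseteq> all_pairs V"
    using F by (simp add: forests_with_degrees_def)
  have deg: "degree_in F u = d u" if "u \<in> V" for u
    using F that by (simp add: forests_with_degrees_def)
  have fin: "finite F"
    using FV assms(1) finite_subset by blast
  have "degree_in F v = 1"
    using deg[OF assms(2)] assms(3) by simp
  then obtain e where e: "e \<in> F" "v \<in> e"
    unfolding degree_in_eq_1_iff by blast
  have "e \<in> all_pairs V"
    using e FV by blast
  then obtain w where w: "w \<in> V" "w \<noteq> v" "e = {v, w}"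
    using e(2) by (rule all_pairs_edgeE)
  define F' where "F' = F - {e}"
  have F': "F = insert {v, w} F'" "{v, w} \<notin> F'" "finite F'"
    using e w fin by (auto simp: F'_def)
  have degF': "degree_in F u = (if u \<in> {v, w} then Suc (degree_in F' u) else degree_in F' u)" for u
    unfolding F'(1) by (rule degree_in_insert[OF F'(3,2)])
  have "0 < d w"
    using deg[OF w(1)] degF'[of w] by simp
  moreover have "F' \<in> forests_with_degrees V (d(v := 0, w := d w - 1))"
    unfolding forests_with_degrees_def
  proof (intro CollectI conjI ballI)
    show "F' \<subseteq> all_pairs V"
      using FV by (auto simp: F'_def)
    show "acyclic_edges F'"
      by (rule acyclic_edges_mono[of F]) (use F in \<open>auto simp: forests_with_degrees_def F'_def\<close>)
    fix u assume "u \<in> V"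
    then show "degree_in F' u = (d(v := 0, w := d w - 1)) u"
      using deg[of u] degF'[of u] assms(3) by (auto split: if_splits)
  qed
  ultimately show "F \<in> (\<Union>w \<in> {w \<in> V - {v}. 0 < d w}.
      insert {v, w} ` forests_with_degrees V (d(v := 0, w := d w - 1)))"
    using F'(1) w by blast
qed

text \<open>Let n be the number of vertices of positive degree and c = n - e. Fix a leaf
  \<open>v\<close> and sum over its neighbour \<open>w\<close>. If \<open>d w \<ge> 2\<close>, then
  n drops by one and the factorials contribute \<open>d w - 1\<close>; if \<open>d w = 1\<close>,
  the edge is a component and n drops by two. Since the numbers \<open>d w - 1\<close> sum to 2 e -
  n, both kinds together give at most (2 e - n + c) (n - 1)! / c! = e (n - 1)! / c!, and e \<le> n.
  Isolated vertices enter the product as \<open>fact (0 - 1) = 1\<close>.\<close>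

lemma card_forests_with_degrees_le:
  assumes "finite V" "(\<Sum>v\<in>V. d v) = 2 * e"
  shows "real (card (forests_with_degrees V d)) * (\<Prod>v\<in>V. fact (d v - 1)) \<le>
    (if e \<le> card {v\<in>V. 0 < d v}
     then fact (card {v\<in>V. 0 < d v}) / fact (card {v\<in>V. 0 < d v} - e) else 0)"
  using assms(2)
proof (induction e arbitrary: d)
  case 0
  then have d: "d v = 0" if "v \<in> V" for v
    using that assms(1) by simp
  have "forests_with_degrees V d \<subseteq> {{}}"
  proof
    fix F assume F: "F \<in> forests_with_degrees V d"
    then have "2 * card F = (\<Sum>v\<in>V. degree_in F v)"
      using sum_degree_in[of V F] assms(1) by (simp add: forests_with_degrees_def)
    also have "\<dots> = 0"
      using F d by (simp add: forests_with_degrees_def)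
    finally have "card F = 0" by simp
    moreover have "finite F"
      using F assms(1) finite_subset[of F "all_pairs V"] by (auto simp: forests_with_degrees_def)
    ultimately show "F \<in> {{}}" by simp
  qed
  then have "card (forests_with_degrees V d) \<le> 1"
    using card_mono[of "{{}}" "forests_with_degrees V d"] by simp
  moreover have "{v\<in>V. 0 < d v} = {}" "(\<Prod>v\<in>V. fact (d v - 1)) = (1::real)"
    using d by auto
  ultimately show ?case by simp
next
  case (Suc e)
  define n where "n = card {v\<in>V. 0 < d v}"
  define \<beta> :: "nat \<Rightarrow> nat \<Rightarrow> real"
    where "\<beta> n e = (if e \<le> n then fact n / fact (n - e) else 0)" for n e
  define P :: "('a \<Rightarrow> nat) \<Rightarrow> real" where "P d = (\<Prod>v\<in>V. fact (d v - 1))" for d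
  have P_pos: "0 < P d" for d
    unfolding P_def by (intro prod_pos) auto
  have IH: "real (card (forests_with_degrees V d)) * P d \<le> \<beta> (card {v\<in>V. 0 < d v}) e"
    if "(\<Sum>v\<in>V. d v) = 2 * e" for d
    using Suc.IH[OF that] by (simp add: \<beta>_def P_def)
  have "real (card (forests_with_degrees V d)) * P d \<le> \<beta> n (Suc e)"
  proof (cases "forests_with_degrees V d = {}")
    case True
    then show ?thesis by (simp add: \<beta>_def)
  next
    case False
    then obtain F where F: "F \<subseteq> all_pairs V" "acyclic_edges F" "\<And>v. v \<in> V \<Longrightarrow> degree_in F v = d v"
      by (auto simp: forests_with_degrees_def)
    have "2 * card F = (\<Sum>v\<in>V. d v)"
      using sum_degree_in[OF assms(1) F(1)] F(3) by simp
    then have cardF: "card F = Suc e"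
      using Suc.prems by simp
    have "\<Union>F = {v\<in>V. 0 < d v}"
      unfolding Union_eq_degree_pos[OF assms(1) F(1)] using F(3) by auto
    then have en: "Suc e \<le> n"
      using card_acyclic_edges_le[OF assms(1) F(1,2)] cardF by (simp add: n_def)
    have "F \<noteq> {}"
      using cardF by auto
    then obtain v where "degree_in F v = 1"
      using F(2) by (auto simp: acyclic_edges_def)
    moreover from this have "v \<in> V"
      using degree_in_eq_0[of v F] F(1) by (force simp: all_pairs_def)
    ultimately have v: "v \<in> V" "d v = 1"
      using F(3) by auto
    define W where "W = {w \<in> V - {v}. 0 < d w}"
    define dw where "dw w = d(v := 0, w := d w - 1)" for w
    define c where "c = n - Suc e"
    have finW: "finite W"
      using assms(1) by (simp add: W_def)
    have posW: "{v\<in>V. 0 < d v} = insert v W"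
      using v by (auto simp: W_def)
    have cardW: "card W = n - 1"
      unfolding n_def posW using finW by (simp add: W_def)
    have "card (forests_with_degrees V d) \<le>
        card (\<Union>w\<in>W. insert {v, w} ` forests_with_degrees V (dw w))"
      using forests_with_degrees_remove_leaf[of V v d, OF assms(1) v] assms(1) finW
      by (intro card_mono finite_UN_I finite_imageI) (auto simp: W_def dw_def)
    also have "\<dots> \<le> (\<Sum>w\<in>W. card (insert {v, w} ` forests_with_degrees V (dw w)))"
      by (rule card_UN_le[OF finW])
    also have "\<dots> \<le> (\<Sum>w\<in>W. card (forests_with_degrees V (dw w)))"
      by (intro sum_mono card_image_le) (use assms(1) in auto)
    finally have "real (card (forests_with_degrees V d)) * P d \<le>
        (\<Sum>w\<in>W. real (card (forests_with_degrees V (dw w))) * P d)"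
      using P_pos[of d] by (simp add: sum_distrib_right[symmetric] of_nat_mono flip: of_nat_sum)
    \<comment> \<open>The first summand is the bound for \<open>d w \<ge> 2\<close>, the second the
      one for \<open>d w = 1\<close>. Both are nonnegative, so their sum serves for every
      \<open>w\<close>.\<close>
    also have "\<dots> \<le> (\<Sum>w\<in>W. (real (d w) - 1) * (fact (n - 1) / fact c) + real c * fact (n - 2) / fact c)"
    proof (rule sum_mono)
      fix w assume "w \<in> W"
      then have w: "w \<in> V" "w \<noteq> v" "0 < d w"
        by (auto simp: W_def)
      have "(\<Sum>u\<in>V. d u) = d v + (d w + (\<Sum>u\<in>V-{v}-{w}. d u))"
        using v(1) w assms(1) by (simp add: sum.remove[of V v] sum.remove[of "V - {v}" w])
      moreover have "(\<Sum>u\<in>V. dw w u) = 0 + (d w - 1 + (\<Sum>u\<in>V-{v}-{w}. dw w u))"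
        using v(1) w assms(1) by (simp add: sum.remove[of V v] sum.remove[of "V - {v}" w] dw_def)
      moreover have "(\<Sum>u\<in>V-{v}-{w}. dw w u) = (\<Sum>u\<in>V-{v}-{w}. d u)"
        by (intro sum.cong) (auto simp: dw_def)
      ultimately have "(\<Sum>u\<in>V. dw w u) = 2 * e"
        using Suc.prems v(2) w(3) by simp
      note IH' = IH[OF this]
      have "P d = fact (d v - 1) * (fact (d w - 1) * (\<Prod>u\<in>V-{v}-{w}. fact (d u - 1)))"
        using v(1) w assms(1) by (simp add: P_def prod.remove[of V v] prod.remove[of "V - {v}" w])
      moreover have "P (dw w) = fact (d w - 1 - 1) * (\<Prod>u\<in>V-{v}-{w}. fact (dw w u - 1))"
        using v(1) w assms(1) by (simp add: P_def prod.remove[of V v] prod.remove[of "V - {v}" w] dw_def)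
      moreover have "(\<Prod>u\<in>V-{v}-{w}. fact (dw w u - 1)) = (\<Prod>u\<in>V-{v}-{w}. fact (d u - 1) :: real)"
        by (intro prod.cong) (auto simp: dw_def)
      ultimately have P_eq: "P d = fact (d w - 1) * Q" "P (dw w) = fact (d w - 1 - 1) * Q"
        if "Q = (\<Prod>u\<in>V-{v}-{w}. fact (d u - 1) :: real)" for Q
        using v(2) that by auto
      show "real (card (forests_with_degrees V (dw w))) * P d
        \<le> (real (d w) - 1) * (fact (n - 1) / fact c) + real c * fact (n - 2) / fact c"
      proof (cases "d w = 1")
        case True
        have "{u\<in>V. 0 < dw w u} = W - {w}"
          using True w by (auto simp: dw_def W_def)
        then have "card {u\<in>V. 0 < dw w u} = n - 2"
          using \<open>w \<in> W\<close> finW cardW by simp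
        then have "real (card (forests_with_degrees V (dw w))) * P d \<le> \<beta> (n - 2) e"
          using IH' P_eq[OF refl] True by simp
        also have "\<dots> \<le> real c * fact (n - 2) / fact c"
        \<comment> \<open>If \<open>c = 0\<close> then \<open>n - 2 < e\<close>: more edges than
          covered vertices would remain, and \<beta> is 0.\<close>
        proof (cases "c = 0 \<or> n - 2 < e")
          case True
          then have "\<not> e \<le> n - 2 \<or> n < 2"
            using en by (auto simp: c_def)
          moreover have "2 \<le> n"
            using cardW \<open>w \<in> W\<close> finW card_gt_0_iff[of W] by (auto simp: card_gt_0_iff)
          ultimately show ?thesis
            by (auto simp: \<beta>_def)
        next
          case False
          then have "n - 2 - e = c - 1" "e \<le> n - 2" "c = Suc (c - 1)"
            by (auto simp: c_def)
          moreover from this(3) have "fact c = real c * fact (c - 1)"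
            by (metis fact_Suc of_nat_fact of_nat_mult)
          ultimately show ?thesis
            by (simp add: \<beta>_def)
        qed
        finally show ?thesis
          using True by simp
      next
        case False
        then have "2 \<le> d w"
          using w(3) by simp
        have "{u\<in>V. 0 < dw w u} = W"
          using \<open>2 \<le> d w\<close> w by (auto simp: dw_def W_def)
        then have "real (card (forests_with_degrees V (dw w))) * P (dw w) \<le> \<beta> (n - 1) e"
          using IH' cardW by simp
        moreover have "P d = (real (d w) - 1) * P (dw w)"
        proof -
          have "fact (d w - 1) = (real (d w) - 1) * fact (d w - 1 - 1)"
            using \<open>2 \<le> d w\<close> by (subst fact_reduce) (auto simp: of_nat_diff)
          then show ?thesis
            using P_eq[OF refl] by simp
        qed
        ultimately have "real (card (forests_with_degrees V (dw w))) * P d \<le> (real (d w) - 1) * \<beta> (n - 1) e"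
          using \<open>2 \<le> d w\<close> mult_left_mono[of _ "\<beta> (n - 1) e" "real (d w) - 1"] by (simp add: mult_ac)
        also have "\<beta> (n - 1) e = fact (n - 1) / fact c"
          using en by (simp add: \<beta>_def c_def)
        finally show ?thesis
          by (smt (verit) divide_nonneg_nonneg fact_ge_zero mult_nonneg_nonneg of_nat_0_le_iff)
      qed
    qed
    also have "\<dots> = (\<Sum>w\<in>W. real (d w) - 1) * (fact (n - 1) / fact c) + real (n - 1) * (real c * fact (n - 2) / fact c)"
      by (simp add: sum.distrib sum_distrib_right sum_divide_distrib cardW)
    also have "(\<Sum>w\<in>W. real (d w) - 1) = 2 * real (Suc e) - real n"
    proof -
      have "real (2 * Suc e) = (\<Sum>u\<in>V. real (d u))"
        using Suc.prems by (metis of_nat_sum)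
      also have "\<dots> = (\<Sum>u\<in>insert v W. real (d u))"
        by (intro sum.mono_neutral_right) (use assms(1) v in \<open>auto simp: W_def\<close>)
      also have "\<dots> = 1 + (\<Sum>u\<in>W. real (d u))"
        using finW v by (simp add: W_def)
      finally show ?thesis
        using en cardW by (simp add: sum_subtractf)
    qed
    also have "real (n - 1) * (real c * fact (n - 2) / fact c) \<le> real c * (fact (n - 1) / fact c)"
    proof -
      have "real (n - 1) * fact (n - 2) \<le> fact (n - 1)"
      proof (cases "n \<ge> 2")
        case True
        then obtain m where "n = Suc (Suc m)"
          by (metis Suc_le_D numeral_2_eq_2 Suc_le_mono)
        then show ?thesis by simp
      next
        case False
        then have "n - 1 = 0" by simp
        then show ?thesis by simp
      qed
      then have "real c / fact c * (real (n - 1) * fact (n - 2)) \<le> real c / fact c * fact (n - 1)"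
        by (rule mult_left_mono) simp
      then show ?thesis
        by (simp only: times_divide_eq_right times_divide_eq_left mult_ac)
    qed
    also have "(2 * real (Suc e) - real n) * (fact (n - 1) / fact c) + real c * (fact (n - 1) / fact c)
        = real (Suc e) * (fact (n - 1) / fact c)"
      using en by (simp add: c_def of_nat_diff algebra_simps add_divide_distrib diff_divide_distrib)
    also have "\<dots> \<le> real n * (fact (n - 1) / fact c)"
      using en by (intro mult_right_mono) auto
    also have "\<dots> = \<beta> n (Suc e)"
      using en by (simp add: \<beta>_def c_def fact_reduce[of n])
    finally show ?thesis by simp
  qed
  then show ?case
    by (simp add: \<beta>_def P_def n_def)
qed


text \<open>Passing from \<open>k\<close> to \<open>k + 1\<close> raises the base in
  \<open>u - 1\<close> of the factors at a cost of at most
  \<open>(1 + 1 / k) ^ k \<le> exp 1\<close>, which one factor \<open>1 / exp 1\<close>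
  pays.\<close>

lemma fact_quotient_ge:
  assumes "u \<le> k"
  shows "(real k / exp 1) ^ u \<le> fact k / fact (k - u)"
  using assms
proof (induction k arbitrary: u)
  case (Suc k)
  show ?case
  proof (cases u)
    case (Suc u')
    have u': "u' \<le> k"
      using Suc Suc.prems by simp
    have "(real (Suc k)) ^ u' \<le> real k ^ u' * exp 1"
    proof (cases "k = 0")
      case True
      then show ?thesis using u' by simp
    next
      case False
      have "(1 + 1 / real k) ^ u' \<le> exp (1 / real k) ^ u'"
        by (intro power_mono exp_ge_add_one_self) auto
      also have "\<dots> = exp (real u' / real k)"
        by (simp flip: exp_of_nat_mult)
      also have "\<dots> \<le> exp 1"
        using u' False by simp
      finally have "real k ^ u' * (1 + 1 / real k) ^ u' \<le> real k ^ u' * exp 1"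
        by (intro mult_left_mono) auto
      moreover have "real k * (1 + 1 / real k) = real (Suc k)"
        using False by (simp add: field_simps)
      ultimately show ?thesis
        by (metis power_mult_distrib)
    qed
    then have "real (Suc k) / exp 1 ^ Suc u' * real (Suc k) ^ u' \<le>
        real (Suc k) / exp 1 ^ Suc u' * (real k ^ u' * exp 1)"
      by (intro mult_left_mono) auto
    then have "(real (Suc k) / exp 1) ^ u \<le> real (Suc k) * (real k / exp 1) ^ u'"
      by (simp add: Suc power_divide)
    also have "\<dots> \<le> real (Suc k) * (fact k / fact (k - u'))"
      using Suc.IH[OF u'] by (intro mult_left_mono) auto
    also have "\<dots> = fact (Suc k) / fact (Suc k - u)"
      by (simp add: Suc)
    finally show ?thesis .
  qed simp
qed simp

lemma power_div_fact_le_exp: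
  fixes x :: real
  assumes "0 \<le> x"
  shows "x ^ n / fact n \<le> exp x"
proof -
  have "(\<Sum>i\<in>{n}. x ^ i /\<^sub>R fact i) \<le> (\<Sum>i. x ^ i /\<^sub>R fact i)"
    using assms by (intro sum_le_suminf summable_exp_generic) auto
  then show ?thesis
    by (simp add: exp_def divide_inverse mult.commute)
qed

definition bounded_forests :: "nat \<Rightarrow> 'a set \<Rightarrow> 'a set set set" where
  "bounded_forests \<Delta> V = {F. F \<subseteq> all_pairs V \<and> acyclic_edges F \<and> (\<forall>v\<in>V. degree_in F v \<le> \<Delta>)}"

lemma finite_bounded_forests [intro, simp]: "finite V \<Longrightarrow> finite (bounded_forests \<Delta> V)"
  by (rule finite_subset[of _ "Pow (all_pairs V)"]) (auto simp: bounded_forests_def)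

text \<open>Forests are grouped by degree sequence. The bound of
  \<open>card_forests_with_degrees_le\<close> becomes a product over the vertices once
  \<open>n! / c!\<close> is replaced by powers, where \<open>c\<close> is the number of covered
  vertices minus the number of edges. The sum over all sequences is then the \<open>k\<close>-th
  power of a sum over one degree, which is \<open>a\<close> up to a term for isolated vertices. The
  factor \<open>exp (O (1 / w))\<close> pays for forests with many components.\<close>

lemma sum_forest_weights_le:
  fixes w :: real
  assumes D: "3 \<le> \<Delta>" and fin: "finite S" and "S \<noteq> {}" and w: "0 < w"
  defines "\<alpha> \<equiv> alpha_const \<Delta>" and "a \<equiv> a_const \<Delta>"
  shows "(\<Sum>F\<in>bounded_forests \<Delta> S. w ^ card F) \<le>
    fact (card S) * (a * w) ^ card S * exp ((\<alpha>\<^sup>2 + exp 1 / a) / w)"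
proof -
  define k where "k = card S"
  have k: "0 < k"
    using assms by (auto simp: k_def card_gt_0_iff)
  have \<alpha>: "1 < \<alpha>" and a: "1 < a" and \<gamma>: "gamma_poly \<Delta> \<alpha> = \<alpha> * a"
    using alpha_const_gt_1[OF D] alpha_const_eq[OF D] a_const_gt_1[OF D] by (auto simp: \<alpha>_def a_def)
  \<comment> \<open>\<open>g j\<close> is the weight of a vertex of degree \<open>j\<close>. The
    powers of \<alpha> make the sum over positive degrees equal to
    \<open>gamma_poly \<Delta> \<alpha> / \<alpha> = a\<close>. For an isolated vertex
    \<open>exp 1 / k\<close> comes from comparing \<open>n!\<close> with \<open>k!\<close>, and
    \<open>1 / w\<close> from a missing edge.\<close>
  define g where "g j = (if j = 0 then exp 1 / (real k * w) else \<alpha> ^ (j - 1) / \<alpha> / fact (j - 1))"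
    for j :: nat
  have g_pos: "0 < g j" for j
    using \<alpha> k w by (auto simp: g_def)
  define r where "r F = restrict (degree_in F) S" for F
  have "(\<Sum>F\<in>bounded_forests \<Delta> S. w ^ card F) =
      (\<Sum>d\<in>PiE S (\<lambda>_. {..\<Delta>}). \<Sum>F\<in>{F \<in> bounded_forests \<Delta> S. r F = d}. w ^ card F)"
    using fin by (intro sum.group[symmetric] finite_PiE) (auto simp: r_def bounded_forests_def)
  also have "\<dots> \<le> (\<Sum>d\<in>PiE S (\<lambda>_. {..\<Delta>}). fact k * w ^ k * exp (\<alpha>\<^sup>2 / w) * (\<Prod>v\<in>S. g (d v)))"
  proof (rule sum_mono)
    fix d assume d: "d \<in> PiE S (\<lambda>_. {..\<Delta>})"
    define X where "X = {F \<in> bounded_forests \<Delta> S. r F = d}"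
    have X: "X \<subseteq> forests_with_degrees S d"
      by (auto simp: X_def r_def forests_with_degrees_def bounded_forests_def)
    have "(\<Sum>F\<in>X. w ^ card F) \<le> fact k * w ^ k * exp (\<alpha>\<^sup>2 / w) * (\<Prod>v\<in>S. g (d v))"
    proof (cases "X = {}")
      case True
      then show ?thesis
        using w g_pos by (simp add: prod_nonneg less_imp_le)
    next
      case False
      define e where "e = (\<Sum>v\<in>S. d v) div 2"
      have card_e: "2 * card F = (\<Sum>v\<in>S. d v)" if "F \<in> X" for F
        using that X sum_degree_in[OF fin, of F] by (auto simp: forests_with_degrees_def)
      then have sum_d: "(\<Sum>v\<in>S. d v) = 2 * e" and ce: "\<And>F. F \<in> X \<Longrightarrow> card F = e"
        using False unfolding e_def by (metis dvd_mult_div_cancel dvd_triv_left ex_in_conv,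
          metis nonzero_mult_div_cancel_left zero_neq_numeral)
      define Z where "Z = {v\<in>S. d v = 0}"
      define N where "N = {v\<in>S. 0 < d v}"
      define n where "n = card N"
      define z where "z = card Z"
      have fin': "finite Z" "finite N" and dis: "Z \<inter> N = {}" "S = Z \<union> N"
        using fin by (auto simp: Z_def N_def)
      have kzn: "k = z + n"
        unfolding k_def dis(2) z_def n_def using fin' dis(1) by (rule card_Un_disjoint)
      obtain F where F: "F \<in> X"
        using False by auto
      then have F': "F \<subseteq> all_pairs S" "acyclic_edges F" "\<And>v. v \<in> S \<Longrightarrow> degree_in F v = d v"
        using X by (auto simp: forests_with_degrees_def)
      have "\<Union>F = N"
        unfolding Union_eq_degree_pos[OF fin F'(1)] N_def using F'(3) by auto
      then have en: "e \<le> n"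
        using card_acyclic_edges_le[OF fin F'(1,2)] ce[OF F] by (simp add: n_def)
      define c where "c = n - e"
      define Q :: real where "Q = (\<Prod>v\<in>S. fact (d v - 1))"
      have Q: "0 < Q"
        unfolding Q_def by (intro prod_pos) auto
      have Qn: "Q = (\<Prod>v\<in>N. fact (d v - 1))"
        unfolding Q_def using fin by (intro prod.mono_neutral_right) (auto simp: N_def)
      have "(\<Sum>F\<in>X. w ^ card F) = real (card X) * w ^ e"
        using ce by simp
      also have "\<dots> \<le> (fact n / fact c / Q) * w ^ e"
      proof (rule mult_right_mono)
        have "real (card X) * Q \<le> real (card (forests_with_degrees S d)) * Q"
          using Q X fin by (intro mult_right_mono of_nat_mono card_mono) auto
        also have "\<dots> \<le> fact n / fact c"
          using card_forests_with_degrees_le[OF fin sum_d] en by (simp add: Q_def n_def N_def c_def)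
        finally show "real (card X) \<le> fact n / fact c / Q"
          using Q by (simp add: field_simps)
      qed (use w in auto)
      also have "\<dots> \<le> (fact k * (exp 1 / real k) ^ z * (exp (\<alpha>\<^sup>2 / w) * (w / \<alpha>\<^sup>2) ^ c) / Q) * w ^ e"
      proof -
        have "(real k / exp 1) ^ z \<le> fact k / fact (k - z)"
          by (rule fact_quotient_ge) (simp add: kzn)
        moreover have "k - z = n"
          by (simp add: kzn)
        ultimately have 1: "fact n \<le> fact k * (exp 1 / real k) ^ z"
          using k by (simp add: field_simps power_divide)
        \<comment> \<open>The argument is chosen so that \<open>(w / \<alpha>\<^sup>2) ^ c\<close>
          supplies the power \<open>w ^ c\<close> missing from \<open>w ^ e\<close> and the power of
          \<alpha> that the weights \<open>g\<close> produce.\<close>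
        have "(\<alpha>\<^sup>2 / w) ^ c / fact c \<le> exp (\<alpha>\<^sup>2 / w)"
          using w by (intro power_div_fact_le_exp) auto
        then have 2: "1 / fact c \<le> exp (\<alpha>\<^sup>2 / w) * (w / \<alpha>\<^sup>2) ^ c"
          using w \<alpha> by (simp add: field_simps power_divide)
        have "fact n * (1 / fact c) \<le> (fact k * (exp 1 / real k) ^ z) * (exp (\<alpha>\<^sup>2 / w) * (w / \<alpha>\<^sup>2) ^ c)"
          by (rule mult_mono[OF 1 2]) auto
        then show ?thesis
          using Q w by (intro mult_right_mono divide_right_mono) (auto simp: mult_ac)
      qed
      also have "\<dots> = fact k * w ^ k * exp (\<alpha>\<^sup>2 / w) * (\<Prod>v\<in>S. g (d v))"
      proof -
        have "(\<Prod>v\<in>S. g (d v)) = (\<Prod>v\<in>Z. g (d v)) * (\<Prod>v\<in>N. g (d v))"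
          unfolding dis(2) using fin' dis(1) by (rule prod.union_disjoint)
        also have "(\<Prod>v\<in>Z. g (d v)) = (exp 1 / (real k * w)) ^ z"
          by (simp add: Z_def g_def z_def)
        also have "(\<Prod>v\<in>N. g (d v)) = (\<Prod>v\<in>N. \<alpha> ^ (d v - 1)) / \<alpha> ^ n / Q"
          unfolding Qn n_def by (subst prod_constant[symmetric], subst prod_dividef[symmetric],
            subst prod_dividef[symmetric]) (auto intro!: prod.cong simp: g_def N_def)
        also have "(\<Prod>v\<in>N. \<alpha> ^ (d v - 1)) = \<alpha> ^ (\<Sum>v\<in>N. d v - 1)"
          by (simp add: power_sum)
        also have "(\<Sum>v\<in>N. d v - 1) = 2 * e - n"
        proof -
          have "(\<Sum>v\<in>N. d v - 1) = (\<Sum>v\<in>N. d v) - (\<Sum>v\<in>N. 1)"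
            by (rule sum_subtractf_nat) (auto simp: N_def)
          also have "(\<Sum>v\<in>N. d v) = (\<Sum>v\<in>S. d v)"
            using fin by (intro sum.mono_neutral_left) (auto simp: N_def)
          finally show ?thesis
            using sum_d by (simp add: n_def)
        qed
        finally have eq: "(\<Prod>v\<in>S. g (d v)) = (exp 1 / (real k * w)) ^ z * (\<alpha> ^ (2 * e - n) / \<alpha> ^ n / Q)" .
        have "n \<le> 2 * e"
        proof -
          have "(\<Sum>v\<in>N. 1) \<le> (\<Sum>v\<in>N. d v)"
            by (intro sum_mono) (auto simp: N_def)
          also have "\<dots> = (\<Sum>v\<in>S. d v)"
            using fin by (intro sum.mono_neutral_left) (auto simp: N_def)
          finally show ?thesis
            using sum_d by (simp add: n_def)
        qed
        \<comment> \<open>\<open>2 * e - n\<close> is the sum of the numbers \<open>d v - 1\<close>;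
          against \<open>\<alpha> ^ n\<close> it leaves \<alpha> with the exponent - 2 c.\<close>
        then have n_eq: "n = 2 * e - n + 2 * c"
          using en by (simp add: c_def)
        have "\<alpha> ^ (2 * e - n) / \<alpha> ^ n = 1 / (\<alpha>\<^sup>2) ^ c"
          using \<alpha> by (subst (2) n_eq) (simp add: power_add power_mult)
        moreover have "k = z + (c + e)"
          using en by (simp add: c_def kzn)
        then have "w ^ k = w ^ z * (w ^ c * w ^ e)"
          by (simp only: power_add)
        ultimately show ?thesis
          unfolding eq power_divide power_mult_distrib using w \<alpha> k Q by (simp add: mult_ac)
      qed
      finally show ?thesis .
    qed
    then show "(\<Sum>F\<in>{F \<in> bounded_forests \<Delta> S. r F = d}. w ^ card F)
        \<le> fact k * w ^ k * exp (\<alpha>\<^sup>2 / w) * (\<Prod>v\<in>S. g (d v))"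
      by (simp add: X_def)
  qed
  also have "\<dots> = fact k * w ^ k * exp (\<alpha>\<^sup>2 / w) * (\<Sum>d\<in>PiE S (\<lambda>_. {..\<Delta>}). \<Prod>v\<in>S. g (d v))"
    by (simp add: sum_distrib_left)
  also have "(\<Sum>d\<in>PiE S (\<lambda>_. {..\<Delta>}). \<Prod>v\<in>S. g (d v)) = (\<Prod>v\<in>S. \<Sum>j\<le>\<Delta>. g j)"
    using fin by (intro prod_sum_PiE[symmetric]) auto
  also have "(\<Sum>j\<le>\<Delta>. g j) = a + exp 1 / (real k * w)"
  proof -
    have "(\<Sum>j\<le>\<Delta>. g j) = g 0 + (\<Sum>j<\<Delta>. g (Suc j))"
      by (rule sum.atMost_shift)
    also have "(\<Sum>j<\<Delta>. g (Suc j)) = (\<Sum>j<\<Delta>. \<alpha> ^ j / fact j) / \<alpha>"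
      by (simp add: g_def sum_divide_distrib mult.commute)
    also have "\<dots> = a"
      using \<gamma> \<alpha> by (simp add: gamma_poly_def)
    finally show ?thesis
      by (simp add: g_def)
  qed
  also have "(\<Prod>v\<in>S. a + exp 1 / (real k * w)) \<le> a ^ k * exp (exp 1 / a / w)"
  proof -
    have "a + exp 1 / (real k * w) = a * (1 + exp 1 / a / (real k * w))"
      using a k w by (simp add: field_simps)
    then have "(\<Prod>v\<in>S. a + exp 1 / (real k * w)) = a ^ k * (1 + exp 1 / a / (real k * w)) ^ k"
      by (simp add: k_def power_mult_distrib)
    moreover have "(1 + exp 1 / a / (real k * w)) ^ k \<le> exp (exp 1 / a / (real k * w)) ^ k"
      using a w by (intro power_mono exp_ge_add_one_self) auto
    moreover have "exp (exp 1 / a / (real k * w)) ^ k = exp (exp 1 / a / w)"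
      using k by (simp flip: exp_of_nat_mult)
    ultimately show ?thesis
      using a by (metis mult_left_mono less_imp_le zero_le_power less_trans zero_less_one)
  qed
  finally have "(\<Sum>F\<in>bounded_forests \<Delta> S. w ^ card F) \<le>
      fact k * w ^ k * exp (\<alpha>\<^sup>2 / w) * (a ^ k * exp (exp 1 / a / w))"
    using w by (simp add: mult_left_mono)
  also have "\<dots> = fact k * (a * w) ^ k * exp ((\<alpha>\<^sup>2 + exp 1 / a) / w)"
    by (simp add: power_mult_distrib exp_add add_divide_distrib)
  finally show ?thesis
    by (simp add: k_def)
qed

section \<open>Counting trees of bounded degree\<close>

definition trees_with_degrees :: "'a set \<Rightarrow> ('a \<Rightarrow> nat) \<Rightarrow> 'a set set set" where
  "trees_with_degrees V d = {T. T \<subseteq> all_pairs V \<and> acyclic_edges T \<and> Suc (card T) = card V \<and>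
     (\<forall>v\<in>V. degree_in T v = d v)}"

lemma finite_trees_with_degrees [intro, simp]:
  "finite V \<Longrightarrow> finite (trees_with_degrees V d)"
  by (rule finite_subset[of _ "Pow (all_pairs V)"]) (auto simp: trees_with_degrees_def)

lemma insert_leaf_trees_with_degrees:
  assumes "finite V" "v \<in> V" "d v = 1" "w \<in> V - {v}" "2 \<le> d w"
    and T: "T \<in> trees_with_degrees (V - {v}) (d(w := d w - 1))"
  shows "insert {v, w} T \<in> trees_with_degrees V d"
proof -
  have TV: "T \<subseteq> all_pairs (V - {v})" and "acyclic_edges T" "Suc (card T) = card (V - {v})"
    and deg: "\<And>u. u \<in> V - {v} \<Longrightarrow> degree_in T u = (d(w := d w - 1)) u"
    using T by (auto simp: trees_with_degrees_def)
  have finT: "finite T"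
    using TV finite_all_pairs[of "V - {v}"] assms(1) by (auto intro: finite_subset)
  have vT: "v \<notin> \<Union>T"
    using TV by (auto simp: all_pairs_def)
  then have notin: "{v, w} \<notin> T"
    by blast
  show ?thesis
    unfolding trees_with_degrees_def
  proof (intro CollectI conjI ballI)
    show "insert {v, w} T \<subseteq> all_pairs V"
      using TV all_pairs_mono[of "V - {v}" V] assms(2,4) pair_in_all_pairs[of v w V] by auto
    show "acyclic_edges (insert {v, w} T)"
      by (rule acyclic_edges_insert) fact+
    have "0 < card V"
      using assms(1,2) card_gt_0_iff by blast
    then show "Suc (card (insert {v, w} T)) = card V"
      using \<open>Suc (card T) = card (V - {v})\<close> finT notin assms(1,2) by simp
    fix u assume u: "u \<in> V"
    show "degree_in (insert {v, w} T) u = d u"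
    proof (cases "u = v")
      case True
      then show ?thesis
        using degree_in_insert[OF finT notin, of u] degree_in_eq_0[OF vT] assms(3) by simp
    next
      case False
      then show ?thesis
        using degree_in_insert[OF finT notin, of u] deg[of u] u assms(5) by auto
    qed
  qed
qed

text \<open>The lower half of the refinement of Cayley's formula by degrees. A leaf \<open>v\<close>
  is fixed and attached to each \<open>w\<close> with \<open>2 \<le> d w\<close>. Different
  \<open>w\<close> give different trees, the recursion multiplies by \<open>d w - 1\<close>, and
  these factors sum to the new value of \<open>n\<close>.\<close>

lemma card_trees_with_degrees_ge:
  assumes "finite V" "card V = n + 2" "\<And>v. v \<in> V \<Longrightarrow> 1 \<le> d v" "(\<Sum>v\<in>V. d v - 1) = n"
  shows "fact n \<le> card (trees_with_degrees V d) * (\<Prod>v\<in>V. fact (d v - 1))"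
  using assms
proof (induction n arbitrary: V d)
  case 0
  then obtain x y where xy: "V = {x, y}" "x \<noteq> y"
    by (metis add_0 card_2_iff)
  have d: "d v = 1" if "v \<in> V" for v
    using that 0(3)[OF that] 0(1,4) by (simp add: le_antisym)
  have "{{x, y}} \<in> trees_with_degrees V d"
    unfolding trees_with_degrees_def
  proof (intro CollectI conjI ballI)
    show "{{x, y}} \<subseteq> all_pairs V"
      using xy by (auto simp: pair_in_all_pairs)
    show "acyclic_edges {{x, y}}"
      by (rule acyclic_edges_insert) auto
    show "Suc (card {{x, y}}) = card V"
      using xy by simp
    fix v assume "v \<in> V"
    then have "{e \<in> {{x, y}}. v \<in> e} = {{x, y}}"
      using xy by blast
    then show "degree_in {{x, y}} v = d v"
      using d[OF \<open>v \<in> V\<close>] by (simp add: degree_in_def)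
  qed
  then have "1 \<le> card (trees_with_degrees V d)"
    using 0 by (metis One_nat_def Suc_leI card_gt_0_iff empty_iff finite_trees_with_degrees)
  then show ?case
    using d by simp
next
  case (Suc n)
  \<comment> \<open>The numbers \<open>d v - 1\<close> sum to two less than the number of vertices,
    so one of them is 0.\<close>
  have "\<exists>v\<in>V. d v = 1"
  proof (rule ccontr)
    assume "\<not> ?thesis"
    then have "1 \<le> d v - 1" if "v \<in> V" for v
      using Suc.prems(3)[OF that] that by fastforce
    then have "(\<Sum>v\<in>V. 1) \<le> (\<Sum>v\<in>V. d v - 1)"
      by (rule sum_mono)
    then show False
      using Suc.prems by simp
  qed
  then obtain v where v: "v \<in> V" "d v = 1"
    by blast
  define V' where "V' = V - {v}"
  define W where "W = {w \<in> V'. 2 \<le> d w}"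
  define dw where "dw w = d(w := d w - 1)" for w
  define Q where "Q = (\<Prod>v\<in>V. fact (d v - 1) :: nat)"
  have fin: "finite V" "finite V'" "finite W"
    using Suc.prems(1) by (auto simp: V'_def W_def)
  have cV': "card V' = n + 2"
    using Suc.prems v by (simp add: V'_def)
  have sumV': "(\<Sum>u\<in>V'. d u - 1) = Suc n"
    using Suc.prems(4) v fin by (simp add: V'_def sum.remove[of V v])
  have sumW: "(\<Sum>w\<in>W. d w - 1) = Suc n"
    unfolding sumV'[symmetric] using fin by (intro sum.mono_neutral_left) (auto simp: W_def)
  have step: "fact n * (d w - 1) \<le> card (trees_with_degrees V' (dw w)) * Q" if "w \<in> W" for w
  proof -
    have w: "w \<in> V'" "2 \<le> d w" "w \<noteq> v"
      using that by (auto simp: W_def V'_def)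
    have rest: "(\<Sum>u\<in>V'-{w}. dw w u - 1) = (\<Sum>u\<in>V'-{w}. d u - 1)"
      "(\<Prod>u\<in>V'-{w}. fact (dw w u - 1)) = (\<Prod>u\<in>V'-{w}. fact (d u - 1) :: nat)"
      by (auto intro!: sum.cong prod.cong simp: dw_def)
    have "(\<Sum>u\<in>V'. dw w u - 1) = n"
      using sumV' rest(1) w fin by (simp add: sum.remove[of V' w] dw_def)
    moreover have "1 \<le> dw w u" if "u \<in> V'" for u
      using Suc.prems(3)[of u] that w by (auto simp: dw_def V'_def)
    ultimately have IH: "fact n \<le> card (trees_with_degrees V' (dw w)) * (\<Prod>u\<in>V'. fact (dw w u - 1))"
      using Suc.IH[of V' "dw w"] fin cV' by blast
    have "Q = (\<Prod>u\<in>V'. fact (d u - 1))"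
      using v fin by (simp add: Q_def V'_def prod.remove[of V v])
    also have "\<dots> = fact (d w - 1) * (\<Prod>u\<in>V'-{w}. fact (d u - 1))"
      by (rule prod.remove[OF fin(2) w(1)])
    also have "fact (d w - 1) = (d w - 1) * fact (d w - 1 - 1)"
      using w by (subst fact_reduce) auto
    also have "(d w - 1) * fact (d w - 1 - 1) * (\<Prod>u\<in>V'-{w}. fact (d u - 1)) =
        (\<Prod>u\<in>V'. fact (dw w u - 1)) * (d w - 1)"
      using w fin rest(2) by (simp add: prod.remove[of V' w] dw_def)
    finally show ?thesis
      using mult_right_mono[OF IH, of "d w - 1"] by (simp add: mult_ac)
  qed
  \<comment> \<open>The only edge at \<open>v\<close> is \<open>{v, w}\<close>; it recovers
    \<open>w\<close> and then \<open>T\<close>.\<close>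
  have inj: "inj_on (\<lambda>(w, T). insert {v, w} T) (Sigma W (\<lambda>w. trees_with_degrees V' (dw w)))"
  proof (rule inj_onI, clarify)
    fix w T w' T'
    assume *: "w \<in> W" "w' \<in> W" "T \<in> trees_with_degrees V' (dw w)" "T' \<in> trees_with_degrees V' (dw w')"
      "insert {v, w} T = insert {v, w'} T'"
    have "v \<notin> \<Union>T" "v \<notin> \<Union>T'"
      using *(3,4) by (auto simp: trees_with_degrees_def all_pairs_def V'_def)
    then have "{e \<in> insert {v, w} T. v \<in> e} = {{v, w}}" "{e \<in> insert {v, w'} T'. v \<in> e} = {{v, w'}}"
      "{v, w} \<notin> T" "{v, w'} \<notin> T'"
      by blast+
    then show "w = w' \<and> T = T'"
      using *(5) by (metis doubleton_eq_iff insert_ident singleton_inject)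
  qed
  have "(\<Sum>w\<in>W. card (trees_with_degrees V' (dw w))) = card (Sigma W (\<lambda>w. trees_with_degrees V' (dw w)))"
    using fin by (subst card_SigmaI) auto
  also have "\<dots> \<le> card (trees_with_degrees V d)"
  proof (rule card_inj_on_le[OF inj])
    show "(\<lambda>(w, T). insert {v, w} T) ` Sigma W (\<lambda>w. trees_with_degrees V' (dw w)) \<subseteq> trees_with_degrees V d"
      using insert_leaf_trees_with_degrees[of V v d] fin v
      by (auto simp: W_def V'_def dw_def)
  qed (use fin in auto)
  finally have le: "(\<Sum>w\<in>W. card (trees_with_degrees V' (dw w))) \<le> card (trees_with_degrees V d)" .
  have "fact (Suc n) = fact n * (\<Sum>w\<in>W. d w - 1)"
    by (simp only: sumW fact_Suc of_nat_id mult.commute)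
  also have "\<dots> = (\<Sum>w\<in>W. fact n * (d w - 1))"
    by (rule sum_distrib_left)
  also have "\<dots> \<le> (\<Sum>w\<in>W. card (trees_with_degrees V' (dw w)) * Q)"
    by (rule sum_mono[OF step])
  also have "\<dots> = (\<Sum>w\<in>W. card (trees_with_degrees V' (dw w))) * Q"
    by (rule sum_distrib_right[symmetric])
  also have "\<dots> \<le> card (trees_with_degrees V d) * Q"
    by (rule mult_right_mono[OF le]) simp
  finally show ?case
    by (simp add: Q_def)
qed

definition bounded_trees :: "nat \<Rightarrow> 'a set \<Rightarrow> 'a set set set" where
  "bounded_trees \<Delta> V = {T. T \<subseteq> all_pairs V \<and> acyclic_edges T \<and> Suc (card T) = card V \<and>
     (\<forall>v\<in>V. degree_in T v \<le> \<Delta>)}"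

lemma finite_bounded_trees [intro, simp]: "finite V \<Longrightarrow> finite (bounded_trees \<Delta> V)"
  by (rule finite_subset[of _ "Pow (all_pairs V)"]) (auto simp: bounded_trees_def)

text \<open>\<open>b v\<close> stands for the degree of \<open>v\<close> minus one, whence the range
  below \<Delta> and the total \<open>card V - 2\<close>. Families belonging to different
  \<open>b\<close> are disjoint, so their sizes add up.\<close>

lemma card_bounded_trees_ge_sum:
  assumes "finite V" "card V = n + 2" "B \<subseteq> {b \<in> PiE V (\<lambda>_. {..<\<Delta>}). (\<Sum>v\<in>V. b v) = n}"
  shows "(\<Sum>b\<in>B. fact n / (\<Prod>v\<in>V. fact (b v))) \<le> real (card (bounded_trees \<Delta> V))"
proof -
  define t where "t b = trees_with_degrees V (\<lambda>v. Suc (b v))" for b :: "'a \<Rightarrow> nat"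
  have finB: "finite B"
    by (rule finite_subset[of _ "PiE V (\<lambda>_. {..<\<Delta>})"]) (use assms(1,3) in \<open>auto intro: finite_PiE\<close>)
  have "(\<Sum>b\<in>B. fact n / (\<Prod>v\<in>V. fact (b v))) \<le> (\<Sum>b\<in>B. real (card (t b)))"
  proof (rule sum_mono)
    fix b assume b: "b \<in> B"
    then have "fact n \<le> card (t b) * (\<Prod>v\<in>V. fact (Suc (b v) - 1))"
      unfolding t_def using assms by (intro card_trees_with_degrees_ge) auto
    then have "real (fact n) \<le> real (card (t b) * (\<Prod>v\<in>V. fact (b v)))"
      by (simp only: of_nat_le_iff diff_Suc_1)
    then have "fact n \<le> real (card (t b)) * (\<Prod>v\<in>V. fact (b v))"
      by (simp only: of_nat_mult of_nat_prod of_nat_fact)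
    moreover have "0 < (\<Prod>v\<in>V. fact (b v) :: real)"
      by (intro prod_pos) auto
    ultimately show "fact n / (\<Prod>v\<in>V. fact (b v)) \<le> real (card (t b))"
      by (simp add: divide_le_eq)
  qed
  also have "\<dots> = real (card (\<Union>b\<in>B. t b))"
  proof -
    have "t b \<inter> t b' = {}" if "b \<in> B" "b' \<in> B" "b \<noteq> b'" for b b'
    proof (rule ccontr)
      assume "t b \<inter> t b' \<noteq> {}"
      then have "\<And>v. v \<in> V \<Longrightarrow> b v = b' v"
        by (force simp: t_def trees_with_degrees_def)
      moreover have "b \<in> PiE V (\<lambda>_. {..<\<Delta>})" "b' \<in> PiE V (\<lambda>_. {..<\<Delta>})"
        using that assms(3) by auto
      ultimately have "b = b'"
        by (intro PiE_ext) auto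
      with that show False by simp
    qed
    then show ?thesis
      using finB assms(1) by (subst card_UN_disjoint) (auto simp: t_def)
  qed
  also have "\<dots> \<le> real (card (bounded_trees \<Delta> V))"
  proof (intro of_nat_mono card_mono)
    show "(\<Union>b\<in>B. t b) \<subseteq> bounded_trees \<Delta> V"
      using assms(3) by (force simp: t_def trees_with_degrees_def bounded_trees_def PiE_def Pi_def)
  qed (use assms(1) in auto)
  finally show ?thesis .
qed


section \<open>Sums of independent variables and the growth rate of the number of trees\<close>

lemma sum_PiE_insert:
  assumes "x \<notin> S"
  shows "(\<Sum>b\<in>PiE (insert x S) (\<lambda>_. D). f b) = (\<Sum>y\<in>D. \<Sum>b\<in>PiE S (\<lambda>_. D). f (b(x := y)))"
  using assms inj_combinator[of x S "\<lambda>_. D"]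
  by (simp add: PiE_insert_eq sum.reindex sum.cartesian_product split_def)

text \<open>Total mass, mean and second moment of a sum of independent centred variables with law
  \<open>w\<close>. They are kept as weighted sums over functions because these are later compared
  with tree counts term by term.\<close>

lemma sum_PiE_moments:
  fixes w x :: "nat \<Rightarrow> real"
  assumes "finite S" and one: "(\<Sum>j\<in>D. w j) = 1" and zero: "(\<Sum>j\<in>D. w j * x j) = 0"
  shows "(\<Sum>b\<in>PiE S (\<lambda>_. D). \<Prod>v\<in>S. w (b v)) = 1"
    and "(\<Sum>b\<in>PiE S (\<lambda>_. D). (\<Prod>v\<in>S. w (b v)) * (\<Sum>v\<in>S. x (b v))) = 0"
    and "(\<Sum>b\<in>PiE S (\<lambda>_. D). (\<Prod>v\<in>S. w (b v)) * (\<Sum>v\<in>S. x (b v))\<^sup>2) =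
      real (card S) * (\<Sum>j\<in>D. w j * (x j)\<^sup>2)"
  using assms(1)
proof (induction S rule: finite_induct)
  case (insert s S)
  let ?E = "PiE S (\<lambda>_. D)"
  have P: "(\<Prod>v\<in>insert s S. w ((b(s := y)) v)) = w y * (\<Prod>v\<in>S. w (b v))" for b y
    using insert.hyps by (auto intro!: prod.cong)
  have X: "(\<Sum>v\<in>insert s S. x ((b(s := y)) v)) = x y + (\<Sum>v\<in>S. x (b v))" for b y
    using insert.hyps by (auto intro!: sum.cong)
  note IH = insert.IH
  {
    case 1
    show ?case
      unfolding sum_PiE_insert[OF insert.hyps(2)] P
      using IH(1) one by (simp flip: sum_distrib_left)
  next
    case 2
    have "(\<Sum>y\<in>D. \<Sum>b\<in>?E. w y * F b * (x y + G b)) =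
      (\<Sum>y\<in>D. w y * x y * (\<Sum>b\<in>?E. F b) + w y * (\<Sum>b\<in>?E. F b * G b))"
      for F G :: "('a \<Rightarrow> nat) \<Rightarrow> real"
      by (simp add: sum_distrib_left sum.distrib algebra_simps)
    then show ?case
      unfolding sum_PiE_insert[OF insert.hyps(2)] P X
      using IH zero by simp
  next
    case 3
    have gen: "(\<Sum>y\<in>D. \<Sum>b\<in>?E. w y * F b * (x y + G b)\<^sup>2) =
      (\<Sum>y\<in>D. w y * (x y)\<^sup>2 * (\<Sum>b\<in>?E. F b) + 2 * (w y * x y) * (\<Sum>b\<in>?E. F b * G b) +
        w y * (\<Sum>b\<in>?E. F b * (G b)\<^sup>2))" for F G :: "('a \<Rightarrow> nat) \<Rightarrow> real"
      by (simp add: sum_distrib_left sum_distrib_right sum.distrib algebra_simps power2_sum)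
    have "(\<Sum>y\<in>D. \<Sum>b\<in>?E. w y * (\<Prod>v\<in>S. w (b v)) * (x y + (\<Sum>v\<in>S. x (b v)))\<^sup>2) = (\<Sum>y\<in>D. w y * (x y)\<^sup>2) + (\<Sum>y\<in>D. w y) * (real (card S) * (\<Sum>j\<in>D. w j * (x j)\<^sup>2))"
      unfolding gen using IH by (simp add: sum.distrib sum_distrib_right)
    also have "\<dots> = real (card (insert s S)) * (\<Sum>j\<in>D. w j * (x j)\<^sup>2)"
      using one insert.hyps by (simp add: algebra_simps)
    finally show ?case
      unfolding sum_PiE_insert[OF insert.hyps(2)] P X .
  }
qed auto

lemma sum_PiE_Chebyshev:
  fixes w x :: "nat \<Rightarrow> real"
  assumes fin: "finite S" "finite D" and one: "(\<Sum>j\<in>D. w j) = 1" and zero: "(\<Sum>j\<in>D. w j * x j) = 0"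
    and w: "\<And>j. j \<in> D \<Longrightarrow> 0 \<le> w j" and x: "\<And>j. j \<in> D \<Longrightarrow> \<bar>x j\<bar> \<le> M"
    and s: "0 < s" "2 * real (card S) * M\<^sup>2 \<le> s\<^sup>2"
  shows "1 / 2 \<le> (\<Sum>b\<in>{b \<in> PiE S (\<lambda>_. D). \<bar>\<Sum>v\<in>S. x (b v)\<bar> \<le> s}. \<Prod>v\<in>S. w (b v))"
proof -
  let ?E = "PiE S (\<lambda>_. D)"
  define W where "W b = (\<Prod>v\<in>S. w (b v))" for b
  define X where "X b = (\<Sum>v\<in>S. x (b v))" for b
  have finE: "finite ?E"
    using fin by (intro finite_PiE) auto
  have W: "0 \<le> W b" if "b \<in> ?E" for b
    unfolding W_def using that w by (intro prod_nonneg) auto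
  note mom = sum_PiE_moments[OF fin(1) one zero, folded W_def X_def]
  have "(\<Sum>j\<in>D. w j * (x j)\<^sup>2) \<le> (\<Sum>j\<in>D. w j * M\<^sup>2)"
    using w x by (intro sum_mono mult_left_mono) (auto simp: abs_le_square_iff[symmetric] intro: order_trans[OF _ abs_ge_self])
  also have "\<dots> = M\<^sup>2"
    using one by (simp flip: sum_distrib_right)
  finally have var: "(\<Sum>b\<in>?E. W b * (X b)\<^sup>2) \<le> s\<^sup>2 / 2"
    unfolding mom(3) using s(2) mult_left_mono[of "\<Sum>j\<in>D. w j * (x j)\<^sup>2" "M\<^sup>2" "real (card S)"] by simp
  have "(\<Sum>b\<in>?E. W b) \<le> (\<Sum>b\<in>?E. (if \<bar>X b\<bar> \<le> s then W b else 0) + W b * (X b)\<^sup>2 / s\<^sup>2)"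
  proof (rule sum_mono)
    fix b assume b: "b \<in> ?E"
    show "W b \<le> (if \<bar>X b\<bar> \<le> s then W b else 0) + W b * (X b)\<^sup>2 / s\<^sup>2"
    proof (cases "\<bar>X b\<bar> \<le> s")
      case False
      then have "s\<^sup>2 \<le> (X b)\<^sup>2"
        using s(1) by (subst abs_le_square_iff[symmetric]) simp
      then have "W b * 1 \<le> W b * ((X b)\<^sup>2 / s\<^sup>2)"
        using W[OF b] s(1) by (intro mult_left_mono) auto
      then show ?thesis
        using False by simp
    qed (use W[OF b] in simp)
  qed
  also have "\<dots> = (\<Sum>b\<in>{b \<in> ?E. \<bar>X b\<bar> \<le> s}. W b) + (\<Sum>b\<in>?E. W b * (X b)\<^sup>2) / s\<^sup>2"
    using finE by (simp add: sum.distrib sum_divide_distrib sum.inter_filter)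
  also have "(\<Sum>b\<in>?E. W b * (X b)\<^sup>2) / s\<^sup>2 \<le> 1 / 2"
    using var s(1) by (simp add: divide_le_eq)
  finally show ?thesis
    using mom(1) by (simp add: W_def X_def)
qed

text \<open>A greedy choice: each element takes \<open>min r 2\<close>. This spreads a missing
  amount of degree over reserve vertices.\<close>

lemma ex_PiE_atMost_2_sum:
  assumes "finite S" "r \<le> 2 * card S"
  shows "\<exists>b\<in>PiE S (\<lambda>_. {..2::nat}). (\<Sum>v\<in>S. b v) = r"
  using assms
proof (induction S arbitrary: r rule: finite_induct)
  case (insert x S)
  have "r - 2 \<le> 2 * card S"
    using insert by simp
  then obtain b where b: "b \<in> PiE S (\<lambda>_. {..2})" "(\<Sum>v\<in>S. b v) = r - 2"
    using insert.IH by blast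
  have "(\<Sum>v\<in>insert x S. (b(x := min r 2)) v) = min r 2 + (\<Sum>v\<in>S. b v)"
    using insert.hyps by (auto intro!: sum.cong)
  then have "(\<Sum>v\<in>insert x S. (b(x := min r 2)) v) = r"
    using b(2) by simp
  moreover have "b(x := min r 2) \<in> PiE (insert x S) (\<lambda>_. {..2})"
    using b(1) by (intro PiE_fun_upd) auto
  ultimately show ?case
    by blast
qed auto


text \<open>Degrees drawn from the tilted law have the right total only approximately. The law is
  therefore used on a set \<open>S\<close> of \<open>k\<close> vertices, where the total of the
  degrees minus one deviates from \<open>k\<close> by at most \<open>s\<close> with probability at
  least 1/2, and \<open>s + 2\<close> reserve vertices \<open>R\<close> correct the total to exactly
  \<open>k + s\<close>. They have to absorb at most \<open>2 * s\<close>, so values up to 2 suffice,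
  which are below \<Delta>.\<close>

lemma card_bounded_trees_ge_explicit:
  assumes D: "3 \<le> \<Delta>" and fin: "finite V" and card: "card V = k + s + 2" and "0 < s"
    and s: "2 * real k * (real \<Delta>)\<^sup>2 \<le> (real s)\<^sup>2"
  defines "\<alpha> \<equiv> alpha_const \<Delta>" and "a \<equiv> a_const \<Delta>"
  shows "fact (k + s) * (a ^ k / \<alpha> ^ s / 2 ^ (s + 3)) \<le> real (card (bounded_trees \<Delta> V))"
proof -
  have \<alpha>: "1 < \<alpha>" and a: "1 < a" and \<gamma>: "gamma_poly \<Delta> \<alpha> = \<alpha> * a"
    and a_def': "a = gamma_poly (\<Delta> - 1) \<alpha>"
    using alpha_const_gt_1[OF D] alpha_const_eq[OF D] a_const_gt_1[OF D]
    by (auto simp: \<alpha>_def a_def a_const_def)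
  obtain S where S: "S \<subseteq> V" "card S = k"
    using obtain_subset_with_card_n[of k V] card by auto
  define R where "R = V - S"
  have finS: "finite S" "finite R" and V: "V = S \<union> R" "S \<inter> R = {}" and cR: "card R = s + 2"
    using S fin card finite_subset[OF S(1)] by (auto simp: R_def card_Diff_subset)
  \<comment> \<open>The weights \<open>\<alpha> ^ j / fact j\<close>, normalised by
    \<open>gamma_poly \<Delta> \<alpha> = \<alpha> * a\<close>. Their mean is 1 because
    \<open>a\<close> is also \<open>gamma_poly (\<Delta> - 1) \<alpha>\<close>; this is where the
    equation defining \<alpha> is used.\<close>
  define w where "w j = \<alpha> ^ j / fact j / (\<alpha> * a)" for j :: nat
  define x where "x j = real j - 1" for j :: nat
  define E where "E = {b \<in> PiE S (\<lambda>_. {..<\<Delta>}). \<bar>\<Sum>v\<in>S. x (b v)\<bar> \<le> real s}"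
  have finE: "finite E"
    unfolding E_def using finS by (auto intro!: finite_PiE)
  have one: "(\<Sum>j<\<Delta>. w j) = 1"
    unfolding w_def sum_divide_distrib[symmetric] using \<gamma> \<alpha> a by (simp add: gamma_poly_def)
  have "(\<Sum>j<\<Delta>. w j * real j) = 1"
  proof -
    have "(\<Sum>j<\<Delta>. w j * real j) = (\<Sum>j<Suc (\<Delta> - 1). w j * real j)"
      using D by simp
    also have "\<dots> = (\<Sum>j<\<Delta> - 1. w (Suc j) * real (Suc j))"
      by (subst sum.lessThan_Suc_shift) simp
    also have "\<dots> = (\<Sum>j<\<Delta> - 1. \<alpha> ^ j / fact j) / a"
      unfolding sum_divide_distrib using \<alpha> a
      by (intro sum.cong) (auto simp: w_def simp del: of_nat_Suc)
    also have "\<dots> = 1"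
      using a by (simp add: a_def' gamma_poly_def)
    finally show ?thesis .
  qed
  then have zero: "(\<Sum>j<\<Delta>. w j * x j) = 0"
    using one by (simp add: x_def right_diff_distrib sum_subtractf)
  have "1 / 2 \<le> (\<Sum>b\<in>E. \<Prod>v\<in>S. w (b v))"
    unfolding E_def
  proof (rule sum_PiE_Chebyshev[OF finS(1) _ one zero])
    show "0 \<le> w j" for j
      using \<alpha> a by (simp add: w_def)
    show "\<bar>x j\<bar> \<le> real \<Delta>" if "j \<in> {..<\<Delta>}" for j
      using that by (auto simp: x_def)
  qed (use s S(2) \<open>0 < s\<close> in auto)
  then have half: "1 / 2 * (a ^ k / \<alpha> ^ s) \<le> (\<Sum>b\<in>E. \<Prod>v\<in>S. w (b v)) * (a ^ k / \<alpha> ^ s)"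
    using a \<alpha> by (intro mult_right_mono) auto
  have sum_b: "(\<Sum>v\<in>S. b v) \<le> k + s \<and> k \<le> (\<Sum>v\<in>S. b v) + s" if "b \<in> E" for b
  proof -
    have "(\<Sum>v\<in>S. x (b v)) = real (\<Sum>v\<in>S. b v) - real k"
      using S(2) by (simp add: x_def sum_subtractf)
    then have "\<bar>real (\<Sum>v\<in>S. b v) - real k\<bar> \<le> real s"
      using that by (simp add: E_def)
    then show ?thesis by linarith
  qed
  have "\<exists>c. \<forall>b\<in>E. c b \<in> PiE R (\<lambda>_. {..2}) \<and> (\<Sum>v\<in>R. c b v) = k + s - (\<Sum>v\<in>S. b v)"
  proof (intro bchoice ballI)
    fix b assume "b \<in> E"
    then have "k + s - (\<Sum>v\<in>S. b v) \<le> 2 * card R"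
      using sum_b[of b] cR by linarith
    from ex_PiE_atMost_2_sum[OF finS(2) this]
    show "\<exists>c. c \<in> PiE R (\<lambda>_. {..2}) \<and> (\<Sum>v\<in>R. c v) = k + s - (\<Sum>v\<in>S. b v)"
      by blast
  qed
  then obtain c where c_all: "\<forall>b\<in>E. c b \<in> PiE R (\<lambda>_. {..2}) \<and> (\<Sum>v\<in>R. c b v) = k + s - (\<Sum>v\<in>S. b v)"
    by (elim exE)
  have c: "c b \<in> PiE R (\<lambda>_. {..2})" "(\<Sum>v\<in>R. c b v) = k + s - (\<Sum>v\<in>S. b v)" if "b \<in> E" for b
    using bspec[OF c_all that] by (simp_all only:)
  define m where "m b = (\<lambda>v. if v \<in> S then b v else c b v)" for b
  have inj: "inj_on m E"
  proof (rule inj_onI)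
    fix b b' assume *: "b \<in> E" "b' \<in> E" "m b = m b'"
    have "b v = b' v" if "v \<in> S" for v
      using fun_cong[OF *(3), of v] that by (simp add: m_def)
    then show "b = b'"
      using * by (intro PiE_ext[of b S "\<lambda>_. {..<\<Delta>}" b']) (auto simp: E_def)
  qed
  have mR: "m b v = c b v" if "v \<in> R" for b v
    using that V by (auto simp: m_def)
  have sub: "m ` E \<subseteq> {b \<in> PiE V (\<lambda>_. {..<\<Delta>}). (\<Sum>v\<in>V. b v) = k + s}"
  proof (intro image_subsetI CollectI conjI)
    fix b assume b: "b \<in> E"
    show "m b \<in> PiE V (\<lambda>_. {..<\<Delta>})"
    proof (rule PiE_I)
      fix v assume "v \<in> V"
      then show "m b v \<in> {..<\<Delta>}"
        using b c(1)[OF b] V D by (force simp: m_def E_def PiE_def Pi_def)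
    next
      fix v assume "v \<notin> V"
      then show "m b v = undefined"
        using c(1)[OF b] V by (auto simp: m_def intro: PiE_arb)
    qed
    have "(\<Sum>v\<in>V. m b v) = (\<Sum>v\<in>S. m b v) + (\<Sum>v\<in>R. m b v)"
      unfolding V(1) by (rule sum.union_disjoint[OF finS V(2)])
    also have "(\<Sum>v\<in>S. m b v) = (\<Sum>v\<in>S. b v)"
      by (simp add: m_def)
    also have "(\<Sum>v\<in>R. m b v) = k + s - (\<Sum>v\<in>S. b v)"
      using c(2)[OF b] mR by simp
    finally show "(\<Sum>v\<in>V. m b v) = k + s"
      using sum_b[OF b] by simp
  qed
  have term_ge: "(\<Prod>v\<in>S. w (b v)) * (a ^ k / \<alpha> ^ s) / 2 ^ (s + 2) \<le> 1 / (\<Prod>v\<in>V. fact (m b v))"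
    if b: "b \<in> E" for b
  proof -
    have "(\<Prod>v\<in>V. fact (m b v)) = (\<Prod>v\<in>S. fact (m b v)) * (\<Prod>v\<in>R. fact (m b v) :: real)"
      unfolding V(1) by (rule prod.union_disjoint[OF finS V(2)])
    also have "(\<Prod>v\<in>S. fact (m b v)) = (\<Prod>v\<in>S. fact (b v) :: real)"
      by (simp add: m_def)
    finally have eq: "(\<Prod>v\<in>V. fact (m b v)) = (\<Prod>v\<in>S. fact (b v)) * (\<Prod>v\<in>R. fact (m b v) :: real)" .
    have "(\<Prod>v\<in>R. fact (m b v) :: real) \<le> (\<Prod>v\<in>R. 2)"
    proof (intro prod_mono conjI)
      fix v assume v: "v \<in> R"
      then have "m b v \<le> 2"
        using c(1)[OF b] mR[OF v] by (auto simp: PiE_def Pi_def)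
      from fact_mono[OF this, where 'a = real] show "fact (m b v) \<le> (2 :: real)"
        by (simp add: fact_2)
    qed auto
    then have R2: "(\<Prod>v\<in>R. fact (m b v) :: real) \<le> 2 ^ (s + 2)"
      by (simp add: cR)
    have posS: "0 < (\<Prod>v\<in>S. fact (b v) :: real)" and posR: "0 < (\<Prod>v\<in>R. fact (m b v) :: real)"
      by (intro prod_pos; simp)+
    have "(\<Prod>v\<in>S. w (b v)) = (\<Prod>v\<in>S. \<alpha> ^ b v) / (\<Prod>v\<in>S. fact (b v)) / (\<Prod>v\<in>S. \<alpha> * a)"
      by (simp only: w_def prod_dividef)
    also have "\<dots> = \<alpha> ^ (\<Sum>v\<in>S. b v) / (\<Prod>v\<in>S. fact (b v)) / (\<alpha> * a) ^ k"
      using S(2) by (simp add: power_sum)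
    also have "\<dots> * (a ^ k / \<alpha> ^ s) = \<alpha> ^ (\<Sum>v\<in>S. b v) / \<alpha> ^ (k + s) / (\<Prod>v\<in>S. fact (b v))"
      using \<alpha> a by (simp add: power_mult_distrib power_add)
    \<comment> \<open>The total on \<open>S\<close> exceeds \<open>k\<close> by at most
      \<open>s\<close>; the factor \<open>1 / \<alpha> ^ s\<close> pays for this.\<close>
    also have "\<alpha> ^ (\<Sum>v\<in>S. b v) / \<alpha> ^ (k + s) \<le> 1"
      using sum_b[OF b] \<alpha> power_increasing[of "\<Sum>v\<in>S. b v" "k + s" \<alpha>] by simp
    finally have "(\<Prod>v\<in>S. w (b v)) * (a ^ k / \<alpha> ^ s) \<le> 1 / (\<Prod>v\<in>S. fact (b v))"
      using posS by (simp add: divide_right_mono)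
    then have "(\<Prod>v\<in>S. w (b v)) * (a ^ k / \<alpha> ^ s) / 2 ^ (s + 2) \<le> 1 / (\<Prod>v\<in>S. fact (b v)) / 2 ^ (s + 2)"
      by (rule divide_right_mono) simp
    also have "\<dots> \<le> 1 / (\<Prod>v\<in>S. fact (b v)) / (\<Prod>v\<in>R. fact (m b v))"
      using R2 posS posR by (intro divide_left_mono) auto
    finally show ?thesis
      unfolding eq by (simp only: divide_divide_eq_left)
  qed
  have "fact (k + s) * (a ^ k / \<alpha> ^ s / 2 ^ (s + 3)) = fact (k + s) * (1 / 2 * (a ^ k / \<alpha> ^ s) / 2 ^ (s + 2))"
    by (simp add: power_add)
  also have "\<dots> \<le> fact (k + s) * ((\<Sum>b\<in>E. \<Prod>v\<in>S. w (b v)) * (a ^ k / \<alpha> ^ s) / 2 ^ (s + 2))"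
    using half by (intro mult_left_mono divide_right_mono) auto
  also have "\<dots> = fact (k + s) * (\<Sum>b\<in>E. (\<Prod>v\<in>S. w (b v)) * (a ^ k / \<alpha> ^ s) / 2 ^ (s + 2))"
    by (simp only: sum_distrib_right sum_divide_distrib)
  also have "\<dots> \<le> fact (k + s) * (\<Sum>b\<in>E. 1 / (\<Prod>v\<in>V. fact (m b v)))"
    using term_ge by (intro mult_left_mono sum_mono) auto
  also have "\<dots> = (\<Sum>b\<in>m ` E. fact (k + s) / (\<Prod>v\<in>V. fact (b v)))"
    by (simp add: sum.reindex[OF inj] sum_distrib_left)
  also have "\<dots> \<le> real (card (bounded_trees \<Delta> V))"
    by (rule card_bounded_trees_ge_sum[OF fin card sub])
  finally show ?thesis .
qed

text \<open>With \<open>s\<close> of order \<open>sqrt k\<close> the explicit bound loses only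
  \<open>exp (O (sqrt k))\<close>, which \<open>(1 - \<delta>) ^ k\<close> absorbs.\<close>

lemma card_bounded_trees_ge:
  assumes D: "3 \<le> \<Delta>" and \<delta>: "0 < \<delta>" "\<delta> < 1"
  obtains k0 where "\<And>V :: 'a set. finite V \<Longrightarrow> k0 \<le> card V \<Longrightarrow>
    fact (card V) * (a_const \<Delta> * (1 - \<delta>)) ^ card V \<le> real (card (bounded_trees \<Delta> V))"
proof -
  define \<alpha> where "\<alpha> = alpha_const \<Delta>"
  define a where "a = a_const \<Delta>"
  have \<alpha>: "1 < \<alpha>" and a: "1 < a"
    using alpha_const_gt_1[OF D] a_const_gt_1[OF D] by (auto simp: \<alpha>_def a_def)
  \<comment> \<open>Each unit of \<open>s\<close> costs a factor 2 for a reserve vertex, a factor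
    \<alpha> for the fluctuation and a factor \<open>a\<close> for a vertex outside
    \<open>S\<close>.\<close>
  define L where "L = ln (2 * \<alpha> * a)"
  define \<theta> where "\<theta> = - ln (1 - \<delta>)"
  have \<theta>: "0 < \<theta>" and L: "0 < L"
    using \<delta> \<alpha> a by (auto simp: \<theta>_def L_def ln_less_zero intro!: ln_gt_zero less_1_mult)
  have "\<forall>\<^sub>F k in sequentially. \<theta> * real k \<ge> 2 * ln (real k) + L * (real \<Delta> * sqrt (2 * real k) + 1) + ln (8 * a\<^sup>2)"
    using \<theta> by real_asymp
  moreover have "\<forall>\<^sub>F k in sequentially. real \<Delta> * sqrt (2 * real k) + 1 + 2 < real k"
    by real_asymp
  ultimately have "\<forall>\<^sub>F k in sequentially. \<theta> * real k \<ge> 2 * ln (real k) +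
      L * (real \<Delta> * sqrt (2 * real k) + 1) + ln (8 * a\<^sup>2) \<and> real \<Delta> * sqrt (2 * real k) + 1 + 2 < real k"
    by eventually_elim simp
  then obtain k0 where k0: "\<And>k. k0 \<le> k \<Longrightarrow> \<theta> * real k \<ge> 2 * ln (real k) +
      L * (real \<Delta> * sqrt (2 * real k) + 1) + ln (8 * a\<^sup>2)"
    "\<And>k. k0 \<le> k \<Longrightarrow> real \<Delta> * sqrt (2 * real k) + 1 + 2 < real k"
    by (auto simp: eventually_sequentially)
  show ?thesis
  proof (rule that[of "max k0 1"])
    fix V :: "'a set" assume V: "finite V" "max k0 1 \<le> card V"
    define k where "k = card V"
    have k: "k0 \<le> k" "1 \<le> k"
      using V by (auto simp: k_def)
    define s where "s = nat \<lceil>real \<Delta> * sqrt (2 * real k)\<rceil>"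
    have s_ge: "real \<Delta> * sqrt (2 * real k) \<le> real s" and s_le: "real s \<le> real \<Delta> * sqrt (2 * real k) + 1"
      by (auto simp: s_def)
    have "0 < real \<Delta> * sqrt (2 * real k)"
      using D k by simp
    then have "0 < s"
      using s_ge by linarith
    have "s + 2 < k"
      using k0(2)[OF k(1)] s_le by linarith
    then obtain l where l: "k = l + s + 2"
      by (metis add.assoc add.commute less_imp_add_positive)
    have "2 * real l * (real \<Delta>)\<^sup>2 \<le> 2 * real k * (real \<Delta>)\<^sup>2"
      using l by (intro mult_right_mono) auto
    also have "\<dots> = (real \<Delta> * sqrt (2 * real k))\<^sup>2"
      by (simp add: power_mult_distrib)
    also have "\<dots> \<le> (real s)\<^sup>2"
      using s_ge by (intro power_mono) auto
    finally have "fact (l + s) * (a ^ l / \<alpha> ^ s / 2 ^ (s + 3)) \<le> real (card (bounded_trees \<Delta> V))"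
      unfolding a_def \<alpha>_def using D V(1) l \<open>0 < s\<close> by (intro card_bounded_trees_ge_explicit) (auto simp: k_def)
    moreover have "fact k * (a * (1 - \<delta>)) ^ k \<le> fact (l + s) * (a ^ l / \<alpha> ^ s / 2 ^ (s + 3))"
    proof -
      have "fact k = real k * real (k - 1) * fact (l + s)"
        by (simp add: l algebra_simps)
      also have "\<dots> \<le> (real k)\<^sup>2 * fact (l + s)"
        by (intro mult_right_mono) (auto simp: power2_eq_square intro!: mult_left_mono)
      finally have 1: "fact k \<le> (real k)\<^sup>2 * fact (l + s)" .
      have "ln ((real k)\<^sup>2 * (1 - \<delta>) ^ k * ((2 * \<alpha> * a) ^ s * (8 * a\<^sup>2))) =
          2 * ln (real k) - \<theta> * real k + (L * real s + ln (8 * a\<^sup>2))"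
        using k \<delta> \<alpha> a by (simp add: ln_mult ln_realpow \<theta>_def L_def)
      also have "\<dots> \<le> 0"
        using k0(1)[OF k(1)] mult_left_mono[OF s_le, of L] L by linarith
      finally have "(real k)\<^sup>2 * (1 - \<delta>) ^ k * ((2 * \<alpha> * a) ^ s * (8 * a\<^sup>2)) \<le> 1"
        using k \<delta> \<alpha> a by (subst (asm) ln_le_zero_iff) auto
      then have "(real k)\<^sup>2 * (1 - \<delta>) ^ k \<le> 1 / ((2 * \<alpha> * a) ^ s * (8 * a\<^sup>2))"
        using \<alpha> a by (simp add: le_divide_eq)
      then have "a ^ k * ((real k)\<^sup>2 * (1 - \<delta>) ^ k) \<le> a ^ k * (1 / ((2 * \<alpha> * a) ^ s * (8 * a\<^sup>2)))"
        using a by (intro mult_left_mono) auto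
      also have "\<dots> = a ^ l / \<alpha> ^ s / 2 ^ (s + 3)"
        using \<alpha> a by (simp add: l power_add power_mult_distrib power2_eq_square)
      finally have 2: "a ^ k * ((real k)\<^sup>2 * (1 - \<delta>) ^ k) \<le> a ^ l / \<alpha> ^ s / 2 ^ (s + 3)" .
      have "fact k * (a * (1 - \<delta>)) ^ k \<le> ((real k)\<^sup>2 * fact (l + s)) * (a * (1 - \<delta>)) ^ k"
        using 1 a \<delta> by (intro mult_right_mono) auto
      also have "\<dots> = fact (l + s) * (a ^ k * ((real k)\<^sup>2 * (1 - \<delta>) ^ k))"
        by (simp add: power_mult_distrib)
      also have "\<dots> \<le> fact (l + s) * (a ^ l / \<alpha> ^ s / 2 ^ (s + 3))"
        by (rule mult_left_mono[OF 2]) simp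
      finally show ?thesis .
    qed
    ultimately show "fact (card V) * (a_const \<Delta> * (1 - \<delta>)) ^ card V \<le> real (card (bounded_trees \<Delta> V))"
      by (simp add: k_def a_def)
  qed
qed

section \<open>The probability that a random tree contains a given forest\<close>

lemma finite_PiE_Collect: "finite U \<Longrightarrow> finite V \<Longrightarrow> finite {\<phi> \<in> PiE U (\<lambda>_. V). P \<phi>}"
  by (rule finite_subset[of _ "PiE U (\<lambda>_. V)"]) (auto intro: finite_PiE)

text \<open>Remove a leaf \<open>v\<close> of \<open>H\<close> with neighbour \<open>w\<close>: the
  image of \<open>v\<close> is one of at most \<Delta> neighbours of the image of \<open>w\<close>.
  After all edges have been removed, \<open>card U - card H\<close> vertices are left and map
  freely.\<close>

lemma card_embeddings_le:
  assumes V: "finite V" and T: "T \<subseteq> all_pairs V" "\<And>x. x \<in> V \<Longrightarrow> degree_in T x \<le> \<Delta>"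
    and U: "finite U" "H \<subseteq> all_pairs U" "acyclic_edges H"
  shows "card {\<phi> \<in> PiE U (\<lambda>_. V). \<forall>e\<in>H. \<phi> ` e \<in> T} \<le> card V ^ (card U - card H) * \<Delta> ^ card H"
  using U
proof (induction "card H" arbitrary: H U)
  case 0
  then have "H = {}"
    using finite_subset[OF 0(3)] by auto
  then show ?case
    using 0 by (simp add: card_PiE)
next
  case (Suc h)
  have finT: "finite T"
    using T(1) V finite_subset by blast
  have finH: "finite H"
    using Suc.prems finite_subset[of H "all_pairs U"] by auto
  have "H \<noteq> {}"
    using Suc.hyps(2) by auto
  obtain v w where vw: "v \<in> U" "w \<in> U" "v \<noteq> w" "{v, w} \<in> H"
    and leaf: "\<And>e. e \<in> H \<Longrightarrow> v \<in> e \<Longrightarrow> e = {v, w}"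
    by (rule acyclic_edges_leaf[OF Suc.prems(3) \<open>H \<noteq> {}\<close> Suc.prems(2)]) (rule that)
  define H' where "H' = H - {{v, w}}"
  define U' where "U' = U - {v}"
  define A where "A = {\<phi> \<in> PiE U (\<lambda>_. V). \<forall>e\<in>H. \<phi> ` e \<in> T}"
  define A' where "A' = {\<phi> \<in> PiE U' (\<lambda>_. V). \<forall>e\<in>H'. \<phi> ` e \<in> T}"
  define B where "B \<psi> = {y \<in> V. {y, \<psi> w} \<in> T}" for \<psi> :: "'b \<Rightarrow> 'a"
  have U': "finite U'" "w \<in> U'" and cU': "card U' = card U - 1"
    using Suc.prems(1) vw by (auto simp: U'_def)
  have H': "H' \<subseteq> all_pairs U'"
  proof
    fix e assume "e \<in> H'"
    then have "e \<in> all_pairs U" "v \<notin> e"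
      using Suc.prems(2) leaf by (auto simp: H'_def)
    then show "e \<in> all_pairs U'"
      by (auto simp: all_pairs_def U'_def)
  qed
  have cH': "card H' = h"
    using vw(4) finH Suc.hyps(2) by (simp add: H'_def)
  have finA': "finite A'"
    unfolding A'_def by (rule finite_PiE_Collect[OF U'(1) V])
  have "card A' \<le> card V ^ (card U' - card H') * \<Delta> ^ card H'"
    unfolding A'_def
  proof (rule Suc.hyps(1))
    show "acyclic_edges H'"
      by (rule acyclic_edges_mono[OF Suc.prems(3)]) (auto simp: H'_def)
  qed (use cH' U' H' in auto)
  then have IH: "card A' \<le> card V ^ (card U - card H) * \<Delta> ^ h"
    using cU' cH' Suc.hyps(2) by simp
  have cB: "card (B \<psi>) \<le> \<Delta>" if "\<psi> \<in> A'" for \<psi>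
  proof -
    have "\<psi> w \<in> V"
      using that U'(2) by (auto simp: A'_def)
    have "card (B \<psi>) \<le> card {e \<in> T. \<psi> w \<in> e}"
    proof (rule card_inj_on_le)
      show "inj_on (\<lambda>y. {y, \<psi> w}) (B \<psi>)"
        by (auto simp: inj_on_def doubleton_eq_iff)
      show "(\<lambda>y. {y, \<psi> w}) ` B \<psi> \<subseteq> {e \<in> T. \<psi> w \<in> e}"
        by (auto simp: B_def)
    qed (use finT in auto)
    also have "\<dots> \<le> \<Delta>"
      using T(2)[OF \<open>\<psi> w \<in> V\<close>] by (simp add: degree_in_def)
    finally show ?thesis .
  qed
  have "card A \<le> card (Sigma A' B)"
  proof (rule card_inj_on_le)
    show "inj_on (\<lambda>\<phi>. (restrict \<phi> U', \<phi> v)) A"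
    proof (rule inj_onI)
      fix \<phi> \<phi>' assume *: "\<phi> \<in> A" "\<phi>' \<in> A" "(restrict \<phi> U', \<phi> v) = (restrict \<phi>' U', \<phi>' v)"
      then have eq: "restrict \<phi> U' = restrict \<phi>' U'" "\<phi> v = \<phi>' v"
        by auto
      have "\<phi> u = \<phi>' u" if "u \<in> U" for u
        using fun_cong[OF eq(1), of u] eq(2) that by (cases "u = v") (auto simp: U'_def)
      then show "\<phi> = \<phi>'"
        using * by (intro PiE_ext[of \<phi> U "\<lambda>_. V" \<phi>']) (auto simp: A_def)
    qed
    show "(\<lambda>\<phi>. (restrict \<phi> U', \<phi> v)) ` A \<subseteq> Sigma A' B"
    proof (intro image_subsetI SigmaI)
      fix \<phi> assume \<phi>: "\<phi> \<in> A"
      then have \<phi>V: "\<phi> \<in> PiE U (\<lambda>_. V)" and \<phi>T: "\<And>e. e \<in> H \<Longrightarrow> \<phi> ` e \<in> T"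
        by (auto simp: A_def)
      have img: "restrict \<phi> U' ` e = \<phi> ` e" if "e \<in> H'" for e
        using that H' by (intro image_cong) (auto simp: all_pairs_def)
      have "restrict \<phi> U' \<in> PiE U' (\<lambda>_. V)"
        using \<phi>V by (auto simp: U'_def)
      moreover have "\<forall>e\<in>H'. restrict \<phi> U' ` e \<in> T"
        using img \<phi>T by (simp add: H'_def)
      ultimately show "restrict \<phi> U' \<in> A'"
        by (simp add: A'_def)
      have "{\<phi> v, \<phi> w} \<in> T"
        using \<phi>T[OF vw(4)] by simp
      then show "\<phi> v \<in> B (restrict \<phi> U')"
        using \<phi>V vw U' by (auto simp: B_def)
    qed
    show "finite (Sigma A' B)"
      using finA' V by (intro finite_SigmaI) (auto simp: B_def)
  qed
  also have "\<dots> = (\<Sum>\<psi>\<in>A'. card (B \<psi>))"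
    using finA' V by (intro card_SigmaI) (auto simp: B_def)
  also have "\<dots> \<le> (\<Sum>\<psi>\<in>A'. \<Delta>)"
    by (rule sum_mono[OF cB])
  also have "\<dots> = card A' * \<Delta>"
    by simp
  also have "\<dots> \<le> card V ^ (card U - card H) * \<Delta> ^ h * \<Delta>"
    using IH by (rule mult_right_mono) simp
  finally show ?case
    by (simp add: A_def Suc.hyps(2)[symmetric] mult_ac)
qed

lemma degree_in_image:
  assumes "inj_on \<pi> V" "F \<subseteq> all_pairs V" "v \<in> V"
  shows "degree_in ((`) \<pi> ` F) (\<pi> v) = degree_in F v"
proof -
  have F: "e \<subseteq> V" if "e \<in> F" for e
    using assms(2) that by (auto simp: all_pairs_def)
  have "{e \<in> (`) \<pi> ` F. \<pi> v \<in> e} = (`) \<pi> ` {e \<in> F. v \<in> e}"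
  proof (intro set_eqI iffI)
    fix e assume "e \<in> {e \<in> (`) \<pi> ` F. \<pi> v \<in> e}"
    then obtain e' where "e' \<in> F" "e = \<pi> ` e'" "\<pi> v \<in> \<pi> ` e'"
      by blast
    moreover from this have "v \<in> e'"
      using inj_on_image_mem_iff[OF assms(1,3) F[of e']] by simp
    ultimately show "e \<in> (`) \<pi> ` {e \<in> F. v \<in> e}"
      by blast
  qed blast
  moreover have "inj_on ((`) \<pi>) {e \<in> F. v \<in> e}"
    by (rule inj_on_subset[OF inj_on_image_Pow[OF assms(1)]]) (use F in auto)
  ultimately show ?thesis
    by (simp add: degree_in_def card_image)
qed

text \<open>Serves twice: for relabelling between sets of equal size, and for permutations of one
  set.\<close>

lemma image_bounded_trees:
  assumes "finite V" "bij_betw \<pi> V V'" "T \<in> bounded_trees \<Delta> V"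
  shows "(`) \<pi> ` T \<in> bounded_trees \<Delta> V'"
proof -
  have inj: "inj_on \<pi> V" and img: "\<pi> ` V = V'"
    using assms(2) by (auto simp: bij_betw_def)
  have T: "T \<subseteq> all_pairs V" "acyclic_edges T" "Suc (card T) = card V" "\<And>v. v \<in> V \<Longrightarrow> degree_in T v \<le> \<Delta>"
    using assms(3) by (auto simp: bounded_trees_def)
  have TV: "e \<subseteq> V" "card e = 2" if "e \<in> T" for e
    using T(1) that by (auto simp: all_pairs_def)
  have injT: "inj_on ((`) \<pi>) T"
    by (rule inj_on_subset[OF inj_on_image_Pow[OF inj]]) (use TV in auto)
  show ?thesis
    unfolding bounded_trees_def
  proof (intro CollectI conjI ballI)
    show "(`) \<pi> ` T \<subseteq> all_pairs V'"
    proof (rule image_subsetI)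
      fix e assume "e \<in> T"
      then show "\<pi> ` e \<in> all_pairs V'"
        using TV[of e] img card_image[OF inj_on_subset[OF inj, of e]] by (auto simp: all_pairs_def)
    qed
    show "Suc (card ((`) \<pi> ` T)) = card V'"
      using T(3) card_image[OF injT] card_image[OF inj] img by simp
    show "acyclic_edges ((`) \<pi> ` T)"
      unfolding acyclic_edges_def
    proof (intro allI impI)
      fix F' assume F': "F' \<subseteq> (`) \<pi> ` T" "F' \<noteq> {}"
      then obtain F where F: "F \<subseteq> T" "F' = (`) \<pi> ` F"
        by (auto simp: subset_image_iff)
      then have "F \<noteq> {}" "F \<subseteq> all_pairs V" "acyclic_edges F"
        using F' T acyclic_edges_mono[OF T(2) F(1)] by auto
      then obtain v where v: "degree_in F v = 1"
        by (auto simp: acyclic_edges_def)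
      then have "v \<in> \<Union>F"
        using degree_in_eq_0[of v F] by linarith
      then have "v \<in> V"
        using \<open>F \<subseteq> all_pairs V\<close> by (auto simp: all_pairs_def)
      then have "degree_in F' (\<pi> v) = 1"
        using degree_in_image[OF inj \<open>F \<subseteq> all_pairs V\<close>] v F(2) by simp
      then show "\<exists>v. degree_in F' v = 1" ..
    qed
    fix v' assume "v' \<in> V'"
    then obtain v where "v \<in> V" "v' = \<pi> v"
      using img by auto
    then show "degree_in ((`) \<pi> ` T) v' \<le> \<Delta>"
      using degree_in_image[OF inj T(1)] T(4) by simp
  qed
qed

lemma inj_on_image_bounded_trees:
  assumes "inj_on \<pi> V"
  shows "inj_on ((`) ((`) \<pi>)) (bounded_trees \<Delta> V)"
proof -
  have "inj_on ((`) ((`) \<pi>)) (Pow (Pow V))"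
    by (intro inj_on_image_Pow assms)
  then show ?thesis
    by (rule inj_on_subset) (auto simp: bounded_trees_def all_pairs_def)
qed

lemma card_bounded_trees_le:
  assumes "finite V" "finite V'" "card V = card V'"
  shows "card (bounded_trees \<Delta> V) \<le> card (bounded_trees \<Delta> V')"
proof -
  obtain \<pi> where \<pi>: "bij_betw \<pi> V V'"
    using finite_same_card_bij[OF assms] by blast
  then show ?thesis
    using image_bounded_trees[OF assms(1) \<pi>] assms inj_on_image_bounded_trees[of \<pi> V]
    by (intro card_inj_on_le[of "(`) ((`) \<pi>)"]) (auto simp: bij_betw_def)
qed

lemma card_bounded_trees_cong:
  assumes "finite V" "finite V'" "card V = card V'"
  shows "card (bounded_trees \<Delta> V) = card (bounded_trees \<Delta> V')"
  using card_bounded_trees_le[OF assms] card_bounded_trees_le[OF assms(2,1) assms(3)[symmetric]] by (rule le_antisym)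

lemma card_injections:
  assumes "finite U" "finite V" "card U \<le> card V"
  shows "real (card {\<phi> \<in> PiE U (\<lambda>_. V). inj_on \<phi> U}) = fact (card V) / fact (card V - card U)"
proof -
  have "real (\<Prod>i=0..<u. k - i) * fact (k - u) = fact k" if "u \<le> k" for u k :: nat
    using that
  proof (induction u)
    case (Suc u)
    then have "fact (k - u) = real (k - u) * fact (k - Suc u)"
      by (subst fact_reduce) auto
    then show ?case
      using Suc by (simp add: mult_ac)
  qed simp
  from this[OF assms(3)] show ?thesis
    using card_inj_on_subset_funcset[OF assms(1,2) subset_refl] by (simp add: field_simps)
qed

lemma extend_injection_to_permutation:
  assumes "finite V" "U \<subseteq> V" "inj_on \<phi> U" "\<phi> ` U \<subseteq> V"
  obtains \<pi> where "bij_betw \<pi> V V" "\<And>u. u \<in> U \<Longrightarrow> \<pi> u = \<phi> u"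
proof -
  have fin: "finite U"
    using assms finite_subset by blast
  have "card (V - U) = card (V - \<phi> ` U)"
    using assms fin by (simp add: card_Diff_subset card_image)
  then obtain g where g: "bij_betw g (V - U) (V - \<phi> ` U)"
    using finite_same_card_bij[of "V - U" "V - \<phi> ` U"] assms(1) by auto
  define \<pi> where "\<pi> x = (if x \<in> U then \<phi> x else g x)" for x
  have "bij_betw \<pi> U (\<phi> ` U)"
    using assms(3) by (auto simp: bij_betw_def \<pi>_def inj_on_def)
  moreover have "bij_betw \<pi> (V - U) (V - \<phi> ` U)"
    using g by (rule bij_betw_cong[THEN iffD1, rotated]) (auto simp: \<pi>_def)
  ultimately have "bij_betw \<pi> (U \<union> (V - U)) (\<phi> ` U \<union> (V - \<phi> ` U))"
    by (rule bij_betw_combine) auto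
  moreover have "U \<union> (V - U) = V" "\<phi> ` U \<union> (V - \<phi> ` U) = V"
    using assms by auto
  ultimately show ?thesis
    using that[of \<pi>] by (simp add: \<pi>_def)
qed

text \<open>Pairs of an injection of the covered set \<open>U\<close> into \<open>V\<close> and a
  tree containing the image of \<open>H\<close> are counted twice. An injection extends to a
  permutation of \<open>V\<close>, so it has at least as many trees as \<open>H\<close> itself. A
  tree has at most \<open>k ^ (card U - h) * \<Delta> ^ h\<close> injections, out of at least
  \<open>(k / exp 1) ^ card U\<close>. Finally \<open>card U \<le> 2 * h\<close> accounts for the
  square of \<open>exp 1\<close>.\<close>

lemma card_bounded_trees_containing_le:
  assumes fin: "finite V" and H: "H \<subseteq> all_pairs V"
  shows "real (card {T \<in> bounded_trees \<Delta> V. H \<subseteq> T}) \<le>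
    real (card (bounded_trees \<Delta> V)) * (real \<Delta> * exp 1 ^ 2 / real (card V)) ^ card H"
proof (cases "acyclic_edges H \<and> V \<noteq> {}")
  case False
  then consider "\<not> acyclic_edges H" | "V = {}"
    by auto
  then show ?thesis
  proof cases
    case 1
    then have "{T \<in> bounded_trees \<Delta> V. H \<subseteq> T} = {}"
      by (auto simp: bounded_trees_def intro: acyclic_edges_mono)
    then have "real (card {T \<in> bounded_trees \<Delta> V. H \<subseteq> T}) = 0"
      by (simp only: card.empty of_nat_0)
    then show ?thesis
      by simp
  next
    case 2
    then show ?thesis
      by (simp add: bounded_trees_def)
  qed
next
  case True
  define U where "U = \<Union>H"
  define k where "k = card V"
  define h where "h = card H"
  define \<T> where "\<T> = bounded_trees \<Delta> V"
  define I where "I = {\<phi> \<in> PiE U (\<lambda>_. V). inj_on \<phi> U}"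
  have finH: "finite H"
    using H fin finite_subset by blast
  have UV: "U \<subseteq> V"
    using H by (auto simp: U_def all_pairs_def)
  have finU: "finite U"
    by (rule finite_subset[OF UV fin])
  have HU: "H \<subseteq> all_pairs U"
    using H by (auto simp: all_pairs_def U_def)
  have hu: "h \<le> card U"
    unfolding h_def U_def by (rule card_acyclic_edges_le[OF fin H]) (use True in simp)
  have u2: "card U \<le> 2 * h"
  proof -
    have "card U \<le> (\<Sum>e\<in>H. card e)"
      unfolding U_def by (rule card_Union_le_sum_card)
    also have "\<dots> = 2 * h"
      using H by (simp add: h_def all_pairs_def subset_iff)
    finally show ?thesis .
  qed
  have uk: "card U \<le> k"
    unfolding k_def by (rule card_mono[OF fin UV])
  have k: "0 < k"
    using True fin by (auto simp: k_def card_gt_0_iff)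
  have fin\<T>: "finite \<T>" "finite I"
    unfolding \<T>_def I_def using fin finU by (auto intro!: finite_PiE_Collect)
  have "card I * card {T \<in> \<T>. H \<subseteq> T} \<le> (\<Sum>\<phi>\<in>I. card {T \<in> \<T>. (`) \<phi> ` H \<subseteq> T})"
  proof -
    have "card {T \<in> \<T>. H \<subseteq> T} \<le> card {T \<in> \<T>. (`) \<phi> ` H \<subseteq> T}" if \<phi>: "\<phi> \<in> I" for \<phi>
    proof -
      obtain \<pi> where \<pi>: "bij_betw \<pi> V V" "\<And>u. u \<in> U \<Longrightarrow> \<pi> u = \<phi> u"
        using extend_injection_to_permutation[OF fin UV, of \<phi>] \<phi> by (auto simp: I_def)
      have img: "\<phi> ` e = \<pi> ` e" if "e \<in> H" for e
        using that \<pi>(2) unfolding U_def by (intro image_cong refl) (metis UnionI)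
      have img': "(`) \<phi> ` H = (`) \<pi> ` H"
        by (rule image_cong[OF refl img])
      show ?thesis
        unfolding img'
      proof (rule card_inj_on_le)
        show "inj_on ((`) ((`) \<pi>)) {T \<in> \<T>. H \<subseteq> T}"
          using inj_on_image_bounded_trees[of \<pi> V \<Delta>] \<pi>(1)
          by (auto simp: \<T>_def bij_betw_def intro: inj_on_subset)
        show "(`) ((`) \<pi>) ` {T \<in> \<T>. H \<subseteq> T} \<subseteq> {T \<in> \<T>. (`) \<pi> ` H \<subseteq> T}"
          using image_bounded_trees[OF fin \<pi>(1)] by (auto simp: \<T>_def)
      qed (use fin\<T> in auto)
    qed
    from sum_mono[of I "\<lambda>_. card {T \<in> \<T>. H \<subseteq> T}", OF this] show ?thesis
      by simp
  qed
  also have "\<dots> = (\<Sum>\<phi>\<in>I. \<Sum>T\<in>\<T>. if (`) \<phi> ` H \<subseteq> T then 1 else 0)"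
    using fin\<T> by (simp add: sum.If_cases Int_def)
  also have "\<dots> = (\<Sum>T\<in>\<T>. \<Sum>\<phi>\<in>I. if (`) \<phi> ` H \<subseteq> T then 1 else 0)"
    by (rule sum.swap)
  also have "\<dots> = (\<Sum>T\<in>\<T>. card {\<phi> \<in> I. (`) \<phi> ` H \<subseteq> T})"
    using fin\<T> by (simp add: sum.If_cases Int_def)
  also have "\<dots> \<le> (\<Sum>T\<in>\<T>. k ^ (card U - h) * \<Delta> ^ h)"
  proof (rule sum_mono)
    fix T assume "T \<in> \<T>"
    then have T: "T \<subseteq> all_pairs V" "\<And>x. x \<in> V \<Longrightarrow> degree_in T x \<le> \<Delta>"
      by (auto simp: \<T>_def bounded_trees_def)
    have "card {\<phi> \<in> I. (`) \<phi> ` H \<subseteq> T} \<le> card {\<phi> \<in> PiE U (\<lambda>_. V). \<forall>e\<in>H. \<phi> ` e \<in> T}"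
      using fin finU by (intro card_mono finite_PiE_Collect) (auto simp: I_def)
    also have "\<dots> \<le> k ^ (card U - h) * \<Delta> ^ h"
      unfolding k_def h_def
      by (rule card_embeddings_le[OF fin T finU HU]) (use True in auto)
    finally show "card {\<phi> \<in> I. (`) \<phi> ` H \<subseteq> T} \<le> k ^ (card U - h) * \<Delta> ^ h" .
  qed
  also have "\<dots> = card \<T> * (k ^ (card U - h) * \<Delta> ^ h)"
    by simp
  finally have main: "real (card I) * real (card {T \<in> \<T>. H \<subseteq> T}) \<le> real (card \<T>) * (real k ^ (card U - h) * real \<Delta> ^ h)"
    by (metis of_nat_mono of_nat_mult of_nat_power)
  have "(real k / exp 1) ^ card U \<le> real (card I)"
    using fact_quotient_ge[OF uk] card_injections[OF finU fin] uk by (simp add: I_def k_def)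
  then have "(real k / exp 1) ^ card U * real (card {T \<in> \<T>. H \<subseteq> T}) \<le> real (card I) * real (card {T \<in> \<T>. H \<subseteq> T})"
    by (rule mult_right_mono) simp
  also note main
  also have "real k ^ (card U - h) = real k ^ card U / real k ^ h"
    using hu k by (simp add: power_diff)
  finally have "real (card {T \<in> \<T>. H \<subseteq> T}) \<le> real (card \<T>) * (exp 1 ^ card U * (real \<Delta> / real k) ^ h)"
    using k by (simp add: power_divide field_simps)
  also have "\<dots> \<le> real (card \<T>) * (exp 1 ^ (2 * h) * (real \<Delta> / real k) ^ h)"
    using u2 by (intro mult_left_mono mult_right_mono power_increasing) auto
  also have "exp 1 ^ (2 * h) * (real \<Delta> / real k) ^ h = (real \<Delta> * exp 1 ^ 2 / real k) ^ h"
    unfolding power_mult by (simp flip: power_mult_distrib add: mult_ac)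
  finally show ?thesis
    by (simp add: \<T>_def h_def k_def)
qed

section \<open>Transversals\<close>

text \<open>\<open>b\<close> gives the block of a vertex, so a transversal has at most one vertex in
  each block. If \<open>b\<close> is injective on \<open>X\<close>, these are all subsets of size
  \<open>k\<close>.\<close>

definition transversals :: "('a \<Rightarrow> 'b) \<Rightarrow> 'a set \<Rightarrow> nat \<Rightarrow> 'a set set" where
  "transversals b X k = {S. S \<subseteq> X \<and> card S = k \<and> inj_on b S}"

lemma finite_transversals [intro, simp]: "finite X \<Longrightarrow> finite (transversals b X k)"
  by (rule finite_subset[of _ "Pow X"]) (auto simp: transversals_def)

text \<open>A transversal takes no vertex or exactly one from the block added last, so the count
  follows Pascal's rule with a factor \<open>m\<close> in the second case.\<close>

lemma card_transversals:
  assumes "finite X" "finite B" "\<And>j. j \<in> B \<Longrightarrow> card {x \<in> X. b x = j} = m"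
  shows "card (transversals b {x \<in> X. b x \<in> B} k) = (card B choose k) * m ^ k"
  using assms(2,3)
proof (induction B arbitrary: k rule: finite_induct)
  case empty
  have "transversals b {x \<in> X. b x \<in> {}} k = (if k = 0 then {{}} else {})"
    by (auto simp: transversals_def)
  then show ?case by simp
next
  case (insert j B)
  define Y where "Y = {x \<in> X. b x \<in> B}"
  define F where "F = {x \<in> X. b x = j}"
  have Y': "{x \<in> X. b x \<in> insert j B} = Y \<union> F"
    by (auto simp: Y_def F_def)
  have IH: "card (transversals b Y k) = (card B choose k) * m ^ k" for k
    unfolding Y_def using insert by simp
  have fin: "finite Y" "finite F" "card F = m"
    using assms(1) insert.prems by (auto simp: Y_def F_def)
  have YF: "b y \<noteq> j" "y \<notin> F" if "y \<in> Y" for y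
    using that insert.hyps by (auto simp: Y_def F_def)
  have bF: "b x = j" if "x \<in> F" for x
    using that by (simp add: F_def)
  have finS: "finite S" if "S \<in> transversals b Y k" for S k
    using that fin finite_subset by (auto simp: transversals_def)
  show ?case
  proof (cases k)
    case 0
    have "transversals b (Y \<union> F) 0 = {{}}"
      using fin finite_subset[of _ "Y \<union> F"] by (auto simp: transversals_def)
    then show ?thesis
      unfolding Y' 0 by simp
  next
    case (Suc l)
    define f where "f = (\<lambda>(x::'a, S). insert x S)"
    have eq: "transversals b (Y \<union> F) k = transversals b Y k \<union> f ` (F \<times> transversals b Y l)"
    proof (intro equalityI subsetI)
      fix S assume S: "S \<in> transversals b (Y \<union> F) k"
      then have S': "S \<subseteq> Y \<union> F" "card S = Suc l" "inj_on b S" "finite S"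
        using fin finite_subset[of S "Y \<union> F"] Suc by (auto simp: transversals_def)
      show "S \<in> transversals b Y k \<union> f ` (F \<times> transversals b Y l)"
      proof (cases "S \<inter> F = {}")
        case True
        then show ?thesis
          using S' Suc by (auto simp: transversals_def)
      next
        case False
        then obtain x where x: "x \<in> S" "x \<in> F" by blast
        have "S - {x} \<subseteq> Y"
        proof
          fix y assume "y \<in> S - {x}"
          then have "y \<notin> F"
            using inj_onD[OF S'(3), of y x] bF x by auto
          then show "y \<in> Y"
            using S'(1) \<open>y \<in> S - {x}\<close> by blast
        qed
        moreover have "inj_on b (S - {x})"
          using S'(3) by (rule inj_on_subset) blast
        moreover have "card (S - {x}) = l"
          using S' x by simp
        ultimately have "S - {x} \<in> transversals b Y l"
          by (simp add: transversals_def)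
        moreover have "S = f (x, S - {x})"
          using x by (auto simp: f_def)
        ultimately show ?thesis
          using x by blast
      qed
    next
      fix S assume "S \<in> transversals b Y k \<union> f ` (F \<times> transversals b Y l)"
      then show "S \<in> transversals b (Y \<union> F) k"
      proof
        assume "S \<in> f ` (F \<times> transversals b Y l)"
        then obtain x S' where x: "x \<in> F" "S' \<in> transversals b Y l" "S = insert x S'"
          by (auto simp: f_def)
        then have "S' \<subseteq> Y" "card S' = l" "inj_on b S'" "finite S'"
          using finS[OF x(2)] x(2) by (simp_all add: transversals_def)
        moreover have "x \<notin> S'"
          using YF \<open>S' \<subseteq> Y\<close> x by blast
        moreover have "b x \<notin> b ` S'"
          using bF[OF x(1)] YF(1) \<open>S' \<subseteq> Y\<close> by force
        ultimately show ?thesis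
          using x Suc by (auto simp: transversals_def)
      qed (auto simp: transversals_def)
    qed
    have "inj_on f (F \<times> transversals b Y l)"
    proof (rule inj_onI, clarify)
      fix x S x' S'
      assume *: "x \<in> F" "x' \<in> F" "S \<in> transversals b Y l" "S' \<in> transversals b Y l" "f (x, S) = f (x', S')"
      have "S \<subseteq> Y" "S' \<subseteq> Y"
        using *(3,4) by (simp_all add: transversals_def)
      then have notin: "x \<notin> S" "x \<notin> S'"
        using *(1) YF(2) by blast+
      have eq: "insert x S = insert x' S'"
        using *(5) by (simp add: f_def)
      then have "x = x'"
        using notin(2) by blast
      with eq notin show "x = x' \<and> S = S'"
        by (simp add: insert_ident)
    qed
    then have "card (f ` (F \<times> transversals b Y l)) = m * card (transversals b Y l)"
      using fin by (simp add: card_image card_cartesian_product)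
    moreover have "transversals b Y k \<inter> f ` (F \<times> transversals b Y l) = {}"
    proof -
      have "S \<subseteq> Y" if "S \<in> transversals b Y k" for S
        using that by (simp add: transversals_def)
      moreover have "\<not> f p \<subseteq> Y" if "p \<in> F \<times> transversals b Y l" for p
        using that YF(2) by (cases p) (auto simp: f_def)
      ultimately show ?thesis
        by blast
    qed
    ultimately have "card (transversals b (Y \<union> F) k) = card (transversals b Y k) + m * card (transversals b Y l)"
      unfolding eq using fin by (subst card_Un_disjoint) auto
    then show ?thesis
      unfolding Y' IH using insert.hyps by (simp add: Suc algebra_simps)
  qed
qed

text \<open>\<open>S - I\<close> is a transversal of the blocks that \<open>I\<close>
  misses.\<close>

lemma card_transversals_containing_le:
  assumes "finite X" "finite B" "\<And>j. j \<in> B \<Longrightarrow> card {x \<in> X. b x = j} = m"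
    and "b ` X \<subseteq> B" "I \<subseteq> X" "inj_on b I"
  shows "card {S \<in> transversals b X k. I \<subseteq> S} \<le> (card B - card I choose (k - card I)) * m ^ (k - card I)"
proof -
  have finI: "finite I"
    using assms finite_subset by blast
  define Y where "Y = {x \<in> X. b x \<in> B - b ` I}"
  have "card {S \<in> transversals b X k. I \<subseteq> S} \<le> card (transversals b Y (k - card I))"
  proof (rule card_inj_on_le)
    show "inj_on (\<lambda>S. S - I) {S \<in> transversals b X k. I \<subseteq> S}"
      by (rule inj_onI) blast
    show "(\<lambda>S. S - I) ` {S \<in> transversals b X k. I \<subseteq> S} \<subseteq> transversals b Y (k - card I)"
    proof clarify
      fix S assume S: "S \<in> transversals b X k" "I \<subseteq> S"
      then have S': "S \<subseteq> X" "card S = k" "inj_on b S"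
        by (auto simp: transversals_def)
      have "b x \<notin> b ` I" if "x \<in> S - I" for x
      proof
        assume "b x \<in> b ` I"
        then obtain y where "y \<in> I" "b x = b y"
          by blast
        then have "x = y"
          using inj_onD[OF S'(3), of x y] S(2) that by auto
        then show False
          using that \<open>y \<in> I\<close> by blast
      qed
      moreover have "x \<in> X" "b x \<in> B" if "x \<in> S - I" for x
        using that S'(1) assms(4) by blast+
      ultimately have "S - I \<subseteq> Y"
        unfolding Y_def by blast
      moreover have "card (S - I) = k - card I"
        using S' S(2) finI by (simp add: card_Diff_subset)
      moreover have "inj_on b (S - I)"
        using S'(3) by (rule inj_on_subset) blast
      ultimately show "S - I \<in> transversals b Y (k - card I)"
        by (simp add: transversals_def)
    qed
    show "finite (transversals b Y (k - card I))"
      using assms(1) by (auto simp: Y_def)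
  qed
  also have "\<dots> = (card (B - b ` I) choose (k - card I)) * m ^ (k - card I)"
    unfolding Y_def using assms by (intro card_transversals) auto
  also have "card (B - b ` I) = card B - card I"
    using assms finI by (subst card_Diff_subset) (auto simp: card_image)
  finally show ?thesis .
qed

text \<open>Both sides are products of \<open>l\<close> factors, and
  \<open>(k - i) * N \<le> (N - i) * k\<close> compares them one by one.\<close>

lemma choose_quotient_le:
  assumes "l \<le> k" "k \<le> N"
  shows "real (k choose l) * real N ^ l \<le> real (N choose l) * real k ^ l"
proof -
  have "real (k choose l) * real N ^ l = (\<Prod>i=0..<l. real (k - i) / real (l - i) * real N)"
    using assms by (simp only: binomial_altdef_of_nat prod.distrib prod_constant card_atLeastLessThan diff_zero)
  also have "\<dots> \<le> (\<Prod>i=0..<l. real (N - i) / real (l - i) * real k)"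
  proof (rule prod_mono)
    fix i assume i: "i \<in> {0..<l}"
    have "real (k - i) * real N \<le> real (N - i) * real k"
    proof -
      have "i * k \<le> i * N"
        using assms by simp
      then have "real i * real k \<le> real i * real N"
        by (metis of_nat_mono of_nat_mult)
      then show ?thesis
        using i assms by (simp add: of_nat_diff algebra_simps)
    qed
    then show "0 \<le> real (k - i) / real (l - i) * real N \<and>
        real (k - i) / real (l - i) * real N \<le> real (N - i) / real (l - i) * real k"
      by (simp add: divide_right_mono)
  qed
  also have "\<dots> = real (N choose l) * real k ^ l"
    using assms by (simp only: binomial_altdef_of_nat[OF order_trans[OF assms]] prod.distrib
        prod_constant card_atLeastLessThan diff_zero)
  finally show ?thesis .
qed

text \<open>In terms of probability: a uniformly random transversal of size \<open>k\<close>
  contains a given one of size \<open>l\<close> with probability at most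
  \<open>(k / (N * m)) ^ l\<close>.\<close>

lemma choose_transversals_quotient_le:
  assumes "l \<le> k" "k \<le> N" "0 < N" "0 < m"
  shows "real ((N - l choose (k - l)) * m ^ (k - l)) \<le>
    (real k / (real N * real m)) ^ l * real ((N choose k) * m ^ k)"
proof -
  have eq: "real (N choose k) * real (k choose l) = real (N choose l) * real (N - l choose (k - l))"
    using choose_mult[OF assms(1,2)] by (metis of_nat_mult)
  have pos: "0 < real (N choose l)"
    using assms by simp
  have "real (N - l choose (k - l)) * real (N choose l) * real N ^ l = real (N choose k) * (real (k choose l) * real N ^ l)"
    using eq by (simp add: mult_ac)
  also have "\<dots> \<le> real (N choose k) * (real (N choose l) * real k ^ l)"
    by (intro mult_left_mono choose_quotient_le assms) simp
  finally have "real (N choose l) * (real (N - l choose (k - l)) * real N ^ l) \<le> real (N choose l) * (real (N choose k) * real k ^ l)"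
    by (simp add: mult_ac)
  then have "real (N - l choose (k - l)) * real N ^ l \<le> real (N choose k) * real k ^ l"
    using pos by (simp only: mult_le_cancel_left_pos)
  then have "real (N - l choose (k - l)) \<le> real (N choose k) * real k ^ l / real N ^ l"
    using assms by (simp add: le_divide_eq)
  then have "real (N - l choose (k - l)) * real m ^ (k - l) \<le> real (N choose k) * real k ^ l / real N ^ l * real m ^ (k - l)"
    by (rule mult_right_mono) simp
  moreover have "real (N choose k) * real k ^ l / real N ^ l * real m ^ (k - l) =
      (real k / (real N * real m)) ^ l * real ((N choose k) * m ^ k)"
    using assms by (simp add: power_diff power_divide power_mult_distrib)
  ultimately show ?thesis
    by simp
qed

section \<open>Second moments and concentration\<close>

lemma prob_Pi_bernoulli_pattern:
  assumes "finite A" "Y \<subseteq> A" "Z \<subseteq> A" "Y \<inter> Z = {}" "0 \<le> p" "p \<le> 1"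
  shows "measure_pmf.prob (Pi_pmf A d (\<lambda>_. bernoulli_pmf p)) {f. (\<forall>e\<in>Y. f e) \<and> (\<forall>e\<in>Z. \<not> f e)} =
    p ^ card Y * (1 - p) ^ card Z"
proof -
  define B where "B e = (if e \<in> Y then {True} else if e \<in> Z then {False} else UNIV)" for e
  have B: "f e \<in> B e \<longleftrightarrow> (e \<in> Y \<longrightarrow> f e) \<and> (e \<in> Z \<longrightarrow> \<not> f e)" for f e
    using assms(4) by (auto simp: B_def)
  have "{f. (\<forall>e\<in>Y. f e) \<and> (\<forall>e\<in>Z. \<not> f e)} = Pi A B"
  proof (rule set_eqI)
    fix f
    have "f \<in> Pi A B \<longleftrightarrow> (\<forall>e\<in>A. (e \<in> Y \<longrightarrow> f e) \<and> (e \<in> Z \<longrightarrow> \<not> f e))"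
      by (simp only: Pi_iff B)
    also have "\<dots> \<longleftrightarrow> (\<forall>e\<in>Y. f e) \<and> (\<forall>e\<in>Z. \<not> f e)"
      using assms(2,3) by blast
    finally show "f \<in> {f. (\<forall>e\<in>Y. f e) \<and> (\<forall>e\<in>Z. \<not> f e)} \<longleftrightarrow> f \<in> Pi A B"
      by simp
  qed
  then have "measure_pmf.prob (Pi_pmf A d (\<lambda>_. bernoulli_pmf p)) {f. (\<forall>e\<in>Y. f e) \<and> (\<forall>e\<in>Z. \<not> f e)} =
      (\<Prod>e\<in>A. measure_pmf.prob (bernoulli_pmf p) (B e))"
    using measure_Pi_pmf_Pi[OF assms(1)] by simp
  also have "\<dots> = (\<Prod>e\<in>A. (if e \<in> Y then p else 1) * (if e \<in> Z then 1 - p else 1))"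
    using assms(4-6) by (intro prod.cong refl) (auto simp: B_def measure_pmf_single)
  also have "\<dots> = (\<Prod>e\<in>A. if e \<in> Y then p else 1) * (\<Prod>e\<in>A. if e \<in> Z then 1 - p else 1)"
    by (rule prod.distrib)
  also have "\<dots> = p ^ card Y * (1 - p) ^ card Z"
    using assms(1-3) by (simp add: prod.If_cases Int_absorb1)
  finally show ?thesis .
qed

text \<open>Where \<open>X \<noteq> 0\<close>, the inequality
  \<open>(1 - c * X)\<^sup>2 \<ge> 0\<close> gives
  \<open>2 * c * X - c\<^sup>2 * X\<^sup>2 \<le> 1\<close>, and elsewhere the left side is 0. Taking
  expectations and choosing \<open>c = E1 / E2\<close>, the maximiser, gives the claim.\<close>

lemma prob_UN_second_moment:
  fixes M :: "'a pmf"
  assumes "finite I"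
    and pos: "0 < (\<Sum>i\<in>I. measure_pmf.prob M (A i))"
  shows "(\<Sum>i\<in>I. measure_pmf.prob M (A i))\<^sup>2 / (\<Sum>i\<in>I. \<Sum>j\<in>I. measure_pmf.prob M (A i \<inter> A j))
    \<le> measure_pmf.prob M (\<Union>i\<in>I. A i)"
proof -
  define E1 where "E1 = (\<Sum>i\<in>I. measure_pmf.prob M (A i))"
  define E2 where "E2 = (\<Sum>i\<in>I. \<Sum>j\<in>I. measure_pmf.prob M (A i \<inter> A j))"
  define X :: "'a \<Rightarrow> real" where "X x = (\<Sum>i\<in>I. indicator (A i) x)" for x
  have ind: "integrable M (indicator B :: 'a \<Rightarrow> real)" for B
    by (rule measure_pmf.integrable_const_bound[of _ 1]) (auto simp: indicator_def)
  have X2: "(X x)\<^sup>2 = (\<Sum>i\<in>I. \<Sum>j\<in>I. indicator (A i \<inter> A j) x)" for x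
    by (simp add: X_def power2_eq_square sum_product indicator_inter_arith)
  have intX: "integrable M X"
    unfolding X_def[abs_def] by (intro Bochner_Integration.integrable_sum ind)
  have intX2: "integrable M (\<lambda>x. (X x)\<^sup>2)"
    unfolding X2 by (intro Bochner_Integration.integrable_sum ind)
  have EX: "measure_pmf.expectation M X = E1"
    unfolding X_def[abs_def] E1_def by (subst Bochner_Integration.integral_sum) (auto intro: ind)
  have EX2: "measure_pmf.expectation M (\<lambda>x. (X x)\<^sup>2) = E2"
    unfolding X2 E2_def
    by (subst Bochner_Integration.integral_sum)
       (auto intro!: ind Bochner_Integration.integrable_sum sum.cong simp: Bochner_Integration.integral_sum[OF ind])
  have ge: "2 * c * E1 - c\<^sup>2 * E2 \<le> measure_pmf.prob M (\<Union>i\<in>I. A i)" for c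
  proof -
    have "2 * c * E1 - c\<^sup>2 * E2 = measure_pmf.expectation M (\<lambda>x. 2 * c * X x - c\<^sup>2 * (X x)\<^sup>2)"
      using intX intX2 EX EX2 by simp
    also have "\<dots> \<le> measure_pmf.expectation M (indicator (\<Union>i\<in>I. A i))"
    proof (rule integral_mono)
      fix x
      show "2 * c * X x - c\<^sup>2 * (X x)\<^sup>2 \<le> indicator (\<Union>i\<in>I. A i) x"
      proof (cases "x \<in> (\<Union>i\<in>I. A i)")
        case True
        have "0 \<le> (1 - c * X x)\<^sup>2"
          by simp
        then show ?thesis
          using True by (simp add: power2_diff power_mult_distrib)
      next
        case False
        then have "X x = 0"
          by (auto simp: X_def indicator_def intro!: sum.neutral)
        then show ?thesis
          using False by simp
      qed
    qed (use intX intX2 ind in auto)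
    finally show ?thesis by simp
  qed
  have "0 < E1"
    using pos by (simp add: E1_def)
  show ?thesis
  proof (cases "E2 > 0")
    case True
    have "E1\<^sup>2 / E2 = 2 * (E1 / E2) * E1 - (E1 / E2)\<^sup>2 * E2"
      using True by (simp add: power2_eq_square field_simps)
    with ge[of "E1 / E2"] show ?thesis
      by (simp add: E1_def E2_def)
  next
    case False
    moreover have "0 \<le> E2"
      unfolding E2_def by (intro sum_nonneg) auto
    ultimately show ?thesis
      by (simp add: E2_def)
  qed
qed

section \<open>Concentration of Lipschitz functions of independent blocks\<close>

lemma cosh_le_exp_square:
  fixes x :: real
  shows "cosh x \<le> exp (x\<^sup>2)"
proof -
  have pos: "cosh y \<le> exp (y\<^sup>2)" if y: "0 \<le> y" for y :: real
  proof (cases "y \<le> 1")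
    case True
    have 1: "exp y \<le> 1 + y + y\<^sup>2"
      using exp_bound[OF y True] .
    have "exp (- y) = 1 / exp y"
      by (simp add: exp_minus field_simps)
    also have "\<dots> \<le> 1 / (1 + y)"
      using y exp_ge_add_one_self[of y] by (intro divide_left_mono) auto
    \<comment> \<open>The linear terms of this bound and of
      \<open>exp y \<le> 1 + y + y\<^sup>2\<close> cancel in the average.\<close>
    also have "\<dots> \<le> 1 - y + y\<^sup>2"
    proof -
      have "1 \<le> (1 - y + y\<^sup>2) * (1 + y)"
        using y by (simp add: algebra_simps power2_eq_square)
      then show ?thesis
        using y by (simp add: divide_le_eq)
    qed
    finally have "cosh y \<le> 1 + y\<^sup>2"
      using 1 by (simp add: cosh_field_def)
    also have "\<dots> \<le> exp (y\<^sup>2)"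
      by (rule exp_ge_add_one_self)
    finally show ?thesis .
  next
    case False
    have "exp (- y) \<le> exp y"
      using y by simp
    then have "cosh y \<le> exp y"
      by (simp add: cosh_field_def)
    also have "y \<le> y\<^sup>2"
      using False by (simp add: power2_eq_square)
    finally show ?thesis by simp
  qed
  show ?thesis
    using pos[of x] pos[of "- x"] by (cases "0 \<le> x") auto
qed

text \<open>Kantorovich's inequality. With \<open>m \<le> G \<le> exp l * m\<close>, dividing
  \<open>(G - m) * (exp l * m - G) \<ge> 0\<close> by \<open>G\<close> and integrating bounds
  \<open>E1 + exp l * m\<^sup>2 * E2\<close>. The inequality between arithmetic and geometric mean
  then bounds the product by \<open>(1 + exp l)\<^sup>2 / (4 * exp l)\<close>, which is
  \<open>(cosh (l / 2))\<^sup>2\<close>.\<close>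

lemma expectation_mult_inverse_le:
  fixes G :: "'a \<Rightarrow> real"
  assumes fin: "finite (set_pmf M)" and pos: "\<And>x. 0 < G x"
    and osc: "\<And>x y. G x \<le> exp l * G y" and "0 \<le> l"
  shows "measure_pmf.expectation M G * measure_pmf.expectation M (\<lambda>x. 1 / G x) \<le> exp (l\<^sup>2 / 2)"
proof -
  define m where "m = Min (G ` set_pmf M)"
  define E1 where "E1 = measure_pmf.expectation M G"
  define E2 where "E2 = measure_pmf.expectation M (\<lambda>x. 1 / G x)"
  have ne: "G ` set_pmf M \<noteq> {}" "finite (G ` set_pmf M)"
    using fin set_pmf_not_empty by auto
  obtain y where y: "y \<in> set_pmf M" "m = G y"
    using Min_in[OF ne(2,1)] unfolding m_def by auto
  have m: "0 < m" and mle: "\<And>x. x \<in> set_pmf M \<Longrightarrow> m \<le> G x" and leM: "\<And>x. G x \<le> exp l * m"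
    using y pos osc Min_le[OF ne(2)] by (auto simp: m_def)
  note int = integrable_measure_pmf_finite[OF fin]
  have "E1 + exp l * m\<^sup>2 * E2 =
      measure_pmf.expectation M G + measure_pmf.expectation M (\<lambda>x. exp l * m\<^sup>2 * (1 / G x))"
    by (simp only: E1_def E2_def integral_mult_right_zero)
  also have "\<dots> = measure_pmf.expectation M (\<lambda>x. G x + exp l * m\<^sup>2 * (1 / G x))"
    by (rule Bochner_Integration.integral_add[OF int int, symmetric])
  also have "\<dots> \<le> measure_pmf.expectation M (\<lambda>x. m + exp l * m)"
  proof (rule integral_mono_AE)
    show "AE x in measure_pmf M. G x + exp l * m\<^sup>2 * (1 / G x) \<le> m + exp l * m"
    proof (rule AE_pmfI)
      fix x assume "x \<in> set_pmf M"
      then have "0 \<le> (G x - m) * (exp l * m - G x)"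
        using mle leM by (intro mult_nonneg_nonneg) auto
      then have "G x * G x + exp l * m\<^sup>2 \<le> (m + exp l * m) * G x"
        by (simp add: algebra_simps power2_eq_square)
      then show "G x + exp l * m\<^sup>2 * (1 / G x) \<le> m + exp l * m"
        using pos[of x] by (simp add: field_simps)
    qed
  qed (use int in auto)
  also have "\<dots> = m * (1 + exp l)"
    by (simp add: algebra_simps)
  finally have 1: "E1 + exp l * m\<^sup>2 * E2 \<le> m * (1 + exp l)" .
  have E_nonneg: "0 \<le> E1" "0 \<le> E2"
    unfolding E1_def E2_def using pos by (auto intro!: integral_nonneg simp: less_imp_le)
  have "4 * (exp l * m\<^sup>2) * (E1 * E2) \<le> (E1 + exp l * m\<^sup>2 * E2)\<^sup>2"
    using sum_squares_bound[of E1 "exp l * m\<^sup>2 * E2"] by (simp add: power2_sum algebra_simps)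
  also have "\<dots> \<le> (m * (1 + exp l))\<^sup>2"
    using 1 E_nonneg by (intro power_mono) auto
  finally have "m\<^sup>2 * (4 * exp l * (E1 * E2)) \<le> m\<^sup>2 * (1 + exp l)\<^sup>2"
    by (simp only: power_mult_distrib mult_ac)
  then have "4 * exp l * (E1 * E2) \<le> (1 + exp l)\<^sup>2"
    using m by (simp add: mult_le_cancel_left_pos)
  moreover have "(1 + exp l)\<^sup>2 = 4 * exp l * (cosh (l / 2))\<^sup>2"
  proof -
    have "exp l = exp (l / 2) * exp (l / 2)"
      by (simp flip: exp_add)
    moreover have "exp (l / 2) * exp (- (l / 2)) = 1"
      by (simp flip: exp_add)
    ultimately have "1 + exp l = 2 * exp (l / 2) * cosh (l / 2)"
      by (simp add: cosh_def algebra_simps)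
    then have "(1 + exp l)\<^sup>2 = 4 * (exp (l / 2))\<^sup>2 * (cosh (l / 2))\<^sup>2"
      by (simp add: power_mult_distrib)
    then show ?thesis
      by (simp flip: exp_double)
  qed
  ultimately have "E1 * E2 \<le> (cosh (l / 2))\<^sup>2"
    by simp
  also have "\<dots> \<le> (exp ((l / 2)\<^sup>2))\<^sup>2"
    by (intro power_mono cosh_le_exp_square cosh_real_nonneg)
  also have "\<dots> = exp (l\<^sup>2 / 2)"
    by (simp add: power2_eq_square flip: exp_add)
  finally show ?thesis
    by (simp add: E1_def E2_def)
qed

definition lipschitz_blocks :: "nat \<Rightarrow> (nat \<Rightarrow> 'a set) \<Rightarrow> (('a \<Rightarrow> 'b) \<Rightarrow> real) \<Rightarrow> bool" where
  "lipschitz_blocks N B f \<longleftrightarrow>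
     (\<forall>i<N. \<forall>x y. (\<forall>e. e \<notin> B i \<longrightarrow> x e = y e) \<longrightarrow> f x \<le> f y + 1)"

text \<open>Bounding the product of both moments replaces a martingale argument and keeps the
  unknown mean of \<open>f\<close> out of the statement. Let \<open>G y\<close> and
  \<open>H y\<close> be the two moments when the last block is fixed to \<open>y\<close>. By
  induction \<open>H y\<close> is at most \<open>exp (N * l\<^sup>2 / 2) / G y\<close>, and
  \<open>G\<close> varies by a factor of at most \<open>exp l\<close>, so
  \<open>expectation_mult_inverse_le\<close> applies to the last block.\<close>

lemma exp_moments_lipschitz_blocks:
  fixes M :: "'b pmf" and f :: "('a \<Rightarrow> 'b) \<Rightarrow> real"
  assumes finM: "finite (set_pmf M)" and "0 \<le> l"
    and finB: "\<And>i. i < N \<Longrightarrow> finite (B i)"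
    and disj: "\<And>i j. i < j \<Longrightarrow> j < N \<Longrightarrow> B i \<inter> B j = {}"
    and lip: "lipschitz_blocks N B f"
  shows "measure_pmf.expectation (Pi_pmf (\<Union>i<N. B i) d (\<lambda>_. M)) (\<lambda>x. exp (l * f x)) *
      measure_pmf.expectation (Pi_pmf (\<Union>i<N. B i) d (\<lambda>_. M)) (\<lambda>x. exp (- l * f x))
    \<le> exp (real N * l\<^sup>2 / 2)"
  using finB disj lip
proof (induction N arbitrary: f)
  case 0
  then show ?case by (simp flip: exp_add)
next
  case (Suc N)
  define A where "A = (\<Union>i<N. B i)"
  define P where "P = Pi_pmf A d (\<lambda>_. M)"
  define Q where "Q = Pi_pmf (B N) d (\<lambda>_. M)"
  define h where "h x y = (\<lambda>e. if e \<in> A then x e else y e)" for x y :: "'a \<Rightarrow> 'b"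
  define G where "G y = measure_pmf.expectation P (\<lambda>x. exp (l * f (h x y)))" for y
  define H where "H y = measure_pmf.expectation P (\<lambda>x. exp (- l * f (h x y)))" for y
  have finA: "finite A" and finBN: "finite (B N)"
    using Suc.prems(1) by (auto simp: A_def)
  have AB: "A \<inter> B N = {}"
    using Suc.prems(2)[of _ N] by (auto simp: A_def)
  have finP: "finite (set_pmf P)" and finQ: "finite (set_pmf Q)"
    unfolding P_def Q_def using finM finA finBN by (auto simp: set_Pi_pmf)
  note intP = integrable_measure_pmf_finite[OF finP]
  note intQ = integrable_measure_pmf_finite[OF finQ]
  have split: "measure_pmf.expectation (Pi_pmf (\<Union>i<Suc N. B i) d (\<lambda>_. M)) g =
      measure_pmf.expectation Q (\<lambda>y. measure_pmf.expectation P (\<lambda>x. g (h x y)))"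
    for g :: "('a \<Rightarrow> 'b) \<Rightarrow> real"
  proof -
    have "(\<Union>i<Suc N. B i) = A \<union> B N"
      by (auto simp: A_def less_Suc_eq)
    then have "Pi_pmf (\<Union>i<Suc N. B i) d (\<lambda>_. M) = map_pmf (\<lambda>(x, y). h x y) (pair_pmf P Q)"
      unfolding P_def Q_def h_def using Pi_pmf_union[OF finA finBN AB] by simp
    also have "\<dots> = bind_pmf Q (\<lambda>y. map_pmf (\<lambda>x. h x y) P)"
      unfolding pair_pmf_def by (subst bind_commute_pmf) (simp add: map_bind_pmf map_pmf_def bind_assoc_pmf bind_return_pmf)
    finally have eq: "Pi_pmf (\<Union>i<Suc N. B i) d (\<lambda>_. M) = bind_pmf Q (\<lambda>y. map_pmf (\<lambda>x. h x y) P)" .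
    show ?thesis
      unfolding eq by (subst pmf_expectation_bind[where A = "set_pmf Q"])
        (use finP finQ in \<open>auto simp: integral_measure_pmf_real[where A = "set_pmf Q"] mult.commute\<close>)
  qed
  have lipN: "f (h x y) \<le> f (h x y') + 1" if "\<And>e. e \<notin> B N \<Longrightarrow> y e = y' e" for x y y'
  proof -
    have "\<forall>e. e \<notin> B N \<longrightarrow> h x y e = h x y' e"
      using that by (simp add: h_def)
    then show ?thesis
      using Suc.prems(3) unfolding lipschitz_blocks_def by blast
  qed
  have Gpos: "0 < G y" for y
  proof -
    obtain x0 where x0: "x0 \<in> set_pmf P"
      using set_pmf_not_empty by fast
    have "0 < pmf P x0 * exp (l * f (h x0 y))"
      using x0 by (simp add: pmf_positive)
    also have "\<dots> \<le> (\<Sum>x\<in>set_pmf P. pmf P x * exp (l * f (h x y)))"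
      by (rule member_le_sum[OF x0]) (use finP in auto)
    also have "\<dots> = G y"
      unfolding G_def by (subst integral_measure_pmf_real[OF finP]) (auto simp: mult.commute)
    finally show ?thesis .
  qed
  have GH: "G y * H y \<le> exp (real N * l\<^sup>2 / 2)" for y
    unfolding G_def H_def P_def A_def
  proof (rule Suc.IH)
    show "lipschitz_blocks N B (\<lambda>x. f (h x y))"
      unfolding lipschitz_blocks_def
    proof (intro allI impI)
      fix i and x x' :: "'a \<Rightarrow> 'b" assume "i < N" and *: "\<forall>e. e \<notin> B i \<longrightarrow> x e = x' e"
      then have "\<forall>e. e \<notin> B i \<longrightarrow> h x y e = h x' y e"
        by (simp add: h_def)
      then show "f (h x y) \<le> f (h x' y) + 1"
        using Suc.prems(3) \<open>i < N\<close> unfolding lipschitz_blocks_def by (meson less_SucI)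
    qed
  qed (use Suc.prems in auto)
  \<comment> \<open>\<open>r\<close> resets the coordinates outside \<open>B N\<close>, where points of \<open>set_pmf Q\<close> equal \<open>d\<close>; thus \<open>G \<circ> r\<close> oscillates by at most \<open>exp l\<close>\<close>
  define r where "r y = (\<lambda>e. if e \<in> B N then y e else d)" for y :: "'a \<Rightarrow> 'b"
  have ry: "r y = y" if "y \<in> set_pmf Q" for y
    using that set_Pi_pmf_subset[OF finBN] unfolding Q_def r_def by force
  have osc: "G (r y) \<le> exp l * G (r y')" for y y'
  proof -
    have "G (r y) \<le> measure_pmf.expectation P (\<lambda>x. exp l * exp (l * f (h x (r y'))))"
      unfolding G_def
    proof (rule integral_mono[OF intP intP])
      fix x
      have "f (h x (r y)) \<le> f (h x (r y')) + 1"
        by (rule lipN) (simp add: r_def)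
      then have "l * f (h x (r y)) \<le> l * (f (h x (r y')) + 1)"
        using \<open>0 \<le> l\<close> by (rule mult_left_mono)
      then show "exp (l * f (h x (r y))) \<le> exp l * exp (l * f (h x (r y')))"
        by (simp add: algebra_simps flip: exp_add)
    qed
    then show ?thesis
      by (simp add: G_def)
  qed
  have Q_cong: "measure_pmf.expectation Q g = measure_pmf.expectation Q (\<lambda>y. g (r y))" for g :: "_ \<Rightarrow> real"
    by (rule integral_cong_AE) (auto simp: AE_measure_pmf_iff ry)
  have "measure_pmf.expectation Q G * measure_pmf.expectation Q H \<le>
      measure_pmf.expectation Q G * measure_pmf.expectation Q (\<lambda>y. exp (real N * l\<^sup>2 / 2) * (1 / G y))"
  proof (intro mult_left_mono integral_mono[OF intQ intQ])
    fix y
    show "H y \<le> exp (real N * l\<^sup>2 / 2) * (1 / G y)"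
      using GH[of y] Gpos[of y] by (simp add: field_simps)
  qed (use Gpos in \<open>auto intro!: integral_nonneg simp: less_imp_le\<close>)
  also have "\<dots> = exp (real N * l\<^sup>2 / 2) * (measure_pmf.expectation Q G * measure_pmf.expectation Q (\<lambda>y. 1 / G y))"
    by (subst integral_mult_right_zero) (simp only: mult_ac)
  also have "measure_pmf.expectation Q G * measure_pmf.expectation Q (\<lambda>y. 1 / G y) \<le> exp (l\<^sup>2 / 2)"
    unfolding Q_cong[of G] Q_cong[of "\<lambda>y. 1 / G y"]
    by (rule expectation_mult_inverse_le[OF finQ Gpos osc \<open>0 \<le> l\<close>])
  finally have "measure_pmf.expectation Q G * measure_pmf.expectation Q H \<le>
      exp (real N * l\<^sup>2 / 2) * exp (l\<^sup>2 / 2)"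
    by simp
  also have "\<dots> = exp (real (Suc N) * l\<^sup>2 / 2)"
    by (simp add: field_simps flip: exp_add)
  finally show ?case
    unfolding split G_def H_def .
qed

text \<open>Markov's inequality for \<open>exp (l * f)\<close> and for \<open>exp (- l * f)\<close>.
  The centre \<open>c\<close> cancels in the product, so any lower bound for the probability of
  reaching \<open>c\<close> becomes an upper bound for the probability of falling below
  \<open>c - t\<close>.\<close>

lemma prob_le_lipschitz_blocks:
  fixes M :: "'b pmf" and f :: "('a \<Rightarrow> 'b) \<Rightarrow> real" and d :: 'b
  assumes finM: "finite (set_pmf M)" and "0 < N" "0 \<le> t"
    and finB: "\<And>i. i < N \<Longrightarrow> finite (B i)"
    and disj: "\<And>i j. i < j \<Longrightarrow> j < N \<Longrightarrow> B i \<inter> B j = {}"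
    and lip: "lipschitz_blocks N B f"
  defines "P \<equiv> Pi_pmf (\<Union>i<N. B i) d (\<lambda>_. M)"
  shows "measure_pmf.prob P {x. f x \<le> c - t} * measure_pmf.prob P {x. c \<le> f x}
    \<le> exp (- (t\<^sup>2 / (2 * real N)))"
proof -
  \<comment> \<open>The minimiser of \<open>N * l\<^sup>2 / 2 - l * t\<close>.\<close>
  define l where "l = t / real N"
  have l: "0 \<le> l"
    using assms(2,3) by (simp add: l_def)
  have finP: "finite (set_pmf P)"
    unfolding P_def using finM finB by (auto simp: set_Pi_pmf)
  note int = integrable_measure_pmf_finite[OF finP]
  have E: "measure_pmf.expectation P (indicator S) = measure_pmf.prob P S" for S
    by simp
  have "exp (l * c) * measure_pmf.prob P {x. c \<le> f x} =
      measure_pmf.expectation P (\<lambda>x. exp (l * c) * indicator {x. c \<le> f x} x)"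
    by simp
  also have "\<dots> \<le> measure_pmf.expectation P (\<lambda>x. exp (l * f x))"
    using l by (intro integral_mono[OF int int]) (auto simp: indicator_def mult_left_mono)
  finally have 1: "exp (l * c) * measure_pmf.prob P {x. c \<le> f x} \<le> measure_pmf.expectation P (\<lambda>x. exp (l * f x))" .
  have "exp (- l * (c - t)) * measure_pmf.prob P {x. f x \<le> c - t} =
      measure_pmf.expectation P (\<lambda>x. exp (- l * (c - t)) * indicator {x. f x \<le> c - t} x)"
    by simp
  also have "\<dots> \<le> measure_pmf.expectation P (\<lambda>x. exp (- l * f x))"
  proof (intro integral_mono[OF int int])
    fix x
    show "exp (- l * (c - t)) * indicator {x. f x \<le> c - t} x \<le> exp (- l * f x)"
      using mult_left_mono[of "f x" "c - t" l] l by (auto simp: indicator_def)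
  qed
  finally have 2: "exp (- l * (c - t)) * measure_pmf.prob P {x. f x \<le> c - t} \<le> measure_pmf.expectation P (\<lambda>x. exp (- l * f x))" .
  have "exp (l * t) * (measure_pmf.prob P {x. f x \<le> c - t} * measure_pmf.prob P {x. c \<le> f x}) =
      (exp (l * c) * measure_pmf.prob P {x. c \<le> f x}) * (exp (- l * (c - t)) * measure_pmf.prob P {x. f x \<le> c - t})"
  proof -
    have "exp (l * t) = exp (l * c) * exp (- l * (c - t))"
      by (simp add: algebra_simps flip: exp_add)
    then show ?thesis
      by (simp only: mult_ac)
  qed
  also have "\<dots> \<le> measure_pmf.expectation P (\<lambda>x. exp (l * f x)) * measure_pmf.expectation P (\<lambda>x. exp (- l * f x))"
    by (rule mult_mono[OF 1 2]) (auto intro!: integral_nonneg)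
  also have "\<dots> \<le> exp (real N * l\<^sup>2 / 2)"
    unfolding P_def by (rule exp_moments_lipschitz_blocks[OF finM l finB disj lip])
  finally have "measure_pmf.prob P {x. f x \<le> c - t} * measure_pmf.prob P {x. c \<le> f x} \<le>
      exp (real N * l\<^sup>2 / 2) / exp (l * t)"
    by (simp add: le_divide_eq mult.commute)
  also have "\<dots> = exp (real N * l\<^sup>2 / 2 - l * t)"
    by (simp add: exp_diff)
  also have "real N * l\<^sup>2 / 2 - l * t = - (t\<^sup>2 / (2 * real N))"
    using assms(2) by (simp add: l_def power2_eq_square field_simps)
  finally show ?thesis .
qed

section \<open>The second moment of the number of induced trees\<close>

lemma sum_Pow_power_card:
  fixes x :: "'b :: comm_semiring_1"
  assumes "finite A"
  shows "(\<Sum>B\<in>Pow A. x ^ card B) = (1 + x) ^ card A"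
  using assms
proof (induction A rule: finite_induct)
  case (insert a A)
  have fin: "finite B" if "B \<in> Pow A" for B
    using that insert.hyps(1) by (auto intro: finite_subset)
  have inj: "inj_on (insert a) (Pow A)"
    using insert.hyps(2) by (auto simp: inj_on_def)
  have "(\<Sum>B\<in>Pow (insert a A). x ^ card B) = (\<Sum>B\<in>Pow A. x ^ card B) + (\<Sum>B\<in>insert a ` Pow A. x ^ card B)"
    unfolding Pow_insert using insert.hyps by (intro sum.union_disjoint) auto
  also have "(\<Sum>B\<in>insert a ` Pow A. x ^ card B) = (\<Sum>B\<in>Pow A. x * x ^ card B)"
  proof (subst sum.reindex[OF inj], rule sum.cong[OF refl])
    fix B assume "B \<in> Pow A"
    then show "((\<lambda>B. x ^ card B) \<circ> insert a) B = x * x ^ card B"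
      using fin[of B] insert.hyps(2) by (auto simp: card_insert_if)
  qed
  also have "\<dots> = x * (\<Sum>B\<in>Pow A. x ^ card B)"
    by (simp add: sum_distrib_left)
  finally show ?case
    using insert by (simp add: algebra_simps)
qed simp

text \<open>Trees that differ on a pair of common vertices belong to disjoint events, so only
  consistent pairs enter the second moment.\<close>

definition consistent_trees :: "'a set \<Rightarrow> 'a set \<Rightarrow> 'a set set \<Rightarrow> 'a set set \<Rightarrow> bool" where
  "consistent_trees S S' T T' \<longleftrightarrow> T \<inter> all_pairs S' = T' \<inter> all_pairs S"

lemma consistent_trees_Int:
  assumes "T \<subseteq> all_pairs S" "T' \<subseteq> all_pairs S'" "consistent_trees S S' T T'"
  shows "T \<inter> T' = T \<inter> all_pairs (S \<inter> S')" "T \<inter> T' = T' \<inter> all_pairs (S \<inter> S')"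
  using assms unfolding consistent_trees_def all_pairs_Int[symmetric] by blast+

text \<open>\<open>(1 / w) ^ card (T \<inter> T')\<close> is at most the sum of
  \<open>(1 / w) ^ card H\<close> over all \<open>H\<close> contained in both trees. For fixed
  \<open>H\<close> the sums over \<open>T\<close> and \<open>T'\<close> separate, and each
  contributes \<open>t * y ^ card H\<close> by \<open>card_bounded_trees_containing_le\<close>.
  Summing over all sets \<open>H\<close> of common pairs gives the power of
  \<open>1 + x\<close>.\<close>

lemma sum_consistent_trees_le_small:
  fixes w :: real and \<Delta> :: nat
  assumes fin: "finite S" "finite S'" and card: "card S = k" "card S' = k" and w: "0 < w"
  defines "x \<equiv> (real \<Delta> * exp 1 ^ 2 / real k)\<^sup>2 / w"
  shows "(\<Sum>T\<in>bounded_trees \<Delta> S. \<Sum>T'\<in>{T' \<in> bounded_trees \<Delta> S'. consistent_trees S S' T T'}. (1 / w) ^ card (T \<inter> T'))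
    \<le> (real (card (bounded_trees \<Delta> S)))\<^sup>2 * (1 + x) ^ (card (S \<inter> S') choose 2)"
proof -
  define t where "t = card (bounded_trees \<Delta> S)"
  define y where "y = real \<Delta> * exp 1 ^ 2 / real k"
  define Q where "Q = all_pairs (S \<inter> S')"
  have t': "card (bounded_trees \<Delta> S') = t"
    unfolding t_def using fin card by (intro card_bounded_trees_cong) auto
  have finQ: "finite Q"
    using fin by (simp add: Q_def)
  have "(\<Sum>T'\<in>{T' \<in> bounded_trees \<Delta> S'. consistent_trees S S' T T'}. (1 / w) ^ card (T \<inter> T')) \<le>
      (\<Sum>H\<in>Pow Q. \<Sum>T'\<in>bounded_trees \<Delta> S'. if H \<subseteq> T \<and> H \<subseteq> T' then (1 / w) ^ card H else 0)"
    if T: "T \<in> bounded_trees \<Delta> S" for T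
  proof -
    have "(\<Sum>T'\<in>{T' \<in> bounded_trees \<Delta> S'. consistent_trees S S' T T'}. (1 / w) ^ card (T \<inter> T')) \<le>
        (\<Sum>T'\<in>bounded_trees \<Delta> S'. (1 / w) ^ card (T \<inter> T'))"
      using fin w by (intro sum_mono2) auto
    also have "\<dots> \<le> (\<Sum>T'\<in>bounded_trees \<Delta> S'. \<Sum>H\<in>Pow Q. if H \<subseteq> T \<and> H \<subseteq> T' then (1 / w) ^ card H else 0)"
    proof (rule sum_mono)
      fix T' assume T': "T' \<in> bounded_trees \<Delta> S'"
      have "T \<inter> T' \<in> Pow Q"
        using T T' by (auto simp: Q_def bounded_trees_def simp flip: all_pairs_Int)
      then have "(if T \<inter> T' \<subseteq> T \<and> T \<inter> T' \<subseteq> T' then (1 / w) ^ card (T \<inter> T') else 0) \<le>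
          (\<Sum>H\<in>Pow Q. if H \<subseteq> T \<and> H \<subseteq> T' then (1 / w) ^ card H else 0)"
        using finQ w by (intro member_le_sum[where f = "\<lambda>H. if H \<subseteq> T \<and> H \<subseteq> T' then (1 / w) ^ card H else 0"]) auto
      then show "(1 / w) ^ card (T \<inter> T') \<le> (\<Sum>H\<in>Pow Q. if H \<subseteq> T \<and> H \<subseteq> T' then (1 / w) ^ card H else 0)"
        by simp
    qed
    also have "\<dots> = (\<Sum>H\<in>Pow Q. \<Sum>T'\<in>bounded_trees \<Delta> S'. if H \<subseteq> T \<and> H \<subseteq> T' then (1 / w) ^ card H else 0)"
      by (rule sum.swap)
    finally show ?thesis .
  qed
  then have "(\<Sum>T\<in>bounded_trees \<Delta> S. \<Sum>T'\<in>{T' \<in> bounded_trees \<Delta> S'. consistent_trees S S' T T'}. (1 / w) ^ card (T \<inter> T'))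
    \<le> (\<Sum>T\<in>bounded_trees \<Delta> S. \<Sum>H\<in>Pow Q. \<Sum>T'\<in>bounded_trees \<Delta> S'. if H \<subseteq> T \<and> H \<subseteq> T' then (1 / w) ^ card H else 0)"
    by (rule sum_mono)
  also have "\<dots> = (\<Sum>H\<in>Pow Q. \<Sum>T\<in>bounded_trees \<Delta> S. \<Sum>T'\<in>bounded_trees \<Delta> S'. if H \<subseteq> T \<and> H \<subseteq> T' then (1 / w) ^ card H else 0)"
    by (rule sum.swap)
  also have "\<dots> \<le> (\<Sum>H\<in>Pow Q. (real t)\<^sup>2 * x ^ card H)"
  proof (rule sum_mono)
    fix H assume "H \<in> Pow Q"
    then have H: "H \<subseteq> all_pairs S" "H \<subseteq> all_pairs S'"
      by (auto simp: Q_def simp flip: all_pairs_Int)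
    have "(\<Sum>T\<in>bounded_trees \<Delta> S. \<Sum>T'\<in>bounded_trees \<Delta> S'. if H \<subseteq> T \<and> H \<subseteq> T' then (1 / w) ^ card H else 0)
        = (\<Sum>T\<in>bounded_trees \<Delta> S. (if H \<subseteq> T then 1 else 0) * ((\<Sum>T'\<in>bounded_trees \<Delta> S'. (if H \<subseteq> T' then 1 else 0)) * (1 / w) ^ card H))"
      unfolding sum_distrib_left sum_distrib_right by (intro sum.cong refl) auto
    also have "\<dots> = real (card {T \<in> bounded_trees \<Delta> S. H \<subseteq> T}) * (real (card {T \<in> bounded_trees \<Delta> S'. H \<subseteq> T}) * (1 / w) ^ card H)"
      unfolding sum_distrib_right[symmetric] using fin by (simp add: sum.If_cases Int_def)
    also have "\<dots> \<le> (real t * y ^ card H) * ((real t * y ^ card H) * (1 / w) ^ card H)"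
      using card_bounded_trees_containing_le[OF fin(1) H(1), of \<Delta>] card_bounded_trees_containing_le[OF fin(2) H(2), of \<Delta>]
        card t' w by (intro mult_mono mult_right_mono) (auto simp: t_def y_def)
    also have "\<dots> = (real t)\<^sup>2 * x ^ card H"
    proof -
      have "x = y * y * (1 / w)"
        by (simp add: x_def y_def power2_eq_square)
      then show ?thesis
        by (simp only: power_mult_distrib power2_eq_square mult_ac)
    qed
    finally show "(\<Sum>T\<in>bounded_trees \<Delta> S. \<Sum>T'\<in>bounded_trees \<Delta> S'. if H \<subseteq> T \<and> H \<subseteq> T' then (1 / w) ^ card H else 0)
        \<le> (real t)\<^sup>2 * x ^ card H" .
  qed
  also have "\<dots> = (real t)\<^sup>2 * (1 + x) ^ card Q"
    by (simp add: sum_Pow_power_card[OF finQ] flip: sum_distrib_left)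
  finally show ?thesis
    using fin by (simp add: t_def Q_def card_all_pairs)
qed

text \<open>Each of the \<open>k - l\<close> further vertices lies in fewer than \<open>k\<close>
  pairs.\<close>

lemma choose_2_diff_le:
  assumes "l \<le> k"
  shows "(k choose 2) - (l choose 2) \<le> (k - l) * k"
proof -
  obtain j where k: "k = l + j"
    using assms le_Suc_ex by blast
  have "(l + j) choose 2 \<le> (l choose 2) + j * (l + j)" for j
    by (induction j) (auto simp: numeral_2_eq_2 algebra_simps)
  then show ?thesis
    unfolding k by (simp add: le_diff_conv add.commute)
qed

text \<open>\<open>T'\<close> is determined by its \<open>r\<close> edges outside \<open>H\<close>,
  chosen from the pairs \<open>Q\<close> of \<open>S'\<close> that do not lie in the intersection.
  \<open>T\<close> has equally many edges outside \<open>H\<close>, and each of them meets one of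
  the \<open>j\<close> vertices of \<open>S - S'\<close>, so
  \<open>r \<le> \<Delta> * j\<close>.\<close>

lemma sum_consistent_trees_le_large:
  fixes w :: real
  assumes fin: "finite S" "finite S'" and card: "card S = k" "card S' = k" and w: "0 < w"
    and T: "T \<in> bounded_trees \<Delta> S" and "0 < k"
  defines "j \<equiv> k - card (S \<inter> S')"
  shows "(\<Sum>T'\<in>{T' \<in> bounded_trees \<Delta> S'. consistent_trees S S' T T'}. (1 / w) ^ card (T \<inter> T'))
    \<le> (1 / w) ^ (k - 1) * (exp 1 * (1 + real k * w) ^ \<Delta>) ^ j"
proof -
  define I where "I = S \<inter> S'"
  define H where "H = T \<inter> all_pairs I"
  define Q where "Q = all_pairs S' - all_pairs I"
  define r where "r = k - 1 - card H"
  \<comment> \<open>The number of \<open>r\<close>-subsets of \<open>Q\<close> times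
    \<open>w ^ r\<close> is at most \<open>z ^ r * (1 + w / z) ^ card Q\<close>. As
    \<open>card Q \<le> j * k\<close>, this \<open>z\<close> keeps the second factor below
    \<open>exp j\<close>, while the first is at most \<open>z ^ (\<Delta> * j)\<close>.\<close>
  define z where "z = 1 + real k * w"
  define C where "C = {T' \<in> bounded_trees \<Delta> S'. consistent_trees S S' T T'}"
  have z: "1 \<le> z"
    using w by (simp add: z_def)
  have TS: "T \<subseteq> all_pairs S" and cT: "card T = k - 1"
    using T card by (auto simp: bounded_trees_def)
  have finT: "finite T"
    using TS fin(1) finite_subset by blast
  have finI: "finite I" and Ik: "card I \<le> k"
    using fin card by (auto simp: I_def intro: card_mono[of S "S \<inter> S'", THEN order_trans])
  have finQ: "finite Q"
    using fin by (simp add: Q_def)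
  have C: "T' \<in> bounded_trees \<Delta> S'" "T \<inter> T' = H" "T' \<inter> all_pairs I = H" "T' \<subseteq> all_pairs S'"
      "card T' = k - 1" "finite T'" if "T' \<in> C" for T'
  proof -
    show 1: "T' \<in> bounded_trees \<Delta> S'"
      using that by (simp add: C_def)
    then show 2: "T' \<subseteq> all_pairs S'" "card T' = k - 1"
      using card by (auto simp: bounded_trees_def)
    then show "finite T'"
      using fin(2) finite_subset by blast
    have "consistent_trees S S' T T'"
      using that by (simp add: C_def)
    from consistent_trees_Int[OF TS 2(1) this] show "T \<inter> T' = H" "T' \<inter> all_pairs I = H"
      by (auto simp: H_def I_def)
  qed
  have r\<Delta>: "r \<le> \<Delta> * j"
  proof -
    have "r = card (T - H)"
      unfolding r_def using cT finT by (subst card_Diff_subset) (auto simp: H_def)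
    also have "\<dots> \<le> card (\<Union>v\<in>S - I. {e \<in> T. v \<in> e})"
    proof (rule card_mono)
      show "finite (\<Union>v\<in>S - I. {e \<in> T. v \<in> e})"
        using fin finT by auto
      show "T - H \<subseteq> (\<Union>v\<in>S - I. {e \<in> T. v \<in> e})"
      proof
        fix e assume e: "e \<in> T - H"
        then have "e \<subseteq> S" "card e = 2"
          using TS by (auto simp: all_pairs_def)
        then have "\<not> e \<subseteq> I"
          using e by (auto simp: H_def all_pairs_def)
        then show "e \<in> (\<Union>v\<in>S - I. {e \<in> T. v \<in> e})"
          using e \<open>e \<subseteq> S\<close> by blast
      qed
    qed
    also have "\<dots> \<le> (\<Sum>v\<in>S - I. card {e \<in> T. v \<in> e})"
      using fin by (intro card_UN_le) auto
    also have "\<dots> \<le> (\<Sum>v\<in>S - I. \<Delta>)"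
      using T by (intro sum_mono) (auto simp: bounded_trees_def degree_in_def)
    also have "\<dots> = \<Delta> * j"
      using fin card finI by (simp add: I_def j_def card_Diff_subset)
    finally show ?thesis .
  qed
  have cQ: "real (card Q) * w / z \<le> real j"
  proof -
    have "card Q = (k choose 2) - (card I choose 2)"
      unfolding Q_def using fin finI card
      by (subst card_Diff_subset) (auto simp: card_all_pairs I_def intro: all_pairs_mono[THEN subsetD])
    also have "\<dots> \<le> j * k"
      using choose_2_diff_le[OF Ik] by (simp add: j_def I_def)
    finally have "real (card Q) \<le> real j * real k"
      by (metis of_nat_mono of_nat_mult)
    then have "real (card Q) * w \<le> real j * real k * w"
      using w by (intro mult_right_mono) auto
    also have "\<dots> \<le> real j * z"
      by (simp add: z_def algebra_simps)
    finally show ?thesis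
      using z by (simp add: divide_le_eq)
  qed
  have cC: "card C \<le> card {D \<in> Pow Q. card D = r}"
  proof (rule card_inj_on_le)
    show "inj_on (\<lambda>T'. T' - H) C"
    proof (rule inj_onI)
      fix T1 T2 assume *: "T1 \<in> C" "T2 \<in> C" "T1 - H = T2 - H"
      have "H \<subseteq> T1" "H \<subseteq> T2"
        using C(3)[OF *(1)] C(3)[OF *(2)] by blast+
      then show "T1 = T2"
        using *(3) by blast
    qed
    show "(\<lambda>T'. T' - H) ` C \<subseteq> {D \<in> Pow Q. card D = r}"
    proof (intro image_subsetI CollectI conjI PowI)
      fix T' assume T': "T' \<in> C"
      show "T' - H \<subseteq> Q"
        using C(3,4)[OF T'] by (auto simp: Q_def)
      have "H \<subseteq> T'"
        using C(3)[OF T'] by blast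
      then show "card (T' - H) = r"
        using C(5,6)[OF T'] by (simp add: r_def card_Diff_subset finite_subset)
    qed
    show "finite {D \<in> Pow Q. card D = r}"
      using finQ by auto
  qed
  show ?thesis
  proof (cases "C = {}")
    case True
    then show ?thesis
      using w by (simp add: C_def[symmetric])
  next
    case False
    then obtain T0 where T0: "T0 \<in> C"
      by blast
    have "card H \<le> k - 1"
      unfolding C(2)[OF T0, symmetric] cT[symmetric] using finT by (intro card_mono) auto
    then have kr: "k - 1 = card H + r"
      by (simp add: r_def)
    have "(\<Sum>T'\<in>C. (1 / w) ^ card (T \<inter> T')) = real (card C) * (1 / w) ^ card H"
      using C(2) by simp
    also have "\<dots> = (1 / w) ^ (k - 1) * (real (card C) * w ^ r)"
      unfolding kr power_add power_divide using w by simp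
    also have "real (card C) * w ^ r \<le> real (card {D \<in> Pow Q. card D = r}) * w ^ r"
      using cC w by (intro mult_right_mono) auto
    also have "\<dots> = (\<Sum>D\<in>{D \<in> Pow Q. card D = r}. z ^ r * (w / z) ^ card D)"
      using z by (simp add: power_divide)
    also have "\<dots> \<le> (\<Sum>D\<in>Pow Q. z ^ r * (w / z) ^ card D)"
      using finQ z w by (intro sum_mono2) auto
    also have "\<dots> = z ^ r * (1 + w / z) ^ card Q"
      by (simp add: sum_Pow_power_card[OF finQ] flip: sum_distrib_left)
    also have "\<dots> \<le> z ^ (\<Delta> * j) * exp (real j)"
    proof (rule mult_mono)
      have "(1 + w / z) ^ card Q \<le> exp (w / z) ^ card Q"
        using w z by (intro power_mono exp_ge_add_one_self) auto
      also have "\<dots> = exp (real (card Q) * w / z)"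
        by (simp flip: exp_of_nat_mult)
      also have "\<dots> \<le> exp (real j)"
        using cQ by simp
      finally show "(1 + w / z) ^ card Q \<le> exp (real j)" .
    qed (use r\<Delta> z w in \<open>auto intro!: power_increasing\<close>)
    also have "z ^ (\<Delta> * j) * exp (real j) = (exp 1 * z ^ \<Delta>) ^ j"
      by (simp add: power_mult_distrib power_mult flip: exp_of_nat_mult)
    finally show ?thesis
      using w by (simp add: C_def z_def)
  qed
qed


section \<open>Probabilities of induced trees and of their overlaps\<close>

definition edge_pmf :: "'a set \<Rightarrow> real \<Rightarrow> ('a set \<Rightarrow> bool) pmf" where
  "edge_pmf V p = Pi_pmf (all_pairs V) False (\<lambda>_. bernoulli_pmf p)"

definition induced_event :: "'a set \<Rightarrow> 'a set set \<Rightarrow> ('a set \<Rightarrow> bool) set" where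
  "induced_event S T = {f. (\<forall>e\<in>T. f e) \<and> (\<forall>e\<in>all_pairs S - T. \<not> f e)}"

lemma prob_edge_pattern:
  assumes "finite V" "Y \<subseteq> Q" "Q \<subseteq> all_pairs V" "0 < p" "p < 1"
  shows "measure_pmf.prob (edge_pmf V p) {f. (\<forall>e\<in>Y. f e) \<and> (\<forall>e\<in>Q - Y. \<not> f e)} =
    (p / (1 - p)) ^ card Y * (1 - p) ^ card Q"
proof -
  have fin: "finite Q"
    by (rule finite_subset[OF assms(3) finite_all_pairs[OF assms(1)]])
  moreover from assms(2) this have "finite Y"
    by (rule finite_subset)
  ultimately have "card Q = card Y + card (Q - Y)"
    using assms(2) by (simp add: card_Diff_subset card_mono)
  then have "p ^ card Y * (1 - p) ^ card (Q - Y) = (p / (1 - p)) ^ card Y * (1 - p) ^ card Q"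
    using assms(5) by (simp add: power_add power_divide)
  moreover have "measure_pmf.prob (edge_pmf V p) {f. (\<forall>e\<in>Y. f e) \<and> (\<forall>e\<in>Q - Y. \<not> f e)} =
      p ^ card Y * (1 - p) ^ card (Q - Y)"
    unfolding edge_pmf_def using assms by (intro prob_Pi_bernoulli_pattern) auto
  ultimately show ?thesis by simp
qed

lemma prob_induced_event:
  assumes "finite V" "S \<subseteq> V" "T \<subseteq> all_pairs S" "0 < p" "p < 1"
  shows "measure_pmf.prob (edge_pmf V p) (induced_event S T) =
    (p / (1 - p)) ^ card T * (1 - p) ^ (card S choose 2)"
proof -
  have "finite S"
    using assms(1,2) finite_subset by blast
  then show ?thesis
    unfolding induced_event_def using prob_edge_pattern[OF assms(1,3) all_pairs_mono[OF assms(2)] assms(4,5)]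
    by (simp add: card_all_pairs)
qed

text \<open>Two consistent events together prescribe the edge set \<open>Y = T \<union> T'\<close>
  on the pairs \<open>Q\<close> of both vertex sets. Inclusion and exclusion for the sizes of
  \<open>Y\<close> and \<open>Q\<close> compares this with the product of the two probabilities:
  only common edges and common pairs make a difference.\<close>

lemma prob_induced_event_Int_le:
  fixes p :: real
  assumes V: "finite V" "S \<subseteq> V" "S' \<subseteq> V" and T: "T \<subseteq> all_pairs S" "T' \<subseteq> all_pairs S'"
    and card: "card S = k" "card S' = k" "card T = k - 1" "card T' = k - 1" and p: "0 < p" "p < 1"
  defines "w \<equiv> p / (1 - p)" and "\<mu> \<equiv> (p / (1 - p)) ^ (k - 1) * (1 - p) ^ (k choose 2)"
  shows "measure_pmf.prob (edge_pmf V p) (induced_event S T \<inter> induced_event S' T') \<le>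
    (if consistent_trees S S' T T'
     then \<mu>\<^sup>2 * (1 / (1 - p)) ^ (card (S \<inter> S') choose 2) * (1 / w) ^ card (T \<inter> T') else 0)"
proof (cases "consistent_trees S S' T T'")
  case False
  then obtain e where "e \<in> T \<and> e \<in> all_pairs S' \<and> e \<notin> T' \<or> e \<in> T' \<and> e \<in> all_pairs S \<and> e \<notin> T"
    using T unfolding consistent_trees_def by blast
  then have "induced_event S T \<inter> induced_event S' T' = {}"
    unfolding induced_event_def by blast
  then show ?thesis
    using False by simp
next
  case True
  define Y where "Y = T \<union> T'"
  define Q where "Q = all_pairs S \<union> all_pairs S'"
  have fin: "finite S" "finite S'" "finite T" "finite T'"
    using finite_subset[OF V(2,1)] finite_subset[OF V(3,1)] finite_subset[OF T(1)] finite_subset[OF T(2)]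
    by simp_all
  have "all_pairs S - T \<union> (all_pairs S' - T') = Q - Y"
    using True T unfolding consistent_trees_def Q_def Y_def by blast
  then have "induced_event S T \<inter> induced_event S' T' = {f. (\<forall>e\<in>Y. f e) \<and> (\<forall>e\<in>Q - Y. \<not> f e)}"
    unfolding induced_event_def Y_def by blast
  moreover have "Y \<subseteq> Q" "Q \<subseteq> all_pairs V"
    using T all_pairs_mono[OF V(2)] all_pairs_mono[OF V(3)] unfolding Y_def Q_def by blast+
  ultimately have "measure_pmf.prob (edge_pmf V p) (induced_event S T \<inter> induced_event S' T') =
      w ^ card Y * (1 - p) ^ card Q"
    using prob_edge_pattern[OF V(1) _ _ p, of Y Q] by (simp add: w_def)
  moreover have "card Y + card (T \<inter> T') = (k - 1) + (k - 1)"
    unfolding Y_def using card_Un_Int[OF fin(3,4)] card by simp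
  then have "w ^ card Y * w ^ card (T \<inter> T') = w ^ (k - 1) * w ^ (k - 1)"
    by (simp flip: power_add)
  then have "w ^ card Y = w ^ (k - 1) * w ^ (k - 1) * (1 / w) ^ card (T \<inter> T')"
    using p by (simp add: w_def power_divide field_simps)
  moreover have "card Q + (card (S \<inter> S') choose 2) = (k choose 2) + (k choose 2)"
    unfolding Q_def using card_Un_Int[of "all_pairs S" "all_pairs S'"] fin card
    by (simp add: card_all_pairs all_pairs_Int)
  then have "(1 - p) ^ card Q * (1 - p) ^ (card (S \<inter> S') choose 2) = (1 - p) ^ (k choose 2) * (1 - p) ^ (k choose 2)"
    by (simp flip: power_add)
  then have "(1 - p) ^ card Q = (1 - p) ^ (k choose 2) * (1 - p) ^ (k choose 2) * (1 / (1 - p)) ^ (card (S \<inter> S') choose 2)"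
    using p by (simp add: power_divide field_simps)
  ultimately show ?thesis
    using True by (simp add: \<mu>_def w_def power2_eq_square)
qed

text \<open>A union bound over the possible intersections \<open>I\<close>.\<close>

lemma card_transversals_overlap_le:
  assumes "finite X" "finite B" "\<And>j. j \<in> B \<Longrightarrow> card {x \<in> X. b x = j} = m" "b ` X \<subseteq> B"
    and S: "S \<in> transversals b X k"
  shows "card {S' \<in> transversals b X k. card (S \<inter> S') = l} \<le>
    (k choose l) * ((card B - l choose (k - l)) * m ^ (k - l))"
proof -
  have S': "S \<subseteq> X" "card S = k" "inj_on b S"
    using S by (auto simp: transversals_def)
  have finS: "finite S"
    using S'(1) assms(1) finite_subset by blast
  have "card {S' \<in> transversals b X k. card (S \<inter> S') = l} \<le>
      card (\<Union>I\<in>{I. I \<subseteq> S \<and> card I = l}. {S' \<in> transversals b X k. I \<subseteq> S'})"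
  proof (rule card_mono)
    show "finite (\<Union>I\<in>{I. I \<subseteq> S \<and> card I = l}. {S' \<in> transversals b X k. I \<subseteq> S'})"
      using finS assms(1) by auto
    show "{S' \<in> transversals b X k. card (S \<inter> S') = l} \<subseteq>
        (\<Union>I\<in>{I. I \<subseteq> S \<and> card I = l}. {S' \<in> transversals b X k. I \<subseteq> S'})"
    proof
      fix S' assume "S' \<in> {S' \<in> transversals b X k. card (S \<inter> S') = l}"
      then show "S' \<in> (\<Union>I\<in>{I. I \<subseteq> S \<and> card I = l}. {S' \<in> transversals b X k. I \<subseteq> S'})"
        by (intro UN_I[of "S \<inter> S'"]) simp_all
    qed
  qed
  also have "\<dots> \<le> (\<Sum>I\<in>{I. I \<subseteq> S \<and> card I = l}. card {S' \<in> transversals b X k. I \<subseteq> S'})"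
    using finS by (intro card_UN_le) auto
  also have "\<dots> \<le> (\<Sum>I\<in>{I. I \<subseteq> S \<and> card I = l}. (card B - l choose (k - l)) * m ^ (k - l))"
  proof (rule sum_mono)
    fix I assume "I \<in> {I. I \<subseteq> S \<and> card I = l}"
    then have I: "I \<subseteq> S" "card I = l"
      by auto
    show "card {S' \<in> transversals b X k. I \<subseteq> S'} \<le> (card B - l choose (k - l)) * m ^ (k - l)"
      using card_transversals_containing_le[OF assms(1-4) order_trans[OF I(1) S'(1)] inj_on_subset[OF S'(3) I(1)]]
      unfolding I(2) by simp
  qed
  also have "\<dots> = (k choose l) * ((card B - l choose (k - l)) * m ^ (k - l))"
    using n_subsets[OF finS, of l] S'(2) by simp
  finally show ?thesis .
qed


text \<open>The denominator bounds the second moment divided by the squared mean. Overlaps in at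
  most one vertex share no pair and give the 1; overlaps with \<open>2 * l \<le> k\<close> give the
  first sum. For larger overlaps, indexed by \<open>j = k - l\<close>, the bound has a single factor
  for the number of trees and of vertex sets, so dividing by the squared mean leaves a division by
  \<open>E1\<close>.\<close>

lemma second_moment_bound:
  fixes p :: real and b :: "'a \<Rightarrow> 'b" and \<Delta> :: nat
  assumes V: "finite V" "X \<subseteq> V" and B: "finite B" "\<And>j. j \<in> B \<Longrightarrow> card {x \<in> X. b x = j} = m" "b ` X \<subseteq> B"
    and k: "2 \<le> k" "k \<le> card B" and m: "0 < m" and p: "0 < p" "p < 1"
    and t: "\<And>S :: 'a set. finite S \<Longrightarrow> card S = k \<Longrightarrow> card (bounded_trees \<Delta> S) = t" "0 < t"
  defines "n \<equiv> real (card B) * real m" and "w \<equiv> p / (1 - p)"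
    and "x \<equiv> (real \<Delta> * exp 1 ^ 2 / real k)\<^sup>2 / (p / (1 - p))"
    and "E1 \<equiv> real (card B choose k) * real m ^ k * real t * ((p / (1 - p)) ^ (k - 1) * (1 - p) ^ (k choose 2))"
  shows "1 / (1 + (\<Sum>l\<in>{2..k div 2}. real (k choose l) * (real k / n) ^ l * ((1 + x) / (1 - p)) ^ (l choose 2))
      + (\<Sum>j\<in>{j. 2 * j < k}. real (k choose j) * (n ^ j / fact j) * (exp 1 * (1 + real k * w) ^ \<Delta>) ^ j *
           (1 - p) ^ ((k choose 2) - (k - j choose 2))) / E1)
    \<le> measure_pmf.prob (edge_pmf V p) (\<Union>(S, T)\<in>Sigma (transversals b X k) (bounded_trees \<Delta>). induced_event S T)"
proof -
  define \<mu> where "\<mu> = w ^ (k - 1) * (1 - p) ^ (k choose 2)"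
  define \<S> where "\<S> = transversals b X k"
  define Idx where "Idx = Sigma \<S> (bounded_trees \<Delta>)"
  define z where "z = exp 1 * (1 + real k * w) ^ \<Delta>"
  define q where "q = 1 / (1 - p)"
  define N where "N = card B"
  have finX: "finite X"
    using V finite_subset by blast
  have w: "0 < w" and q: "0 < q" and \<mu>: "0 < \<mu>" and x: "0 \<le> x" and z: "0 < z"
    using p by (auto simp: w_def q_def \<mu>_def x_def z_def add_pos_nonneg)
  have fin\<S>: "finite \<S>"
    using finX by (simp add: \<S>_def)
  have \<S>: "S \<subseteq> V" "finite S" "card S = k" if "S \<in> \<S>" for S
    using that V finX finite_subset[of S X] by (auto simp: \<S>_def transversals_def)
  have tS: "card (bounded_trees \<Delta> S) = t" if "S \<in> \<S>" for S
    using t(1) \<S>[OF that] by blast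
  have trees: "T \<subseteq> all_pairs S" "card T = k - 1" if "S \<in> \<S>" "T \<in> bounded_trees \<Delta> S" for S T
    using that \<S>(3)[OF that(1)] by (auto simp: bounded_trees_def)
  have finIdx: "finite Idx"
    unfolding Idx_def using fin\<S> \<S>(2) by (intro finite_SigmaI) auto
  have card\<S>: "real (card \<S>) = real (N choose k) * real m ^ k"
  proof -
    have "{x \<in> X. b x \<in> B} = X"
      using B(3) by auto
    then show ?thesis
      using card_transversals[OF finX B(1,2), of k] by (simp add: \<S>_def N_def)
  qed
  have E1: "E1 = real (card \<S>) * real t * \<mu>"
    by (simp add: E1_def card\<S> \<mu>_def w_def N_def)
  have \<S>pos: "0 < real (card \<S>)"
    using k m by (simp add: card\<S> N_def)
  have E1pos: "0 < E1"
    using \<S>pos t(2) \<mu> by (simp add: E1)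
  let ?P = "\<lambda>E. measure_pmf.prob (edge_pmf V p) E"
  let ?A = "\<lambda>(S, T). induced_event S T"
  have P1: "?P (?A i) = \<mu>" if "i \<in> Idx" for i
    using that \<S> trees prob_induced_event[OF V(1) _ _ p] by (auto simp: Idx_def \<mu>_def w_def)
  have "real (card Idx) = real (card \<S>) * real t"
    unfolding Idx_def using fin\<S> \<S>(2) tS by (subst card_SigmaI) auto
  then have sum1: "(\<Sum>i\<in>Idx. ?P (?A i)) = E1"
    using P1 by (simp add: E1)
  define E2 where "E2 = (\<Sum>i\<in>Idx. \<Sum>i'\<in>Idx. ?P (?A i \<inter> ?A i'))"
  have "E1 \<le> E2"
    unfolding E2_def sum1[symmetric]
  proof (rule sum_mono)
    fix i assume "i \<in> Idx"
    then have "?P (?A i \<inter> ?A i) \<le> (\<Sum>i'\<in>Idx. ?P (?A i \<inter> ?A i'))"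
      using finIdx by (intro member_le_sum[where f = "\<lambda>i'. ?P (?A i \<inter> ?A i')"]) auto
    then show "?P (?A i) \<le> (\<Sum>i'\<in>Idx. ?P (?A i \<inter> ?A i'))"
      by simp
  qed
  \<comment> \<open>\<open>\<mu>\<^sup>2 * g l\<close> bounds the contribution of a pair of vertex
    sets with overlap \<open>l\<close>.\<close>
  define g where "g l = (if l \<le> 1 then (real t)\<^sup>2
      else if 2 * l \<le> k then (real t)\<^sup>2 * ((1 + x) * q) ^ (l choose 2)
      else real t * ((1 / w) ^ (k - 1) * z ^ (k - l)) * q ^ (l choose 2))" for l
  have g_nonneg: "0 \<le> g l" for l
    using x q w z by (auto simp: g_def intro!: mult_nonneg_nonneg)
  have pair: "(\<Sum>T\<in>bounded_trees \<Delta> S. \<Sum>T'\<in>bounded_trees \<Delta> S'. ?P (induced_event S T \<inter> induced_event S' T'))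
      \<le> \<mu>\<^sup>2 * g (card (S \<inter> S'))" if S: "S \<in> \<S>" "S' \<in> \<S>" for S S'
  proof -
    define l where "l = card (S \<inter> S')"
    define W where "W = (\<Sum>T\<in>bounded_trees \<Delta> S. \<Sum>T'\<in>{T' \<in> bounded_trees \<Delta> S'. consistent_trees S S' T T'}. (1 / w) ^ card (T \<inter> T'))"
    have "(\<Sum>T\<in>bounded_trees \<Delta> S. \<Sum>T'\<in>bounded_trees \<Delta> S'. ?P (induced_event S T \<inter> induced_event S' T')) \<le>
      (\<Sum>T\<in>bounded_trees \<Delta> S. \<Sum>T'\<in>bounded_trees \<Delta> S'.
        if consistent_trees S S' T T' then \<mu>\<^sup>2 * q ^ (l choose 2) * (1 / w) ^ card (T \<inter> T') else 0)"
      unfolding \<mu>_def w_def q_def l_def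
      by (intro sum_mono prob_induced_event_Int_le) (use S \<S> trees V p in auto)
    also have "\<dots> = \<mu>\<^sup>2 * (q ^ (l choose 2) * W)"
      using \<S>(2)[OF S(2)] 
      by (simp add: W_def sum_distrib_left sum.inter_filter mult.assoc) (auto intro!: sum.cong)
    also have "q ^ (l choose 2) * W \<le> g l"
    proof -
      have small: "W \<le> (real t)\<^sup>2 * (1 + x) ^ (l choose 2)"
        using sum_consistent_trees_le_small[of S S' k w \<Delta>] S \<S> w tS
        by (simp add: W_def l_def x_def w_def)
      consider "l \<le> 1" | "1 < l" "2 * l \<le> k" | "1 < l" "k < 2 * l"
        by linarith
      then show ?thesis
      proof cases
        case 1
        then have "l choose 2 = 0"
          by (intro binomial_eq_0) simp
        with small 1 show ?thesis
          by (simp only: g_def power_0 mult_1 mult_1_right if_True)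
      next
        case 2
        have "q ^ (l choose 2) * W \<le> q ^ (l choose 2) * ((real t)\<^sup>2 * (1 + x) ^ (l choose 2))"
          using small q by (intro mult_left_mono) auto
        then show ?thesis
          using 2 by (simp add: g_def power_mult_distrib mult_ac)
      next
        case 3
        have "W \<le> (\<Sum>T\<in>bounded_trees \<Delta> S. (1 / w) ^ (k - 1) * z ^ (k - l))"
          unfolding W_def z_def l_def
          by (intro sum_mono sum_consistent_trees_le_large) (use S \<S> w k in auto)
        also have "\<dots> = real t * ((1 / w) ^ (k - 1) * z ^ (k - l))"
          using tS[OF S(1)] by simp
        finally have "q ^ (l choose 2) * W \<le> q ^ (l choose 2) * (real t * ((1 / w) ^ (k - 1) * z ^ (k - l)))"
          using q by (intro mult_left_mono) auto
        then show ?thesis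
          using 3 by (simp add: g_def mult_ac)
      qed
    qed
    finally show ?thesis
      using \<mu> by (simp add: l_def mult_left_mono)
  qed
  define R where "R = 1 + (\<Sum>l\<in>{2..k div 2}. real (k choose l) * (real k / n) ^ l * ((1 + x) * q) ^ (l choose 2))
      + (\<Sum>j\<in>{j. 2 * j < k}. real (k choose j) * (n ^ j / fact j) * z ^ j * (1 - p) ^ ((k choose 2) - (k - j choose 2))) / E1"
  have row: "(\<Sum>S'\<in>\<S>. g (card (S \<inter> S'))) \<le> real (card \<S>) * (real t)\<^sup>2 * R" if S: "S \<in> \<S>" for S
  proof -
    define c where "c l = real (card {S' \<in> \<S>. card (S \<inter> S') = l})" for l
    have c_le: "c l \<le> real (k choose l) * real ((N - l choose (k - l)) * m ^ (k - l))" for l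
      unfolding c_def \<S>_def N_def of_nat_mult[symmetric] of_nat_le_iff
      using card_transversals_overlap_le[OF finX B S[unfolded \<S>_def], of l] .
    have "(\<Sum>S'\<in>\<S>. g (card (S \<inter> S'))) = (\<Sum>l\<in>{..k}. \<Sum>S'\<in>{S' \<in> \<S>. card (S \<inter> S') = l}. g (card (S \<inter> S')))"
    proof (rule sum.group[symmetric, OF fin\<S>])
      have "card (S \<inter> S') \<le> k" for S'
        using \<S>[OF S] by (metis card_mono inf_le1)
      then show "(\<lambda>S'. card (S \<inter> S')) ` \<S> \<subseteq> {..k}"
        by auto
    qed simp
    also have "\<dots> = (\<Sum>l\<in>{..k}. c l * g l)"
      by (intro sum.cong refl) (simp add: c_def)
    also have "{..k} = {..1} \<union> ({2..k div 2} \<union> {l. k < 2 * l \<and> l \<le> k})"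
      using k(1) by auto
    also have "(\<Sum>l\<in>{..1} \<union> ({2..k div 2} \<union> {l. k < 2 * l \<and> l \<le> k}). c l * g l) =
        (\<Sum>l\<in>{..1}. c l * g l) + ((\<Sum>l\<in>{2..k div 2}. c l * g l) + (\<Sum>l\<in>{l. k < 2 * l \<and> l \<le> k}. c l * g l))"
      using k(1) by (subst sum.union_disjoint, simp, simp, force, subst sum.union_disjoint) auto
    also have "(\<Sum>l\<in>{..1}. c l * g l) \<le> real (card \<S>) * (real t)\<^sup>2"
    proof -
      have "(\<Sum>l\<in>{..1::nat}. c l) = real (card ({S' \<in> \<S>. card (S \<inter> S') = 0} \<union> {S' \<in> \<S>. card (S \<inter> S') = 1}))"
        using fin\<S> by (subst card_Un_disjoint) (auto simp: c_def)
      also have "\<dots> \<le> real (card \<S>)"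
        using fin\<S> by (intro of_nat_mono card_mono) auto
      finally have "(\<Sum>l\<in>{..1::nat}. c l) * (real t)\<^sup>2 \<le> real (card \<S>) * (real t)\<^sup>2"
        by (rule mult_right_mono) simp
      moreover have "(\<Sum>l\<in>{..1::nat}. c l * g l) = (\<Sum>l\<in>{..1::nat}. c l) * (real t)\<^sup>2"
        by (simp add: g_def distrib_right)
      ultimately show ?thesis by simp
    qed
    also have "(\<Sum>l\<in>{2..k div 2}. c l * g l) \<le> real (card \<S>) * (real t)\<^sup>2 *
        (\<Sum>l\<in>{2..k div 2}. real (k choose l) * (real k / n) ^ l * ((1 + x) * q) ^ (l choose 2))"
      unfolding sum_distrib_left
    proof (rule sum_mono)
      fix l assume "l \<in> {2..k div 2}"
      then have l: "1 < l" "\<not> l \<le> 1" "2 * l \<le> k" "l \<le> k"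
        by auto
      have "c l \<le> real (k choose l) * ((real k / n) ^ l * real (card \<S>))"
      proof (rule order_trans[OF c_le], rule mult_left_mono)
        show "real ((N - l choose (k - l)) * m ^ (k - l)) \<le> (real k / n) ^ l * real (card \<S>)"
          using choose_transversals_quotient_le[of l k N m] l k m by (simp add: N_def n_def card\<S>)
      qed simp
      then have "c l * g l \<le> real (k choose l) * ((real k / n) ^ l * real (card \<S>)) * g l"
        using g_nonneg by (rule mult_right_mono)
      then show "c l * g l \<le> real (card \<S>) * (real t)\<^sup>2 * (real (k choose l) * (real k / n) ^ l * ((1 + x) * q) ^ (l choose 2))"
        using l by (simp add: g_def mult_ac)
    qed
    also have "(\<Sum>l\<in>{l. k < 2 * l \<and> l \<le> k}. c l * g l) \<le> real (card \<S>) * (real t)\<^sup>2 *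
        ((\<Sum>j\<in>{j. 2 * j < k}. real (k choose j) * (n ^ j / fact j) * z ^ j * (1 - p) ^ ((k choose 2) - (k - j choose 2))) / E1)"
    proof -
      have "(\<Sum>l\<in>{l. k < 2 * l \<and> l \<le> k}. c l * g l) = (\<Sum>j\<in>{j. 2 * j < k}. c (k - j) * g (k - j))"
        by (rule sum.reindex_bij_witness[of _ "\<lambda>j. k - j" "\<lambda>l. k - l"]) auto
      also have "\<dots> \<le> (\<Sum>j\<in>{j. 2 * j < k}. real (card \<S>) * (real t)\<^sup>2 *
          (real (k choose j) * (n ^ j / fact j) * z ^ j * (1 - p) ^ ((k choose 2) - (k - j choose 2)) / E1))"
      proof (rule sum_mono)
        fix j assume j: "j \<in> {j. 2 * j < k}"
        define l where "l = k - j"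
        have l: "1 < l" "\<not> 2 * l \<le> k" "k - l = j" "l \<le> k"
          using j k(1) by (auto simp: l_def)
        have "(N - l choose j) * fact j \<le> (N - l) ^ j"
          by (rule binomial_fact_pow)
        also have "\<dots> \<le> N ^ j"
          by (rule power_mono) auto
        finally have "real (N - l choose j) * fact j \<le> real N ^ j"
          by (metis of_nat_mono of_nat_mult of_nat_fact of_nat_power)
        then have "real (N - l choose j) * real m ^ j \<le> real N ^ j / fact j * real m ^ j"
          by (intro mult_right_mono) (auto simp: le_divide_eq)
        then have "real ((N - l choose (k - l)) * m ^ (k - l)) \<le> n ^ j / fact j"
          unfolding l(3) by (simp add: n_def N_def power_mult_distrib)
        then have "c l \<le> real (k choose l) * (n ^ j / fact j)"
          by (rule order_trans[OF c_le mult_left_mono]) simp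
        then have "c l \<le> real (k choose j) * (n ^ j / fact j)"
          using binomial_symmetric[OF l(4)] l(3) by simp
        then have "c l * g l \<le> real (k choose j) * (n ^ j / fact j) * g l"
          using g_nonneg by (rule mult_right_mono)
        \<comment> \<open>This introduces \<open>E1\<close>: the powers of \<open>w\<close> and of
          \<open>1 - p\<close> inside \<mu> match those of \<open>g l\<close>.\<close>
        moreover have "g l = real (card \<S>) * (real t)\<^sup>2 * (z ^ j * (1 - p) ^ ((k choose 2) - (l choose 2)) / E1)"
        proof -
          have "(l choose 2) \<le> (k choose 2)"
            unfolding choose_two using l(4) by (intro div_le_mono mult_le_mono) auto
          then have "(1 - p) ^ ((k choose 2) - (l choose 2)) = (1 - p) ^ (k choose 2) * q ^ (l choose 2)"
            using p by (simp add: q_def power_diff power_divide)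
          moreover have "g l = real t * ((1 / w) ^ (k - 1) * z ^ j) * q ^ (l choose 2)"
            using l by (simp add: g_def)
          ultimately show ?thesis
            unfolding E1 \<mu>_def using w p \<S>pos t(2) by (simp add: power_divide power2_eq_square)
        qed
        then have "real (k choose j) * (n ^ j / fact j) * g l = real (card \<S>) * (real t)\<^sup>2 *
            (real (k choose j) * (n ^ j / fact j) * z ^ j * (1 - p) ^ ((k choose 2) - (l choose 2)) / E1)"
          by (simp add: mult_ac)
        ultimately show "c (k - j) * g (k - j) \<le> real (card \<S>) * (real t)\<^sup>2 *
          (real (k choose j) * (n ^ j / fact j) * z ^ j * (1 - p) ^ ((k choose 2) - (k - j choose 2)) / E1)"
          by (simp only: l_def)
      qed
      finally show ?thesis
        by (simp add: sum_distrib_left sum_divide_distrib)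
    qed
    finally show ?thesis
      by (simp add: R_def algebra_simps)
  qed
  have "E2 \<le> E1\<^sup>2 * R"
  proof -
    have "E2 = (\<Sum>S\<in>\<S>. \<Sum>T\<in>bounded_trees \<Delta> S. \<Sum>S'\<in>\<S>. \<Sum>T'\<in>bounded_trees \<Delta> S'. ?P (induced_event S T \<inter> induced_event S' T'))"
    proof -
      have "(\<Sum>i\<in>Idx. h i) = (\<Sum>S\<in>\<S>. \<Sum>T\<in>bounded_trees \<Delta> S. h (S, T))" for h :: "_ \<Rightarrow> real"
        unfolding Idx_def using fin\<S> \<S>(2) by (subst sum.Sigma) auto
      then show ?thesis
        by (simp add: E2_def)
    qed
    also have "\<dots> = (\<Sum>S\<in>\<S>. \<Sum>S'\<in>\<S>. \<Sum>T\<in>bounded_trees \<Delta> S. \<Sum>T'\<in>bounded_trees \<Delta> S'. ?P (induced_event S T \<inter> induced_event S' T'))"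
      by (intro sum.cong refl sum.swap)
    also have "\<dots> \<le> (\<Sum>S\<in>\<S>. \<Sum>S'\<in>\<S>. \<mu>\<^sup>2 * g (card (S \<inter> S')))"
      by (intro sum_mono pair)
    also have "\<dots> = \<mu>\<^sup>2 * (\<Sum>S\<in>\<S>. \<Sum>S'\<in>\<S>. g (card (S \<inter> S')))"
      by (simp add: sum_distrib_left)
    also have "\<dots> \<le> \<mu>\<^sup>2 * (\<Sum>S\<in>\<S>. real (card \<S>) * (real t)\<^sup>2 * R)"
      by (intro mult_left_mono sum_mono row) auto
    also have "\<dots> = E1\<^sup>2 * R"
      by (simp add: E1 power2_eq_square)
    finally show ?thesis .
  qed
  moreover have "0 < E2"
    using E1pos \<open>E1 \<le> E2\<close> by linarith
  ultimately have "0 < R"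
    using E1pos by (metis less_le_trans zero_less_mult_pos zero_less_power)
  have "1 / R \<le> E1\<^sup>2 / E2"
    using \<open>E2 \<le> E1\<^sup>2 * R\<close> \<open>0 < E2\<close> \<open>0 < R\<close> by (simp add: divide_le_eq le_divide_eq mult.commute)
  also have "\<dots> \<le> ?P (\<Union>i\<in>Idx. ?A i)"
    using prob_UN_second_moment[OF finIdx, of "edge_pmf V p" ?A] sum1 E1pos by (simp add: E2_def)
  finally show ?thesis
    unfolding R_def Idx_def \<S>_def z_def q_def by simp
qed

section \<open>The upper tail\<close>

definition graph_of :: "'a set \<Rightarrow> ('a set \<Rightarrow> bool) \<Rightarrow> 'a ugraph" where
  "graph_of V f = (V, {e \<in> all_pairs V. f e})"

text \<open>Formulated with the pairs inside \<open>S\<close> only, so that all other pairs visibly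
  have no influence.\<close>

definition induces_forest :: "nat \<Rightarrow> ('a set \<Rightarrow> bool) \<Rightarrow> 'a set \<Rightarrow> bool" where
  "induces_forest \<Delta> f S \<longleftrightarrow> {e \<in> all_pairs S. f e} \<in> bounded_forests \<Delta> S"

lemma gnp_eq_map_edge_pmf: "gnp n p = map_pmf (graph_of {1..n}) (edge_pmf {1..n} p)"
  by (simp add: gnp_def edge_pmf_def graph_of_def[abs_def])

lemma induces_forest_iff:
  assumes "finite V" "S \<subseteq> V"
  shows "induces_forest \<Delta> f S \<longleftrightarrow> is_forest (induced_subgraph (graph_of V f) S) \<and>
    max_degree_le \<Delta> (induced_subgraph (graph_of V f) S)"
proof -
  define F where "F = {e \<in> all_pairs S. f e}"
  have "induced_subgraph (graph_of V f) S = (S, F)"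
    using assms(2) by (auto simp: induced_subgraph_def graph_of_def edges_def F_def all_pairs_def)
  moreover have "finite S"
    using assms finite_subset by blast
  then have "is_forest (S, F) \<longleftrightarrow> acyclic_edges F"
    by (rule is_forest_iff_acyclic_edges) (auto simp: F_def)
  moreover have "max_degree_le \<Delta> (S, F) \<longleftrightarrow> (\<forall>v\<in>S. degree_in F v \<le> \<Delta>)"
    by (simp add: max_degree_le_def verts_def vertex_degree_def edges_def degree_in_def)
  moreover have "induces_forest \<Delta> f S \<longleftrightarrow> acyclic_edges F \<and> (\<forall>v\<in>S. degree_in F v \<le> \<Delta>)"
    by (auto simp: induces_forest_def bounded_forests_def F_def)
  ultimately show ?thesis
    by simp
qed

lemma induces_forest_subset:
  assumes "finite S" "S' \<subseteq> S" "induces_forest \<Delta> f S"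
  shows "induces_forest \<Delta> f S'"
proof -
  have sub: "{e \<in> all_pairs S'. f e} \<subseteq> {e \<in> all_pairs S. f e}"
    using all_pairs_mono[OF assms(2)] by blast
  have fin: "finite {e \<in> all_pairs S. f e}"
    using assms(1) by simp
  have f: "acyclic_edges {e \<in> all_pairs S. f e}" "\<And>v. v \<in> S \<Longrightarrow> degree_in {e \<in> all_pairs S. f e} v \<le> \<Delta>"
    using assms(3) by (simp_all add: induces_forest_def bounded_forests_def)
  show ?thesis
    unfolding induces_forest_def bounded_forests_def
  proof (intro CollectI conjI ballI)
    show "acyclic_edges {e \<in> all_pairs S'. f e}"
      by (rule acyclic_edges_mono[OF f(1) sub])
    fix v assume "v \<in> S'"
    then show "degree_in {e \<in> all_pairs S'. f e} v \<le> \<Delta>"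
      using order_trans[OF degree_in_le_mono[OF fin sub] f(2)] assms(2) by blast
  qed blast
qed

text \<open>The property is inherited by subsets, so sets of size exactly \<open>k\<close> suffice;
  the empty set makes the maximum well defined.\<close>

lemma max_induced_forest_ge_iff:
  assumes "finite V"
  shows "k \<le> max_induced_forest \<Delta> (graph_of V f) \<longleftrightarrow> (\<exists>S\<subseteq>V. card S = k \<and> induces_forest \<Delta> f S)"
proof -
  define \<F> where "\<F> = {S. S \<subseteq> V \<and> induces_forest \<Delta> f S}"
  have "{S. S \<subseteq> verts (graph_of V f) \<and> is_forest (induced_subgraph (graph_of V f) S) \<and>
      max_degree_le \<Delta> (induced_subgraph (graph_of V f) S)} = \<F>"
    using induces_forest_iff[OF assms] by (auto simp: \<F>_def verts_def graph_of_def)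
  then have eq: "max_induced_forest \<Delta> (graph_of V f) = Max (card ` \<F>)"
    by (simp add: max_induced_forest_def)
  have fin: "finite \<F>"
    using assms by (simp add: \<F>_def)
  have "{} \<in> \<F>"
    using assms by (auto simp: \<F>_def induces_forest_def bounded_forests_def all_pairs_def cong: conj_cong)
  then have "k \<le> Max (card ` \<F>) \<longleftrightarrow> (\<exists>S\<in>\<F>. k \<le> card S)"
    using fin by (subst Max_ge_iff) auto
  also have "\<dots> \<longleftrightarrow> (\<exists>S\<subseteq>V. card S = k \<and> induces_forest \<Delta> f S)"
  proof
    assume "\<exists>S\<in>\<F>. k \<le> card S"
    then obtain S where S: "S \<subseteq> V" "induces_forest \<Delta> f S" "k \<le> card S"
      by (auto simp: \<F>_def)
    then obtain S' where "S' \<subseteq> S" "card S' = k"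
      using obtain_subset_with_card_n by metis
    then show "\<exists>S\<subseteq>V. card S = k \<and> induces_forest \<Delta> f S"
      using S induces_forest_subset[of S S' \<Delta> f] finite_subset[OF S(1) assms] by blast
  qed (auto simp: \<F>_def)
  finally show ?thesis
    by (simp add: eq)
qed

text \<open>A union bound over vertex sets and forests. The factorial from
  \<open>sum_forest_weights_le\<close> turns the binomial coefficient into a power of
  \<open>card V\<close>.\<close>

lemma prob_max_induced_forest_ge_le:
  fixes p :: real
  assumes V: "finite V" and D: "3 \<le> \<Delta>" and p: "0 < p" "p < 1" and k: "0 < k"
  defines "w \<equiv> p / (1 - p)"
  shows "measure_pmf.prob (edge_pmf V p) {f. k \<le> max_induced_forest \<Delta> (graph_of V f)} \<le>
    (real (card V) * a_const \<Delta> * w) ^ k * (1 - p) ^ (k choose 2) *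
    exp (((alpha_const \<Delta>)\<^sup>2 + exp 1 / a_const \<Delta>) / w)"
proof -
  define C where "C = exp (((alpha_const \<Delta>)\<^sup>2 + exp 1 / a_const \<Delta>) / w)"
  define \<S> where "\<S> = {S. S \<subseteq> V \<and> card S = k}"
  let ?P = "measure_pmf.prob (edge_pmf V p)"
  have fin: "finite \<S>"
    using V by (simp add: \<S>_def)
  have \<S>: "S \<subseteq> V" "finite S" "card S = k" if "S \<in> \<S>" for S
    using that V finite_subset by (auto simp: \<S>_def)
  have a: "0 < a_const \<Delta>"
    using a_const_gt_1[OF D] by simp
  have w: "0 < w"
    using p by (simp add: w_def)
  have "{f. k \<le> max_induced_forest \<Delta> (graph_of V f)} \<subseteq> (\<Union>S\<in>\<S>. \<Union>F\<in>bounded_forests \<Delta> S. induced_event S F)"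
  proof
    fix f assume "f \<in> {f. k \<le> max_induced_forest \<Delta> (graph_of V f)}"
    then obtain S where S: "S \<subseteq> V" "card S = k" "induces_forest \<Delta> f S"
      using max_induced_forest_ge_iff[OF V] by auto
    have "f \<in> induced_event S {e \<in> all_pairs S. f e}"
      by (auto simp: induced_event_def)
    then show "f \<in> (\<Union>S\<in>\<S>. \<Union>F\<in>bounded_forests \<Delta> S. induced_event S F)"
      using S by (auto simp: \<S>_def induces_forest_def)
  qed
  then have "?P {f. k \<le> max_induced_forest \<Delta> (graph_of V f)} \<le>
      ?P (\<Union>S\<in>\<S>. \<Union>F\<in>bounded_forests \<Delta> S. induced_event S F)"
    by (intro measure_pmf.finite_measure_mono) auto
  also have "\<dots> \<le> (\<Sum>S\<in>\<S>. ?P (\<Union>F\<in>bounded_forests \<Delta> S. induced_event S F))"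
    by (rule measure_pmf.finite_measure_subadditive_finite[OF fin]) auto
  also have "\<dots> \<le> (\<Sum>S\<in>\<S>. fact k * (a_const \<Delta> * w) ^ k * C * (1 - p) ^ (k choose 2))"
  proof (rule sum_mono)
    fix S assume S: "S \<in> \<S>"
    then have "S \<noteq> {}"
      using \<S>(3) k by force
    have "?P (\<Union>F\<in>bounded_forests \<Delta> S. induced_event S F) \<le> (\<Sum>F\<in>bounded_forests \<Delta> S. ?P (induced_event S F))"
      by (rule measure_pmf.finite_measure_subadditive_finite) (use \<S>[OF S] in auto)
    also have "\<dots> = (\<Sum>F\<in>bounded_forests \<Delta> S. w ^ card F * (1 - p) ^ (k choose 2))"
      using prob_induced_event[OF V \<S>(1)[OF S] _ p] \<S>(3)[OF S]
      by (intro sum.cong refl) (auto simp: bounded_forests_def w_def)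
    also have "\<dots> = (\<Sum>F\<in>bounded_forests \<Delta> S. w ^ card F) * (1 - p) ^ (k choose 2)"
      by (simp add: sum_distrib_right)
    also have "\<dots> \<le> fact k * (a_const \<Delta> * w) ^ k * C * (1 - p) ^ (k choose 2)"
      using sum_forest_weights_le[OF D \<S>(2)[OF S] \<open>S \<noteq> {}\<close> w] k \<S>(3)[OF S] p
      by (intro mult_right_mono) (auto simp: C_def)
    finally show "?P (\<Union>F\<in>bounded_forests \<Delta> S. induced_event S F) \<le>
      fact k * (a_const \<Delta> * w) ^ k * C * (1 - p) ^ (k choose 2)" .
  qed
  also have "\<dots> = (real (card V choose k) * fact k) * ((a_const \<Delta> * w) ^ k * C * (1 - p) ^ (k choose 2))"
    using n_subsets[OF V, of k] by (simp add: \<S>_def)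
  also have "\<dots> \<le> real (card V) ^ k * ((a_const \<Delta> * w) ^ k * C * (1 - p) ^ (k choose 2))"
  proof (rule mult_right_mono)
    show "real (card V choose k) * fact k \<le> real (card V) ^ k"
      using binomial_fact_pow[of "card V" k] by (metis of_nat_mono of_nat_mult of_nat_fact of_nat_power)
  qed (use a w p in \<open>auto simp: C_def\<close>)
  also have "\<dots> = (real (card V) * a_const \<Delta> * w) ^ k * (1 - p) ^ (k choose 2) * C"
    by (simp add: power_mult_distrib)
  finally show ?thesis
    by (simp add: C_def)
qed

text \<open>The origin of the \<open>+ 3\<close> in the theorem: \<open>k choose 2\<close> gives the
  exponent \<open>(k - 1) / 2\<close> for each vertex, and the denominator of
  \<open>p / (1 - p)\<close> lowers it to \<open>(k - 3) / 2\<close>.\<close>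

lemma ln_weight_power:
  fixes p c :: real
  assumes p: "0 < p" "p < 1" and c: "0 < c" and "0 < k"
  shows "(c * (p / (1 - p))) ^ k * (1 - p) ^ (k choose 2) =
    exp (real k * (ln (c * p) + (real k - 3) / 2 * ln (1 - p)))"
proof -
  define X where "X = (c * (p / (1 - p))) ^ k * (1 - p) ^ (k choose 2)"
  have ch: "real (k choose 2) = real k * (real k - 1) / 2"
    using assms(4) by (simp add: choose_two real_of_nat_div of_nat_diff)
  have "ln X = real k * (ln c + ln p - ln (1 - p)) + real (k choose 2) * ln (1 - p)"
    using p c by (simp add: X_def ln_mult ln_realpow ln_div)
  also have "\<dots> = real k * (ln (c * p) + (real k - 3) / 2 * ln (1 - p))"
    unfolding ch using p c by (simp add: ln_mult field_simps)
  finally have "ln X = real k * (ln (c * p) + (real k - 3) / 2 * ln (1 - p))" .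
  moreover have "0 < X"
    using p c by (simp add: X_def)
  ultimately show ?thesis
    by (metis X_def exp_ln)
qed

lemma mult_log_ge:
  fixes p c \<epsilon> :: real
  assumes "0 < p" "p \<le> 1 - \<epsilon>" "0 < \<epsilon>" "1 \<le> c"
  shows "\<epsilon> * ln c / p \<le> ln c / (- ln (1 - p))"
proof -
  have "- ln (1 - p) = ln (1 + p / (1 - p))"
    using assms by (simp add: field_simps flip: ln_inverse)
  also have "\<dots> \<le> p / (1 - p)"
    using assms by (intro ln_add_one_self_le_self) auto
  also have "\<dots> \<le> p / \<epsilon>"
    using assms by (intro divide_left_mono) auto
  finally have le: "- ln (1 - p) \<le> p / \<epsilon>" .
  have pos: "0 < - ln (1 - p)"
    using assms by simp
  have "\<epsilon> * ln c / p = ln c / (p / \<epsilon>)"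
    using assms by simp
  also have "\<dots> \<le> ln c / (- ln (1 - p))"
    using assms le pos by (intro divide_left_mono mult_pos_pos) auto
  finally show ?thesis .
qed

text \<open>\<open>ln d / d\<close> decreases beyond \<open>exp 1\<close>. This converts bounds of
  the form \<open>ln d / p\<close> into multiples of \<open>ln n\<close> that are uniform in
  \<open>p\<close>.\<close>

lemma div_mult_ln_ge:
  fixes d n :: real
  assumes "exp 1 \<le> d" "d \<le> n"
  shows "ln n \<le> n / d * ln d"
proof -
  have d: "0 < d" "0 < n"
    using assms exp_gt_zero[of "1::real"] by linarith+
  have "1 \<le> ln d"
    using assms d by (simp add: ln_ge_iff)
  have "ln (n / d) \<le> n / d - 1"
    using d by (intro ln_le_minus_one) auto
  also have "\<dots> \<le> (n / d - 1) * ln d"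
    using \<open>1 \<le> ln d\<close> d assms by (simp add: mult_le_cancel_left1)
  finally show ?thesis
    using d by (simp add: ln_div algebra_simps)
qed

text \<open>The factor \<open>1 + \<epsilon>\<close> in the target divides the first moment by
  \<open>(1 + \<epsilon>) ^ k\<close>. Half of this gain absorbs the factor
  \<open>exp (M / w)\<close>, where \<open>w\<close> is \<open>p / (1 - p)\<close>; the other half
  tends to 0 because \<open>k \<ge> 2 * \<epsilon> * ln n\<close>.\<close>

lemma upper_tail_bound:
  fixes \<epsilon> :: real
  assumes D: "3 \<le> \<Delta>" and \<epsilon>: "0 < \<epsilon>"
  obtains C where "0 < C" "\<And>n p. 0 < n \<Longrightarrow> C / real n \<le> p \<Longrightarrow> p \<le> 1 - \<epsilon> \<Longrightarrow>
    measure_pmf.prob (gnp n p)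
      {G. \<lceil>2 * log (1 / (1 - p)) (a_const \<Delta> * real n * p * (1 + \<epsilon>)) + 3\<rceil> < int (max_induced_forest \<Delta> G)}
    \<le> exp (- (\<epsilon> * ln (1 + \<epsilon>) * ln (real n)))"
proof -
  define a where "a = a_const \<Delta>"
  define M where "M = (alpha_const \<Delta>)\<^sup>2 + exp 1 / a"
  have a: "1 < a"
    using a_const_gt_1[OF D] by (simp add: a_def)
  have M: "0 < M"
    using a by (simp add: M_def add_nonneg_pos)
  \<comment> \<open>The entry 1 ensures \<open>exp 1 \<le> d\<close>, as
    \<open>div_mult_ln_ge\<close> requires. The other entry ensures
    \<open>M / p \<le> k * ln (1 + \<epsilon>) / 2\<close>.\<close>
  define C where "C = exp (max 1 (M / (\<epsilon> * ln (1 + \<epsilon>))))"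
  show ?thesis
  proof (rule that[of C])
    show "0 < C"
      by (simp add: C_def)
    fix n :: nat and p :: real
    assume n: "0 < n" and p: "C / real n \<le> p" "p \<le> 1 - \<epsilon>"
    define d where "d = real n * p"
    define L where "L = - ln (1 - p)"
    define x where "x = 2 * log (1 / (1 - p)) (a * real n * p * (1 + \<epsilon>)) + 3"
    have "0 < C / real n"
      using n by (simp add: C_def)
    then have p': "0 < p" "p < 1"
      using p \<epsilon> by auto
    have d: "C \<le> d"
      using p n by (simp add: d_def divide_le_eq mult.commute)
    have dn: "d \<le> real n"
      using p' n by (simp add: d_def)
    have lnC: "1 \<le> ln C" "M \<le> \<epsilon> * ln (1 + \<epsilon>) * ln C"
    proof -
      show "1 \<le> ln C"
        by (simp add: C_def)
      have "M / (\<epsilon> * ln (1 + \<epsilon>)) \<le> ln C"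
        by (simp add: C_def)
      then show "M \<le> \<epsilon> * ln (1 + \<epsilon>) * ln C"
        using \<epsilon> by (simp add: divide_le_eq mult.commute)
    qed
    have Cpos: "0 < C" "exp 1 \<le> C"
      by (auto simp: C_def)
    have ed: "exp 1 \<le> d"
      using Cpos d by linarith
    have dpos: "0 < d" "1 \<le> d"
      using ed exp_gt_zero[of 1] exp_ge_add_one_self[of 1] by linarith+
    have lnd: "ln C \<le> ln d"
      using d Cpos dpos by simp
    have L: "0 < L"
      using p' by (simp add: L_def)
    \<comment> \<open>The first size beyond the claimed range. As \<open>x + 1 \<le> k\<close>, the
      number \<open>(k - 3) / 2 * L\<close> is at least
      \<open>ln (a * d * (1 + \<epsilon>))\<close>.\<close>
    define k where "k = nat (\<lceil>x\<rceil> + 1)"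
    have "0 \<le> ln (a * d * (1 + \<epsilon>))" and ln_ge: "ln d \<le> ln (a * d * (1 + \<epsilon>))"
    proof -
      have "d * 1 \<le> d * (a * (1 + \<epsilon>))"
        using a \<epsilon> dpos mult_mono[of 1 a 1 "1 + \<epsilon>"] by (intro mult_left_mono) auto
      then have "d \<le> a * d * (1 + \<epsilon>)"
        by (simp add: mult_ac)
      with dpos show "ln d \<le> ln (a * d * (1 + \<epsilon>))"
        by (subst ln_le_cancel_iff) linarith+
      then show "0 \<le> ln (a * d * (1 + \<epsilon>))"
        using lnd lnC by linarith
    qed
    have x_eq: "x = 2 * (ln (a * d * (1 + \<epsilon>)) / L) + 3"
      by (simp add: x_def log_def L_def d_def mult_ac ln_div)
    have x3: "3 \<le> x"
      using x_eq \<open>0 \<le> ln (a * d * (1 + \<epsilon>))\<close> L by simp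
    have kx: "x + 1 \<le> real k"
      using x3 by (simp add: k_def)
    have k0: "0 < k"
      using x3 kx by simp
    have k_ge: "2 * (\<epsilon> * ln d / p) \<le> real k"
    proof -
      have "\<epsilon> * ln d / p \<le> ln d / L"
        unfolding L_def using p' p \<epsilon> dpos by (intro mult_log_ge) auto
      also have "\<dots> \<le> ln (a * d * (1 + \<epsilon>)) / L"
        using ln_ge L by (intro divide_right_mono) auto
      finally show ?thesis
        using x_eq kx by simp
    qed
    have "measure_pmf.prob (gnp n p) {G. \<lceil>x\<rceil> < int (max_induced_forest \<Delta> G)} =
        measure_pmf.prob (edge_pmf {1..n} p) {f. k \<le> max_induced_forest \<Delta> (graph_of {1..n} f)}"
      unfolding gnp_eq_map_edge_pmf measure_map_pmf
      using x3 by (intro arg_cong2[of _ _ _ _ measure] refl) (auto simp: k_def)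
    also have "\<dots> \<le> (real n * a * (p / (1 - p))) ^ k * (1 - p) ^ (k choose 2) * exp (M / (p / (1 - p)))"
      using prob_max_induced_forest_ge_le[OF _ D p' k0, of "{1..n}"] by (simp add: a_def M_def)
    also have "(real n * a * (p / (1 - p))) ^ k * (1 - p) ^ (k choose 2) =
        exp (real k * (ln (real n * a * p) + (real k - 3) / 2 * ln (1 - p)))"
      by (rule ln_weight_power[OF p' _ k0]) (use n a in simp)
    also have "\<dots> \<le> exp (- (real k * ln (1 + \<epsilon>)))"
    proof -
      have "2 * (ln (a * d * (1 + \<epsilon>)) / L) \<le> real k - 3"
        using kx x_eq by linarith
      then have "ln (a * d * (1 + \<epsilon>)) \<le> (real k - 3) / 2 * L"
        using L by (simp add: field_simps)
      moreover have "ln (a * d * (1 + \<epsilon>)) = ln (real n * a * p) + ln (1 + \<epsilon>)"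
        using a dpos \<epsilon> p' n by (simp add: d_def ln_mult mult_ac)
      ultimately have "ln (real n * a * p) + (real k - 3) / 2 * ln (1 - p) \<le> - ln (1 + \<epsilon>)"
        by (simp add: L_def)
      then have "real k * (ln (real n * a * p) + (real k - 3) / 2 * ln (1 - p)) \<le> real k * (- ln (1 + \<epsilon>))"
        by (rule mult_left_mono) simp
      then show ?thesis
        by simp
    qed
    also have "exp (- (real k * ln (1 + \<epsilon>))) * exp (M / (p / (1 - p))) \<le> exp (- (real k * ln (1 + \<epsilon>))) * exp (real k * ln (1 + \<epsilon>) / 2)"
    proof -
      have "M / (p / (1 - p)) \<le> M / p"
        using M p' by (simp add: field_simps)
      also have "\<dots> \<le> (\<epsilon> * ln (1 + \<epsilon>) * ln d) / p"
      proof -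
        have "\<epsilon> * ln (1 + \<epsilon>) * ln C \<le> \<epsilon> * ln (1 + \<epsilon>) * ln d"
          using \<epsilon> lnd by (intro mult_left_mono) auto
        then show ?thesis
          using lnC(2) p' by (intro divide_right_mono) auto
      qed
      also have "\<dots> = (2 * (\<epsilon> * ln d / p)) * (ln (1 + \<epsilon>) / 2)"
        by simp
      also have "\<dots> \<le> real k * (ln (1 + \<epsilon>) / 2)"
        using k_ge \<epsilon> by (intro mult_right_mono) auto
      finally show ?thesis
        by simp
    qed
    also have "\<dots> = exp (- (real k * ln (1 + \<epsilon>) / 2))"
      by (simp flip: exp_add)
    also have "\<dots> \<le> exp (- (\<epsilon> * ln (1 + \<epsilon>) * ln (real n)))"
    proof -
      have "ln (real n) \<le> real n / d * ln d"
        by (rule div_mult_ln_ge[OF ed dn])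
      also have "real n / d = 1 / p"
        using n p' by (simp add: d_def)
      finally have "\<epsilon> * ln (real n) \<le> \<epsilon> * (1 / p * ln d)"
        using \<epsilon> by (intro mult_left_mono) auto
      also have "\<epsilon> * (1 / p * ln d) = \<epsilon> * ln d / p"
        by simp
      also have "\<dots> \<le> real k / 2"
        using k_ge by linarith
      finally have "\<epsilon> * ln (real n) * ln (1 + \<epsilon>) \<le> real k / 2 * ln (1 + \<epsilon>)"
        using \<epsilon> by (intro mult_right_mono) auto
      then show ?thesis
        by (simp add: mult_ac)
    qed
    finally show "measure_pmf.prob (gnp n p)
      {G. \<lceil>2 * log (1 / (1 - p)) (a_const \<Delta> * real n * p * (1 + \<epsilon>)) + 3\<rceil> < int (max_induced_forest \<Delta> G)}
      \<le> exp (- (\<epsilon> * ln (1 + \<epsilon>) * ln (real n)))"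
      by (simp add: x_def a_def)
  qed
qed

section \<open>The lower tail\<close>

text \<open>Rounding down loses less than 1, so \<open>ln D\<close> lies between
  \<open>(k - 3) / 2 * L\<close> and \<open>(k - 2) / 2 * L\<close>. The first inequality serves the
  mean and the small overlaps, the second the large overlaps.\<close>

lemma forest_size_bounds:
  fixes p \<epsilon> D :: real
  assumes p: "0 < p" "p \<le> 1 - \<epsilon>" "0 < \<epsilon>" and D: "1 \<le> D"
  defines "L \<equiv> - ln (1 - p)"
  defines "k \<equiv> nat \<lfloor>2 * log (1 / (1 - p)) D + 3\<rfloor>"
  shows "3 \<le> k" "(real k - 3) / 2 * L \<le> ln D" "ln D \<le> (real k - 2) / 2 * L"
    "2 * ln D \<le> real k * (p / (1 - p))" "real k \<le> (2 * ln D + 3) / p" "2 * (\<epsilon> * ln D / p) \<le> real k"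
    "0 < L" "L \<le> p / \<epsilon>" "L \<le> - ln \<epsilon>"
proof -
  define x where "x = 2 * log (1 / (1 - p)) D + 3"
  have p1: "p < 1"
    using p by simp
  show L: "0 < L"
    using p p1 by (simp add: L_def)
  have x: "x = 2 * (ln D / L) + 3"
    by (simp add: x_def log_def L_def ln_div)
  have lnD: "0 \<le> ln D"
    using D by simp
  have x3: "3 \<le> x"
    using lnD L by (simp add: x)
  have k: "real k \<le> x" "x - 1 \<le> real k"
    using x3 by (simp_all add: k_def flip: x_def)
  show "3 \<le> k"
    using x3 unfolding k_def x_def[symmetric] by linarith
  have "real k - 3 \<le> 2 * (ln D / L)"
    using k(1) x by linarith
  then show "(real k - 3) / 2 * L \<le> ln D"
    using L by (simp add: field_simps)
  have "2 * (ln D / L) \<le> real k - 2"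
    using k(2) x by linarith
  then show 1: "ln D \<le> (real k - 2) / 2 * L"
    using L by (simp add: field_simps)
  have w: "0 < p / (1 - p)"
    using p p1 by simp
  have "L = ln (1 + p / (1 - p))"
    using p1 by (simp add: L_def field_simps flip: ln_inverse)
  also have "\<dots> \<le> p / (1 - p)"
    using w by (intro ln_add_one_self_le_self) auto
  finally have Lw: "L \<le> p / (1 - p)" .
  have "2 * ln D \<le> (real k - 2) * L"
    using 1 by simp
  also have "\<dots> \<le> real k * L"
    using L by simp
  also have "\<dots> \<le> real k * (p / (1 - p))"
    using Lw by (rule mult_left_mono) simp
  finally show "2 * ln D \<le> real k * (p / (1 - p))" .
  have pL: "p \<le> L"
    unfolding L_def using p1 ln_le_minus_one[of "1 - p"] by simp
  have "real k \<le> 2 * (ln D / L) + 3"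
    using k(1) x by simp
  also have "\<dots> \<le> 2 * (ln D / p) + 3 / p"
  proof (intro add_mono mult_left_mono)
    show "ln D / L \<le> ln D / p"
      using lnD pL p L by (intro divide_left_mono) auto
    show "3 \<le> 3 / p"
      using p p1 by (simp add: le_divide_eq)
  qed simp
  finally show "real k \<le> (2 * ln D + 3) / p"
    by (simp add: add_divide_distrib)
  have "2 * (\<epsilon> * ln D / p) \<le> 2 * (ln D / L)"
    using mult_log_ge[OF p D] by (simp add: L_def)
  then show "2 * (\<epsilon> * ln D / p) \<le> real k"
    using k(2) x by linarith
  have "p / (1 - p) \<le> p / \<epsilon>"
    using p by (intro divide_left_mono mult_pos_pos) auto
  then show "L \<le> p / \<epsilon>"
    using Lw by linarith
  have "ln \<epsilon> \<le> ln (1 - p)"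
    using p by (subst ln_le_cancel_iff) auto
  then show "L \<le> - ln \<epsilon>"
    by (simp add: L_def)
qed

lemma power_div_fact_le:
  fixes x :: real
  assumes "0 \<le> x"
  shows "x ^ l / fact l \<le> (exp 1 * x / real l) ^ l"
proof (cases "l = 0")
  case False
  have "(real l / exp 1) ^ l \<le> fact l"
    using fact_quotient_ge[of l l] by simp
  then have "x ^ l / fact l \<le> x ^ l / (real l / exp 1) ^ l"
    using assms False by (intro divide_left_mono) auto
  also have "\<dots> = (exp 1 * x / real l) ^ l"
    by (simp add: power_divide power_mult_distrib)
  finally show ?thesis .
qed simp

lemma binomial_le_exp_power: "real (k choose l) \<le> (exp 1 * real k / real l) ^ l"
proof -
  have "real (k choose l) * fact l \<le> real k ^ l"
    using binomial_fact_pow[of k l] by (metis of_nat_mono of_nat_mult of_nat_fact of_nat_power)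
  then have "real (k choose l) \<le> real k ^ l / fact l"
    by (simp add: le_divide_eq)
  also have "\<dots> \<le> (exp 1 * real k / real l) ^ l"
    by (rule power_div_fact_le) simp
  finally show ?thesis .
qed

lemma choose_two_real: "real (k choose 2) = real k * (real k - 1) / 2"
  by (cases "k = 0") (simp_all add: choose_two real_of_nat_div of_nat_diff)

text \<open>For each of the \<open>l\<close> vertices the exponent of \<open>1 / (1 - p)\<close> is
  \<open>(l - 1) / 2 \<le> (k - 2) / 4\<close>, half of what would produce \<open>D\<close>, hence
  \<open>sqrt D\<close>. The factor with \<open>L / 4\<close> comes from \<open>k - 2\<close> in
  place of \<open>k - 3\<close>, and \<open>x \<le> 1 / k\<close> costs at most
  \<open>exp (1 / 2)\<close>.\<close>

lemma small_overlap_le: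
  fixes p x D n :: real
  assumes p: "0 < p" "p < 1" and l: "1 \<le> l" "2 * l \<le> k" and x: "0 \<le> x" "x \<le> 1 / real k"
    and n: "0 < n" and D: "0 < D" "(real k - 3) / 2 * (- ln (1 - p)) \<le> ln D"
  shows "real (k choose l) * (real k / n) ^ l * ((1 + x) / (1 - p)) ^ (l choose 2) \<le>
    (exp (3 / 2) * (real k)\<^sup>2 / n * sqrt D * exp (- ln (1 - p) / 4) / real l) ^ l"
proof -
  define L where "L = - ln (1 - p)"
  have L: "0 < L"
    using p by (simp add: L_def)
  have "(1 + x) / (1 - p) = (1 + x) * exp L"
    using p by (simp add: L_def exp_minus divide_inverse)
  also have "\<dots> \<le> exp x * exp L"
    by (intro mult_right_mono exp_ge_add_one_self) auto
  also have "\<dots> \<le> exp (1 / real k + L)"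
    using x by (simp add: exp_add)
  finally have "((1 + x) / (1 - p)) ^ (l choose 2) \<le> exp (1 / real k + L) ^ (l choose 2)"
    using p x by (intro power_mono) auto
  also have "\<dots> = exp (real l * ((real l - 1) / 2 * (1 / real k + L)))"
    by (simp only: exp_of_nat_mult[symmetric] choose_two_real times_divide_eq_left times_divide_eq_right mult.assoc)
  also have "\<dots> \<le> exp (real l * (1 / 2 + (ln D / 2 + L / 4)))"
  proof -
    have "(real l - 1) / 2 * (1 / real k) \<le> 1 / 2"
      using l by (simp add: divide_le_eq)
    moreover have "(real l - 1) / 2 * L \<le> (real k - 2) / 4 * L"
      using l L by (intro mult_right_mono) auto
    moreover have "(real k - 2) / 4 * L = (real k - 3) / 2 * L / 2 + L / 4"
      by (simp add: field_simps)
    ultimately have "(real l - 1) / 2 * (1 / real k + L) \<le> 1 / 2 + (ln D / 2 + L / 4)"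
      using D(2) unfolding L_def[symmetric] distrib_left by linarith
    then show ?thesis
      unfolding exp_le_cancel_iff by (rule mult_left_mono) simp
  qed
  also have "\<dots> = (exp (1 / 2) * sqrt D * exp (L / 4)) ^ l"
  proof -
    have "(exp (ln D / 2))\<^sup>2 = D"
      using D(1) by (simp flip: exp_double)
    then have "sqrt D = exp (ln D / 2)"
      by (rule real_sqrt_unique) simp
    then have eq: "exp (1 / 2) * sqrt D * exp (L / 4) = exp (1 / 2 + (ln D / 2 + L / 4))"
      by (simp only: exp_add mult.assoc)
    show ?thesis
      unfolding eq by (rule exp_of_nat_mult)
  qed
  finally have 1: "((1 + x) / (1 - p)) ^ (l choose 2) \<le> (exp (1 / 2) * sqrt D * exp (L / 4)) ^ l" .
  have "real (k choose l) * (real k / n) ^ l * ((1 + x) / (1 - p)) ^ (l choose 2) \<le>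
      (exp 1 * real k / real l) ^ l * (real k / n) ^ l * (exp (1 / 2) * sqrt D * exp (L / 4)) ^ l"
    using 1 n x p D by (intro mult_mono binomial_le_exp_power order_refl) auto
  also have "\<dots> = ((exp 1 * exp (1 / 2)) * (real k)\<^sup>2 / n * sqrt D * exp (L / 4) / real l) ^ l"
    by (simp add: power2_eq_square flip: power_mult_distrib) (simp add: mult_ac)
  also have "exp 1 * exp (1 / 2) = exp (3 / 2 :: real)"
    by (simp flip: exp_add)
  finally show ?thesis
    by (simp add: L_def)
qed

text \<open>Exchanging \<open>j\<close> vertices changes \<open>j * (2 * k - j - 1) / 2\<close>
  pairs. As \<open>2 * j < k\<close>, this is at least \<open>3 / 2\<close> times
  \<open>j * (k - 2) / 2\<close>, hence \<open>D powr (- 3 / 2)\<close> for each exchanged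
  vertex.\<close>

lemma large_overlap_le:
  fixes p D n z :: real
  assumes p: "0 < p" "p < 1" and j: "1 \<le> j" "2 * j < k" and n: "0 < n" and z: "0 < z"
    and D: "0 < D" "ln D \<le> (real k - 2) / 2 * (- ln (1 - p))"
  shows "real (k choose j) * (n ^ j / fact j) * z ^ j * (1 - p) ^ ((k choose 2) - (k - j choose 2)) \<le>
    (exp 2 * real k * n * z * D powr (- 3 / 2) / (real j)\<^sup>2) ^ j"
proof -
  define L where "L = - ln (1 - p)"
  define M where "M = (k choose 2) - (k - j choose 2)"
  have L: "0 < L"
    using p by (simp add: L_def)
  have "(k - j choose 2) \<le> (k choose 2)"
    unfolding choose_two by (intro div_le_mono mult_le_mono) auto
  then have "real M = real (k choose 2) - real (k - j choose 2)"
    by (simp add: M_def of_nat_diff)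
  also have "\<dots> = real j * ((2 * real k - real j - 1) / 2)"
    using j by (simp add: choose_two_real of_nat_diff field_simps)
  finally have M: "real M = real j * ((2 * real k - real j - 1) / 2)" .
  have "3 / 2 * ln D \<le> (2 * real k - real j - 1) / 2 * L"
  proof -
    have "3 / 2 * ln D \<le> 3 / 2 * ((real k - 2) / 2 * L)"
      unfolding L_def by (rule mult_left_mono[OF D(2)]) simp
    also have "\<dots> = 3 / 2 * ((real k - 2) / 2) * L"
      by (simp only: mult.assoc)
    also have "\<dots> \<le> (2 * real k - real j - 1) / 2 * L"
      using j L by (intro mult_right_mono) auto
    finally show ?thesis .
  qed
  then have *: "real j * (3 / 2 * ln D) \<le> real M * L"
    unfolding M mult.assoc by (rule mult_left_mono) simp
  have "(1 - p) ^ M = exp (- L) ^ M"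
    using p by (simp add: L_def)
  also have "\<dots> = exp (- (real M * L))"
    by (simp flip: exp_of_nat_mult)
  also have "\<dots> \<le> exp (real j * (- 3 / 2 * ln D))"
    using * by simp
  also have "\<dots> = (D powr (- 3 / 2)) ^ j"
    unfolding exp_of_nat_mult powr_def using D(1) by simp
  finally have 1: "(1 - p) ^ M \<le> (D powr (- 3 / 2)) ^ j" .
  have "real (k choose j) * (n ^ j / fact j) * z ^ j * (1 - p) ^ M \<le>
      (exp 1 * real k / real j) ^ j * (exp 1 * n / real j) ^ j * z ^ j * (D powr (- 3 / 2)) ^ j"
    using 1 n z p by (intro mult_mono binomial_le_exp_power power_div_fact_le order_refl) auto
  also have "\<dots> = ((exp 1 * exp 1) * real k * n * z * D powr (- 3 / 2) / (real j)\<^sup>2) ^ j"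
    by (simp add: power2_eq_square flip: power_mult_distrib) (simp add: mult_ac)
  also have "exp 1 * exp 1 = exp (2 :: real)"
    by (simp flip: exp_add)
  finally show ?thesis
    by (simp add: M_def)
qed

lemma power_le_fact_quotient:
  assumes "u \<le> K" "K \<le> N"
  shows "(real N - real K) ^ u \<le> fact N / fact (N - u)"
  using assms(1)
proof (induction u)
  case (Suc u)
  have "N - u = Suc (N - Suc u)"
    using Suc.prems assms(2) by simp
  then have f: "fact (N - u) = real (N - u) * fact (N - Suc u)"
    by simp
  have "(real N - real K) ^ u * (real N - real K) \<le> fact N / fact (N - u) * (real N - real u)"
    using Suc assms(2) by (intro mult_mono) auto
  then have "(real N - real K) ^ Suc u \<le> fact N / fact (N - u) * (real N - real u)"
    by (simp only: power_Suc2)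
  also have "\<dots> = fact N / fact (N - Suc u)"
    using Suc.prems assms(2) unfolding f by (simp add: of_nat_diff)
  finally show ?case .
qed simp

text \<open>The factor \<open>1 - \<eta>\<close> in the target leaves room for two losses of
  \<open>1 - \<eta> / 4\<close>, one in the number of trees and one in the number of transversals,
  and still for a gain of \<open>1 + \<eta> / 2\<close> per vertex. Having \<open>k - 1\<close>
  edges, a tree gives an additional factor \<open>1 / w \<ge> \<epsilon>\<close>.\<close>

lemma expected_trees_ge:
  fixes p \<epsilon> \<eta> a :: real
  assumes p: "0 < p" "p \<le> 1 - \<epsilon>" "0 < \<epsilon>" and \<eta>: "0 < \<eta>" "\<eta> < 1" and a: "0 < a" and k: "0 < k" "k \<le> N"
    and t: "fact k * (a * (1 - \<eta> / 4)) ^ k \<le> t" and n: "0 < n" "(1 - \<eta> / 4) * n \<le> (real N - real k) * real m"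
    and D: "(real k - 3) / 2 * (- ln (1 - p)) \<le> ln (a * n * p * (1 - \<eta>))"
  shows "\<epsilon> * (1 + \<eta> / 2) ^ k \<le>
    real (N choose k) * real m ^ k * t * ((p / (1 - p)) ^ (k - 1) * (1 - p) ^ (k choose 2))"
proof -
  define \<delta> where "\<delta> = \<eta> / 4"
  define w where "w = p / (1 - p)"
  define K where "K = (k choose 2)"
  have \<delta>: "0 < \<delta>" "\<delta> < 1"
    using \<eta> by (auto simp: \<delta>_def)
  have p1: "p < 1"
    using p by simp
  have w: "0 < w" "\<epsilon> \<le> 1 / w"
  proof -
    show "0 < w"
      using p p1 by (simp add: w_def)
    have "p * \<epsilon> \<le> 1 - p"
      using p p1 mult_right_mono[of p 1 \<epsilon>] by linarith
    then show "\<epsilon> \<le> 1 / w"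
      using p p1 by (simp add: w_def le_divide_eq mult.commute)
  qed
  have "real (N choose k) * fact k = fact N / fact (N - k)"
    using binomial_fact[OF k(2), where 'a = real] by simp
  then have Nk: "(real N - real k) ^ k \<le> real (N choose k) * fact k"
    using power_le_fact_quotient[of k k N] k(2) by simp
  have "(1 + \<eta> / 2) * (1 - \<eta>) \<le> (1 - \<delta>)\<^sup>2"
    using \<eta> by (simp add: \<delta>_def power2_eq_square algebra_simps)
  then have "ln (1 + \<eta> / 2) + ln (1 - \<eta>) \<le> ln ((1 - \<delta>)\<^sup>2)"
    using \<eta> \<delta> by (subst ln_mult_pos[symmetric]) auto
  then have "ln (1 + \<eta> / 2) \<le> ln ((1 - \<delta>)\<^sup>2) - ln (1 - \<eta>)"
    by simp
  also have "\<dots> = ln (n * a * (1 - \<delta>)\<^sup>2 * p) - ln (a * n * p * (1 - \<eta>))"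
    using \<eta> \<delta> a n p by (simp add: ln_mult_pos)
  also have "\<dots> \<le> ln (n * a * (1 - \<delta>)\<^sup>2 * p) + (real k - 3) / 2 * ln (1 - p)"
    using D by simp
  finally have "real k * ln (1 + \<eta> / 2) \<le> real k * (ln (n * a * (1 - \<delta>)\<^sup>2 * p) + (real k - 3) / 2 * ln (1 - p))"
    by (rule mult_left_mono) simp
  then have "exp (real k * ln (1 + \<eta> / 2)) \<le> (n * a * (1 - \<delta>)\<^sup>2 * w) ^ k * (1 - p) ^ K"
    unfolding w_def K_def using p p1 n a \<delta> k by (subst ln_weight_power) auto
  moreover have "exp (real k * ln (1 + \<eta> / 2)) = (1 + \<eta> / 2) ^ k"
    using \<eta> by (simp add: exp_of_nat_mult)
  ultimately have "\<epsilon> * (1 + \<eta> / 2) ^ k \<le> 1 / w * ((n * a * (1 - \<delta>)\<^sup>2 * w) ^ k * (1 - p) ^ K)"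
    using w p \<eta> by (intro mult_mono) auto
  also have "\<dots> = ((1 - \<delta>) * n) ^ k * (a * (1 - \<delta>)) ^ k * (w ^ (k - 1) * (1 - p) ^ K)"
  proof -
    have "w ^ k = w * w ^ (k - 1)"
      using k(1) by (simp flip: power_Suc)
    then show ?thesis
      using w by (simp add: power_mult_distrib power2_eq_square)
  qed
  also have "\<dots> \<le> ((real N - real k) * real m) ^ k * (a * (1 - \<delta>)) ^ k * (w ^ (k - 1) * (1 - p) ^ K)"
    using n \<delta> a w p1 by (intro mult_right_mono power_mono) (auto simp: \<delta>_def)
  also have "\<dots> = (real N - real k) ^ k * real m ^ k * (a * (1 - \<delta>)) ^ k * (w ^ (k - 1) * (1 - p) ^ K)"
    by (simp add: power_mult_distrib)
  also have "\<dots> \<le> (real (N choose k) * fact k) * real m ^ k * (a * (1 - \<delta>)) ^ k * (w ^ (k - 1) * (1 - p) ^ K)"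
    using Nk \<delta> a w p1 by (intro mult_right_mono) auto
  also have "\<dots> = real (N choose k) * real m ^ k * (fact k * (a * (1 - \<delta>)) ^ k) * (w ^ (k - 1) * (1 - p) ^ K)"
    by simp
  also have "\<dots> \<le> real (N choose k) * real m ^ k * t * (w ^ (k - 1) * (1 - p) ^ K)"
    using t w p1 by (intro mult_right_mono mult_left_mono) (auto simp: \<delta>_def)
  finally show ?thesis
    by (simp add: w_def K_def)
qed

section \<open>Choice of the blocks and the success probability for transversal trees\<close>

lemma card_residue_class:
  assumes "j < N"
  shows "card {v \<in> {1..N * m}. (v - 1) mod N = j} = m"
proof -
  have "bij_betw (\<lambda>i. i * N + j + 1) {..<m} {v \<in> {1..N * m}. (v - 1) mod N = j}"
  proof (rule bij_betwI[where g = "\<lambda>v. (v - 1) div N"])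
    show "(\<lambda>i. i * N + j + 1) \<in> {..<m} \<rightarrow> {v \<in> {1..N * m}. (v - 1) mod N = j}"
    proof
      fix i assume "i \<in> {..<m}"
      then have "Suc i * N \<le> m * N"
        by (intro mult_le_mono1) simp
      then show "i * N + j + 1 \<in> {v \<in> {1..N * m}. (v - 1) mod N = j}"
        using assms by (simp add: mult.commute)
    qed
    show "(\<lambda>v. (v - 1) div N) \<in> {v \<in> {1..N * m}. (v - 1) mod N = j} \<rightarrow> {..<m}"
    proof
      fix v assume "v \<in> {v \<in> {1..N * m}. (v - 1) mod N = j}"
      then have "v - 1 < N * m"
        by auto
      then show "(v - 1) div N \<in> {..<m}"
        by (simp add: less_mult_imp_div_less mult.commute)
    qed
  qed (use assms in auto)
  then show ?thesis
    using bij_betw_same_card by fastforce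
qed

lemma induced_event_imp_induces_forest:
  assumes "T \<in> bounded_trees \<Delta> S" "f \<in> induced_event S T"
  shows "induces_forest \<Delta> f S"
proof -
  have "{e \<in> all_pairs S. f e} = T"
    using assms unfolding bounded_trees_def induced_event_def by blast
  then show ?thesis
    using assms(1) by (simp add: induces_forest_def bounded_forests_def bounded_trees_def)
qed

text \<open>All requirements that involve only \<open>d\<close> are collected to obtain a single
  threshold. In the first three, \<open>d powr (1 / 10)\<close> dominates the logarithms from the
  small overlaps, from the large overlaps and from the share of blocks met by a tree;
  \<open>K3\<close> controls the quantity \<open>x\<close> of the second moment.\<close>

lemma eventually_growth_conditions:
  fixes \<epsilon> \<eta> a :: real
  assumes "0 < \<epsilon>" "0 < \<eta>" "\<eta> < 1" "1 < a"
  shows "\<forall>\<^sub>F d in at_top. K1 * (2 * ln (a * d) + 3)\<^sup>2 \<le> d powr (1 / 10) \<and>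
    K2 * (2 * ln (a * d) + 3) * (1 + (2 * ln (a * d) + 3) / \<epsilon>) ^ \<Delta> \<le> d powr (1 / 10) \<and>
    2 * ln (a * d) + 3 + 1 \<le> \<eta> / 4 * d powr (1 / 10) \<and>
    K3 \<le> 2 * ln (a * d * (1 - \<eta>)) \<and> 1 \<le> a * d * (1 - \<eta>) \<and>
    ln d / 2 \<le> ln (a * d * (1 - \<eta>)) \<and> exp 1 \<le> d"
proof -
  have "\<forall>\<^sub>F d in at_top. K1 * (2 * ln (a * d) + 3)\<^sup>2 \<le> d powr (1 / 10)"
    using assms by real_asymp
  moreover have "\<forall>\<^sub>F d in at_top. K2 * (2 * ln (a * d) + 3) * (1 + (2 * ln (a * d) + 3) / \<epsilon>) ^ \<Delta> \<le> d powr (1 / 10)"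
  proof -
    \<comment> \<open>Each of the \<Delta> factors is at most \<open>d powr s\<close>, so together
      they use at most \<open>d powr (1 / 20)\<close>, half of the available slack.\<close>
    define s where "s = 1 / (20 * (real \<Delta> + 1))"
    have s: "0 < s" "s * real \<Delta> \<le> 1 / 20"
      by (simp_all add: s_def field_simps)
    have "\<forall>\<^sub>F d in at_top. 1 + (2 * ln (a * d) + 3) / \<epsilon> \<le> d powr s"
      using assms s by real_asymp
    moreover have "\<forall>\<^sub>F d in at_top. K2 * (2 * ln (a * d) + 3) \<le> d powr (1 / 20)"
      using assms by real_asymp
    moreover have "\<forall>\<^sub>F d in at_top. 0 \<le> 2 * ln (a * d) + 3"
      using assms by real_asymp
    moreover have "\<forall>\<^sub>F d in at_top. (1 :: real) \<le> d"
      by real_asymp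
    ultimately show ?thesis
    proof eventually_elim
      case (elim d)
      have "K2 * (2 * ln (a * d) + 3) * (1 + (2 * ln (a * d) + 3) / \<epsilon>) ^ \<Delta> \<le> d powr (1 / 20) * (d powr s) ^ \<Delta>"
        using elim assms by (intro mult_mono power_mono) auto
      also have "(d powr s) ^ \<Delta> = d powr (s * real \<Delta>)"
        using elim by (simp add: powr_powr flip: powr_realpow)
      also have "\<dots> \<le> d powr (1 / 20)"
        using elim s by (intro powr_mono) auto
      also have "d powr (1 / 20) * d powr (1 / 20) = d powr (1 / 10)"
        by (simp flip: powr_add)
      finally show ?case
        by (simp add: mult_left_mono)
    qed
  qed
  moreover have "\<forall>\<^sub>F d in at_top. 2 * ln (a * d) + 3 + 1 \<le> \<eta> / 4 * d powr (1 / 10)"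
    using assms by real_asymp
  moreover have "\<forall>\<^sub>F d in at_top. K3 \<le> 2 * ln (a * d * (1 - \<eta>))"
    using assms by real_asymp
  moreover have "\<forall>\<^sub>F d in at_top. 1 \<le> a * d * (1 - \<eta>)"
    using assms by real_asymp
  moreover have "\<forall>\<^sub>F d in at_top. ln d / 2 \<le> ln (a * d * (1 - \<eta>))"
    using assms by real_asymp
  moreover have "\<forall>\<^sub>F d in at_top. exp 1 \<le> (d :: real)"
    by real_asymp
  ultimately show ?thesis
    by eventually_elim blast
qed

text \<open>Residue classes have equal size on \<open>{1..N * m}\<close>. The fewer than
  \<open>m\<close> vertices beyond that range also receive a block, so every pair of vertices can be
  assigned to one.\<close>

definition block_of :: "nat \<Rightarrow> nat \<Rightarrow> nat" where
  "block_of N v = (v - 1) mod N"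

text \<open>Up to logarithms \<open>k\<close> is \<open>n / d\<close>. The base of the small
  overlaps is thus \<open>k\<^sup>2 / n * sqrt d\<close>, about \<open>n * d powr (- 3 / 2)\<close>,
  and that of the large ones is \<open>k * n * d powr (- 3 / 2)\<close>, about
  \<open>n\<^sup>2 * d powr (- 5 / 2)\<close>. \<open>D0\<close> becomes part of the constant
  \<open>C\<close>, whereas \<open>k0 \<le> k\<close> is met for large \<open>n\<close> through
  \<open>\<epsilon> * ln n \<le> k\<close>.\<close>

lemma transversal_forest_prob_ge:
  fixes \<epsilon> \<eta> :: real
  assumes \<Delta>: "3 \<le> \<Delta>" and \<epsilon>: "0 < \<epsilon>" and \<eta>: "0 < \<eta>" "\<eta> < 1"
  obtains D0 k0 where "1 < D0"
    "\<And>n p m k N d. d = real n * p \<Longrightarrow> D0 \<le> d \<Longrightarrow> 0 < p \<Longrightarrow> p \<le> 1 - \<epsilon> \<Longrightarrow> 1 \<le> m \<Longrightarrow>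
      real m \<le> d powr (9 / 10) \<Longrightarrow>
      k = nat \<lfloor>2 * log (1 / (1 - p)) (a_const \<Delta> * real n * p * (1 - \<eta>)) + 3\<rfloor> \<Longrightarrow> N = n div m \<Longrightarrow> k0 \<le> k \<Longrightarrow>
      1 / (1 + (\<Sum>l\<in>{2..k div 2}. (real n * d powr (- 7 / 5) / real l) ^ l)
        + (\<Sum>j\<in>{j. 2 * j < k}. ((real n)\<^sup>2 * d powr (- 12 / 5) / (real j)\<^sup>2) ^ j) / (\<epsilon> * (1 + \<eta> / 2) ^ k))
      \<le> measure_pmf.prob (edge_pmf {1..n} p)
          {f. \<exists>S\<in>transversals (block_of N) {1..N * m} k. induces_forest \<Delta> f S}"
    "\<And>n p k d. d = real n * p \<Longrightarrow> D0 \<le> d \<Longrightarrow> 0 < p \<Longrightarrow> p \<le> 1 - \<epsilon> \<Longrightarrow>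
      k = nat \<lfloor>2 * log (1 / (1 - p)) (a_const \<Delta> * real n * p * (1 - \<eta>)) + 3\<rfloor> \<Longrightarrow>
      3 \<le> k \<and> real k \<le> real n * d powr (- 9 / 10) \<and> \<epsilon> * ln (real n) \<le> real k"
proof -
  define a where "a = a_const \<Delta>"
  have a: "1 < a"
    using a_const_gt_1[OF \<Delta>] by (simp add: a_def)
  \<comment> \<open>\<open>E\<epsilon>\<close> bounds the rounding loss \<open>exp (L / 4)\<close>
    of the small overlaps, since \<open>L \<le> - ln \<epsilon>\<close>.\<close>
  define E\<epsilon> where "E\<epsilon> = exp (- ln \<epsilon> / 4)"
  define K1 where "K1 = 2 * exp (3 / 2) * sqrt a * E\<epsilon>"
  define K2 where "K2 = exp 3 * (a * (1 - \<eta>)) powr (- 3 / 2)"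
  define K3 where "K3 = (real \<Delta> * exp 1 ^ 2)\<^sup>2"
  define \<Lambda> where "\<Lambda> d = 2 * ln (a * d) + 3" for d
  from eventually_growth_conditions[OF \<epsilon> \<eta> a, of K1 K2 \<Delta> K3]
  obtain D0 where D0: "\<And>d. D0 \<le> d \<Longrightarrow> K1 * (\<Lambda> d)\<^sup>2 \<le> d powr (1 / 10)"
    "\<And>d. D0 \<le> d \<Longrightarrow> K2 * \<Lambda> d * (1 + \<Lambda> d / \<epsilon>) ^ \<Delta> \<le> d powr (1 / 10)"
    "\<And>d. D0 \<le> d \<Longrightarrow> \<Lambda> d + 1 \<le> \<eta> / 4 * d powr (1 / 10)"
    "\<And>d. D0 \<le> d \<Longrightarrow> K3 \<le> 2 * ln (a * d * (1 - \<eta>))"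
    "\<And>d. D0 \<le> d \<Longrightarrow> 1 \<le> a * d * (1 - \<eta>)"
    "\<And>d. D0 \<le> d \<Longrightarrow> ln d / 2 \<le> ln (a * d * (1 - \<eta>))"
    "\<And>d. D0 \<le> d \<Longrightarrow> exp 1 \<le> d"
    unfolding eventually_at_top_linorder \<Lambda>_def by blast
  have "0 < \<eta> / 4" "\<eta> / 4 < 1"
    using \<eta> by auto
  then obtain k0 where k0: "\<And>V :: nat set. finite V \<Longrightarrow> k0 \<le> card V \<Longrightarrow>
    fact (card V) * (a * (1 - \<eta> / 4)) ^ card V \<le> real (card (bounded_trees \<Delta> V))"
    unfolding a_def by (rule card_bounded_trees_ge[OF \<Delta>, where 'a = nat]) blast
  have one_less_e: "1 < exp (1::real)"
    by simp
  show ?thesis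
  proof (rule that[of "max D0 2" k0])
    show "1 < max D0 2"
      by simp
    fix n :: nat and p d :: real and k :: nat
    assume d_def: "d = real n * p" and dD0': "max D0 2 \<le> d" and p: "0 < p" "p \<le> 1 - \<epsilon>"
      and k_def: "k = nat \<lfloor>2 * log (1 / (1 - p)) (a_const \<Delta> * real n * p * (1 - \<eta>)) + 3\<rfloor>"
    have dD0: "D0 \<le> d" and d1: "1 \<le> d"
      using dD0' by auto
    define D where "D = a * d * (1 - \<eta>)"
    define L where "L = - ln (1 - p)"
    define w where "w = p / (1 - p)"
    have p1: "p < 1"
      using p \<epsilon> by simp
    have npos: "0 < n"
      using d1 d_def by (cases n) auto
    have dn: "d \<le> real n"
      unfolding d_def using p1 p by (simp add: mult_left_le)
    have D1: "1 \<le> D"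
      using D0(5)[OF dD0] by (simp add: D_def)
    have Dle: "D \<le> a * d"
      unfolding D_def using a d1 \<eta> by (simp add: mult_left_le)
    have D_eq: "a_const \<Delta> * real n * p * (1 - \<eta>) = D"
      by (simp add: D_def d_def a_def mult_ac)
    note kb = forest_size_bounds[OF p \<epsilon> D1, folded D_eq, folded k_def, unfolded D_eq, folded L_def w_def]
    have lnD: "ln D \<le> ln (a * d)"
      using Dle D1 by (subst ln_le_cancel_iff) auto
    have k_le: "real k \<le> \<Lambda> d * real n / d"
    proof -
      have "real k \<le> (2 * ln D + 3) / p"
        by (rule kb(5))
      also have "\<dots> \<le> \<Lambda> d / p"
        using lnD p by (intro divide_right_mono) (auto simp: \<Lambda>_def)
      also have "\<dots> = \<Lambda> d * real n / d"
        using p npos by (simp add: d_def)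
      finally show ?thesis .
    qed
    have powr_split: "d powr (1 / 10) / d = d powr (- 9 / 10)"
      using powr_diff[of d "1 / 10" 1] d1 by simp
    have k_le': "real k \<le> real n * d powr (- 9 / 10)"
    proof -
      have "\<Lambda> d \<le> \<eta> / 4 * d powr (1 / 10)"
        using D0(3)[OF dD0] by simp
      also have "\<dots> \<le> 1 * d powr (1 / 10)"
        using \<eta> by (intro mult_right_mono) auto
      finally have "\<Lambda> d * real n / d \<le> d powr (1 / 10) * real n / d"
        using d1 by (simp add: divide_right_mono mult_right_mono)
      also have "\<dots> = real n * (d powr (1 / 10) / d)"
        by simp
      also have "\<dots> = real n * d powr (- 9 / 10)"
        by (simp only: powr_split)
      finally show ?thesis
        using k_le by simp
    qed
    have k_ge: "\<epsilon> * ln (real n) \<le> real k"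
    proof -
      have "ln (real n) \<le> real n / d * ln d"
        by (rule div_mult_ln_ge[OF D0(7)[OF dD0] dn])
      also have "\<dots> = 1 / p * ln d"
        using npos by (simp add: d_def)
      also have "\<dots> \<le> 1 / p * (2 * ln D)"
        using D0(6)[OF dD0] p by (intro mult_left_mono) (auto simp: D_def)
      finally have "\<epsilon> * ln (real n) \<le> \<epsilon> * (1 / p * (2 * ln D))"
        using \<epsilon> by (intro mult_left_mono) auto
      also have "\<dots> = 2 * (\<epsilon> * ln D / p)"
        by simp
      also have "\<dots> \<le> real k"
        by (rule kb(6))
      finally show ?thesis .
    qed
    show "3 \<le> k \<and> real k \<le> real n * d powr (- 9 / 10) \<and> \<epsilon> * ln (real n) \<le> real k"
      using kb(1) k_le' k_ge by blast
    fix m N :: nat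
    assume m: "1 \<le> m" "real m \<le> d powr (9 / 10)" and N_def: "N = n div m" and kk0: "k0 \<le> k"
    define n' where "n' = real N * real m"
    have k3: "3 \<le> k"
      by (rule kb(1))
    have "n = N * m + n mod m"
      by (simp add: N_def)
    moreover have "n mod m < m"
      using m(1) by simp
    ultimately have Nm: "N * m \<le> n" "n \<le> N * m + m"
      by linarith+
    have n'_le: "n' \<le> real n" and n'_ge: "real n - real m \<le> n'"
      using of_nat_mono[OF Nm(1), where 'a = real] of_nat_mono[OF Nm(2), where 'a = real]
      by (simp_all add: n'_def)
    have split: "d powr (9 / 10) = d * d powr (- 1 / 10)"
      using powr_add[of d 1 "- 1 / 10"] d1 by simp
    have inv: "d powr (1 / 10) * d powr (- 1 / 10) = 1"
      using d1 by (simp flip: powr_add)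
    \<comment> \<open>The blocks met by a tree contain \<open>k * m\<close> vertices and fewer than
      \<open>m\<close> vertices lie outside \<open>{1..N * m}\<close>. Because
      \<open>m \<le> d powr (9 / 10)\<close>, both together stay below
      \<open>\<eta> / 4 * n\<close>.\<close>
    have Nk: "(1 - \<eta> / 4) * real n \<le> (real N - real k) * real m"
    proof -
      have "real k * real m \<le> (\<Lambda> d * real n / d) * d powr (9 / 10)"
        using k_le m by (intro mult_mono) auto
      also have "\<dots> = \<Lambda> d * real n * d powr (- 1 / 10)"
        using d1 by (simp add: split)
      finally have 1: "real k * real m \<le> \<Lambda> d * real n * d powr (- 1 / 10)" .
      have "real m \<le> d * d powr (- 1 / 10)"
        using m(2) split by simp
      also have "\<dots> \<le> real n * d powr (- 1 / 10)"
        using dn by (intro mult_right_mono) auto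
      finally have "real k * real m + real m \<le> (\<Lambda> d + 1) * (real n * d powr (- 1 / 10))"
        using 1 by (simp add: algebra_simps)
      also have "\<dots> \<le> (\<eta> / 4 * d powr (1 / 10)) * (real n * d powr (- 1 / 10))"
        using D0(3)[OF dD0] by (intro mult_right_mono) auto
      also have "\<dots> = \<eta> / 4 * real n * (d powr (1 / 10) * d powr (- 1 / 10))"
        by simp
      also have "\<dots> = \<eta> / 4 * real n"
        unfolding inv by simp
      finally show ?thesis
        using n'_ge by (simp add: n'_def algebra_simps)
    qed
    have "0 < (1 - \<eta> / 4) * real n"
      using \<eta> npos by simp
    then have "0 < (real N - real k) * real m"
      using Nk by linarith
    then have kN: "k \<le> N"
      using m(1) by (simp add: zero_less_mult_iff)
    have Npos: "0 < N"
      using kN k3 by simp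
    have n'_half: "real n / 2 \<le> n'"
    proof -
      have "1 / 2 * real n \<le> (1 - \<eta> / 4) * real n"
        using \<eta> by (intro mult_right_mono) auto
      then have "real n / 2 \<le> (1 - \<eta> / 4) * real n"
        by simp
      also have "\<dots> \<le> (real N - real k) * real m"
        by (rule Nk)
      also have "\<dots> \<le> n'"
        by (simp add: n'_def algebra_simps)
      finally show ?thesis .
    qed
    have n'pos: "0 < n'"
      using n'_half npos by simp
    define t where "t = card (bounded_trees \<Delta> {..<k})"
    have t: "card (bounded_trees \<Delta> S) = t" if "finite S" "card S = k" for S :: "nat set"
      unfolding t_def using that by (intro card_bounded_trees_cong) auto
    have t_ge: "fact k * (a * (1 - \<eta> / 4)) ^ k \<le> real t"
      using k0[of "{..<k}"] kk0 by (simp add: t_def)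
    have "0 < fact k * (a * (1 - \<eta> / 4)) ^ k"
      using a \<eta> by simp
    then have tpos: "0 < t"
      using t_ge by (metis less_le_trans of_nat_0_less_iff)
    define x where "x = (real \<Delta> * exp 1 ^ 2 / real k)\<^sup>2 / w"
    have w: "0 < w"
      using p p1 by (simp add: w_def)
    have x: "0 \<le> x" "x \<le> 1 / real k"
    proof -
      show "0 \<le> x"
        using w by (simp add: x_def)
      \<comment> \<open>\<open>x\<close> equals \<open>K3 / (k\<^sup>2 * w)\<close>, and
        \<open>k * w \<ge> 2 * ln D\<close> is large with \<open>d\<close>.\<close>
      have "K3 \<le> real k * w"
        using kb(4) D0(4)[OF dD0] by (simp add: D_def)
      then have "K3 / (real k * w) \<le> 1"
        using w k3 by (simp add: divide_le_eq)
      then have "K3 / (real k * w) / real k \<le> 1 / real k"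
        by (rule divide_right_mono) simp
      then show "x \<le> 1 / real k"
        by (simp add: x_def K3_def power_divide power2_eq_square mult_ac)
    qed
    define z where "z = exp 1 * (1 + real k * w) ^ \<Delta>"
    have z: "0 < z"
      using w by (simp add: z_def add_pos_nonneg)
    define E1 where "E1 = real (N choose k) * real m ^ k * real t * (w ^ (k - 1) * (1 - p) ^ (k choose 2))"
    have Uk: "(real k - 3) / 2 * (- ln (1 - p)) \<le> ln D"
      using kb(2) by (simp only: L_def)
    have Lk: "ln D \<le> (real k - 2) / 2 * (- ln (1 - p))"
      using kb(3) by (simp only: L_def)
    have "ln (a * real n * p * (1 - \<eta>)) = ln D"
      by (simp add: D_def d_def mult_ac)
    then have E1_ge: "\<epsilon> * (1 + \<eta> / 2) ^ k \<le> E1"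
      unfolding E1_def w_def using p \<epsilon> \<eta> a k3 kN t_ge npos Nk Uk
      by (intro expected_trees_ge[where a = a and n = "real n"]) auto
    have E1pos: "0 < \<epsilon> * (1 + \<eta> / 2) ^ k"
      using \<epsilon> \<eta> by simp
    define \<S> where "\<S> = transversals (block_of N) {1..N * m} k"
    have "1 / (1 + (\<Sum>l\<in>{2..k div 2}. real (k choose l) * (real k / n') ^ l * ((1 + x) / (1 - p)) ^ (l choose 2))
      + (\<Sum>j\<in>{j. 2 * j < k}. real (k choose j) * (n' ^ j / fact j) * z ^ j *
           (1 - p) ^ ((k choose 2) - (k - j choose 2))) / E1)
      \<le> measure_pmf.prob (edge_pmf {1..n} p) (\<Union>(S, T)\<in>Sigma \<S> (bounded_trees \<Delta>). induced_event S T)"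
    proof -
      have "card {..<N} = N" "k \<le> card {..<N}"
        using kN by auto
      moreover have "card {v \<in> {1..N * m}. block_of N v = j} = m" if "j \<in> {..<N}" for j
        unfolding block_of_def using that by (intro card_residue_class) simp
      moreover have "block_of N ` {1..N * m} \<subseteq> {..<N}"
        using Npos by (auto simp: block_of_def)
      moreover have "{1..N * m} \<subseteq> {1..n}"
        using Nm(1) by auto
      ultimately show ?thesis
        using second_moment_bound[of "{1..n}" "{1..N * m}" "{..<N}" "block_of N" m k p \<Delta> t] t tpos k3 m(1) p(1) p1
        unfolding x_def z_def E1_def n'_def w_def \<S>_def by simp
    qed
    also have "\<dots> \<le> measure_pmf.prob (edge_pmf {1..n} p) {f. \<exists>S\<in>\<S>. induces_forest \<Delta> f S}"
      by (intro measure_pmf.finite_measure_mono) (auto intro: induced_event_imp_induces_forest)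
    finally have prob_ge: "1 / (1 + (\<Sum>l\<in>{2..k div 2}. real (k choose l) * (real k / n') ^ l * ((1 + x) / (1 - p)) ^ (l choose 2))
      + (\<Sum>j\<in>{j. 2 * j < k}. real (k choose j) * (n' ^ j / fact j) * z ^ j *
           (1 - p) ^ ((k choose 2) - (k - j choose 2))) / E1)
      \<le> measure_pmf.prob (edge_pmf {1..n} p) {f. \<exists>S\<in>\<S>. induces_forest \<Delta> f S}" .
    have \<Lambda>pos: "0 \<le> \<Lambda> d"
    proof -
      have "0 \<le> ln D"
        using D1 by simp
      then show ?thesis
        using lnD unfolding \<Lambda>_def by linarith
    qed
    have small: "real (k choose l) * (real k / n') ^ l * ((1 + x) / (1 - p)) ^ (l choose 2) \<le>
        (real n * d powr (- 7 / 5) / real l) ^ l" if l: "l \<in> {2..k div 2}" for l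
    proof -
      have "real (k choose l) * (real k / n') ^ l * ((1 + x) / (1 - p)) ^ (l choose 2) \<le>
          (exp (3 / 2) * (real k)\<^sup>2 / n' * sqrt D * exp (- ln (1 - p) / 4) / real l) ^ l"
        using l p p1 x n'pos D1 Uk by (intro small_overlap_le) auto
      also have "\<dots> \<le> (real n * d powr (- 7 / 5) / real l) ^ l"
      proof (intro power_mono divide_right_mono)
        have "exp (3 / 2) * (real k)\<^sup>2 / n' * sqrt D * exp (- ln (1 - p) / 4) \<le>
            exp (3 / 2) * (\<Lambda> d * real n / d)\<^sup>2 / (real n / 2) * sqrt (a * d) * E\<epsilon>"
        proof (intro mult_mono frac_le power_mono real_sqrt_le_mono)
          show "exp (- ln (1 - p) / 4) \<le> E\<epsilon>"
            using kb(9) by (simp add: E\<epsilon>_def L_def)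
        qed (use k_le n'_half npos Dle D1 a d1 \<Lambda>pos in auto)
        also have "\<dots> = K1 * (\<Lambda> d)\<^sup>2 * (real n * (sqrt d / d\<^sup>2))"
          using npos by (simp add: K1_def power2_eq_square real_sqrt_mult)
        also have "\<dots> \<le> d powr (1 / 10) * (real n * (sqrt d / d\<^sup>2))"
          using D0(1)[OF dD0] d1 by (intro mult_right_mono) auto
        also have "sqrt d / d\<^sup>2 = d powr (- 3 / 2)"
          using d1 powr_diff[of d "1 / 2" 2] by (simp add: powr_half_sqrt)
        also have "d powr (1 / 10) * (real n * d powr (- 3 / 2)) = real n * d powr (- 7 / 5)"
          by (simp flip: powr_add)
        finally show "exp (3 / 2) * (real k)\<^sup>2 / n' * sqrt D * exp (- ln (1 - p) / 4) \<le> real n * d powr (- 7 / 5)" .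
      qed (use n'pos D1 in auto)
      finally show ?thesis .
    qed
    have large: "real (k choose j) * (n' ^ j / fact j) * z ^ j * (1 - p) ^ ((k choose 2) - (k - j choose 2)) \<le>
        ((real n)\<^sup>2 * d powr (- 12 / 5) / (real j)\<^sup>2) ^ j" if j: "2 * j < k" for j
    proof (cases "j = 0")
      case False
      have "real (k choose j) * (n' ^ j / fact j) * z ^ j * (1 - p) ^ ((k choose 2) - (k - j choose 2)) \<le>
          (exp 2 * real k * n' * z * D powr (- 3 / 2) / (real j)\<^sup>2) ^ j"
        using False j p p1 n'pos z D1 Lk by (intro large_overlap_le) auto
      also have "\<dots> \<le> ((real n)\<^sup>2 * d powr (- 12 / 5) / (real j)\<^sup>2) ^ j"
      proof (intro power_mono divide_right_mono)
        \<comment> \<open>\<open>k * w\<close> is only logarithmic in \<open>d\<close>; hence so is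
          \<open>z\<close>, up to a power.\<close>
        have "w \<le> p / \<epsilon>"
          unfolding w_def using p p1 \<epsilon> by (intro divide_left_mono mult_pos_pos) auto
        then have "real k * w \<le> (\<Lambda> d * real n / d) * (p / \<epsilon>)"
          using k_le w by (intro mult_mono) auto
        also have "\<dots> = \<Lambda> d / \<epsilon>"
          using p npos by (simp add: d_def)
        finally have kw: "real k * w \<le> \<Lambda> d / \<epsilon>" .
        have "exp 2 * real k * n' * z * D powr (- 3 / 2) \<le>
            exp 2 * (\<Lambda> d * real n / d) * real n * (exp 1 * (1 + \<Lambda> d / \<epsilon>) ^ \<Delta>) * D powr (- 3 / 2)"
          unfolding z_def using k_le n'_le kw w n'pos \<Lambda>pos d1 \<epsilon>
          by (intro mult_mono power_mono) (auto intro!: mult_nonneg_nonneg add_nonneg_nonneg)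
        also have "\<dots> = (exp 2 * exp 1 * (a * (1 - \<eta>)) powr (- 3 / 2) * \<Lambda> d * (1 + \<Lambda> d / \<epsilon>) ^ \<Delta>) *
              ((real n)\<^sup>2 * (d powr (- 3 / 2) / d))"
        proof -
          have "D powr (- 3 / 2) = (a * (1 - \<eta>)) powr (- 3 / 2) * d powr (- 3 / 2)"
            unfolding D_def using a \<eta> d1 by (subst powr_mult[symmetric]) (auto simp: mult_ac)
          then show ?thesis
            by (simp add: power2_eq_square)
        qed
        also have "exp 2 * exp 1 = exp (3 :: real)"
          by (simp flip: exp_add)
        also have "d powr (- 3 / 2) / d = d powr (- 5 / 2)"
          using d1 powr_diff[of d "- 3 / 2" 1] by simp
        also have "(exp 3 * (a * (1 - \<eta>)) powr (- 3 / 2) * \<Lambda> d * (1 + \<Lambda> d / \<epsilon>) ^ \<Delta>) * ((real n)\<^sup>2 * d powr (- 5 / 2)) \<le>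
            d powr (1 / 10) * ((real n)\<^sup>2 * d powr (- 5 / 2))"
          using D0(2)[OF dD0] by (intro mult_right_mono) (auto simp: K2_def)
        also have "\<dots> = (real n)\<^sup>2 * d powr (- 12 / 5)"
          by (simp flip: powr_add)
        finally show "exp 2 * real k * n' * z * D powr (- 3 / 2) \<le> (real n)\<^sup>2 * d powr (- 12 / 5)" .
      qed (use n'pos z in auto)
      finally show ?thesis .
    qed simp
    have nonneg: "0 \<le> real (k choose j) * (n' ^ j / fact j) * z ^ j * (1 - p) ^ ((k choose 2) - (k - j choose 2))" for j
      using n'pos z p1 by (intro mult_nonneg_nonneg) auto
    have nonneg': "0 \<le> real (k choose l) * (real k / n') ^ l * ((1 + x) / (1 - p)) ^ (l choose 2)" for l
      using n'pos x p1 by (intro mult_nonneg_nonneg) auto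
    have "1 / (1 + (\<Sum>l\<in>{2..k div 2}. (real n * d powr (- 7 / 5) / real l) ^ l)
        + (\<Sum>j\<in>{j. 2 * j < k}. ((real n)\<^sup>2 * d powr (- 12 / 5) / (real j)\<^sup>2) ^ j) / (\<epsilon> * (1 + \<eta> / 2) ^ k))
      \<le> 1 / (1 + (\<Sum>l\<in>{2..k div 2}. real (k choose l) * (real k / n') ^ l * ((1 + x) / (1 - p)) ^ (l choose 2))
      + (\<Sum>j\<in>{j. 2 * j < k}. real (k choose j) * (n' ^ j / fact j) * z ^ j *
           (1 - p) ^ ((k choose 2) - (k - j choose 2))) / E1)"
    proof (intro divide_left_mono add_mono order_refl sum_mono frac_le sum_nonneg)
      show "0 < (1 + (\<Sum>l\<in>{2..k div 2}. (real n * d powr (- 7 / 5) / real l) ^ l)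
        + (\<Sum>j\<in>{j. 2 * j < k}. ((real n)\<^sup>2 * d powr (- 12 / 5) / (real j)\<^sup>2) ^ j) / (\<epsilon> * (1 + \<eta> / 2) ^ k)) *
        (1 + (\<Sum>l\<in>{2..k div 2}. real (k choose l) * (real k / n') ^ l * ((1 + x) / (1 - p)) ^ (l choose 2))
      + (\<Sum>j\<in>{j. 2 * j < k}. real (k choose j) * (n' ^ j / fact j) * z ^ j *
           (1 - p) ^ ((k choose 2) - (k - j choose 2))) / E1)"
        using nonneg nonneg' E1pos E1_ge
        by (intro mult_pos_pos add_pos_nonneg sum_nonneg divide_nonneg_nonneg) auto
    qed (use small large E1_ge E1pos in \<open>auto\<close>)
    also note prob_ge
    finally show "1 / (1 + (\<Sum>l\<in>{2..k div 2}. (real n * d powr (- 7 / 5) / real l) ^ l)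
        + (\<Sum>j\<in>{j. 2 * j < k}. ((real n)\<^sup>2 * d powr (- 12 / 5) / (real j)\<^sup>2) ^ j) / (\<epsilon> * (1 + \<eta> / 2) ^ k))
      \<le> measure_pmf.prob (edge_pmf {1..n} p)
          {f. \<exists>S\<in>transversals (block_of N) {1..N * m} k. induces_forest \<Delta> f S}"
      by (simp add: \<S>_def)
  qed
qed

section \<open>The largest transversal forest as a Lipschitz function of the blocks\<close>

definition max_transversal_forest :: "nat \<Rightarrow> ('a \<Rightarrow> 'b) \<Rightarrow> 'a set \<Rightarrow> ('a set \<Rightarrow> bool) \<Rightarrow> nat" where
  "max_transversal_forest \<Delta> b X f = Max (card ` {S. S \<subseteq> X \<and> inj_on b S \<and> induces_forest \<Delta> f S})"

lemma induces_forest_empty [simp]: "induces_forest \<Delta> f {}"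
  by (auto simp: induces_forest_def bounded_forests_def all_pairs_def cong: conj_cong)

lemma max_transversal_forest_ge:
  assumes "finite X" "S \<subseteq> X" "inj_on b S" "induces_forest \<Delta> f S"
  shows "card S \<le> max_transversal_forest \<Delta> b X f"
  unfolding max_transversal_forest_def using assms by (intro Max_ge) auto

lemma max_transversal_forest_witness:
  assumes "finite X"
  obtains S where "S \<subseteq> X" "inj_on b S" "induces_forest \<Delta> f S" "max_transversal_forest \<Delta> b X f = card S"
proof -
  define \<F> where "\<F> = {S. S \<subseteq> X \<and> inj_on b S \<and> induces_forest \<Delta> f S}"
  have "finite \<F>" "{} \<in> \<F>"
    using assms by (auto simp: \<F>_def)
  then have "Max (card ` \<F>) \<in> card ` \<F>"
    by (intro Max_in) auto
  then show ?thesis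
    using that by (auto simp: max_transversal_forest_def \<F>_def)
qed

text \<open>A pair is charged to the block of its larger vertex. This divides the independent
  coordinates into as many groups as there are blocks, and a vertex set that avoids block
  \<open>i\<close> contains no pair charged to \<open>i\<close>.\<close>

definition edge_block :: "(nat \<Rightarrow> nat) \<Rightarrow> nat set \<Rightarrow> nat \<Rightarrow> nat set set" where
  "edge_block b V i = {e \<in> all_pairs V. b (Max e) = i}"

lemma Max_edge_mem:
  fixes V :: "nat set"
  assumes "e \<in> all_pairs V"
  shows "Max e \<in> V"
proof -
  have e: "e \<subseteq> V" "card e = 2"
    using assms by (simp_all add: all_pairs_def)
  then have "finite e" "e \<noteq> {}"
    by (metis card.infinite zero_neq_numeral, metis card.empty zero_neq_numeral)
  then have "Max e \<in> e"
    by (rule Max_in)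
  then show ?thesis
    using e(1) by (rule rev_subsetD)
qed

text \<open>Deleting from an optimal set its only vertex in block \<open>i\<close> removes every edge of \<open>edge_block b V i\<close>.\<close>

lemma lipschitz_max_transversal_forest:
  assumes "finite V" "X \<subseteq> V"
  shows "lipschitz_blocks N (edge_block b V) (\<lambda>f. real (max_transversal_forest \<Delta> b X f))"
  unfolding lipschitz_blocks_def
proof (intro allI impI)
  fix i and f g :: "nat set \<Rightarrow> bool"
  assume agree: "\<forall>e. e \<notin> edge_block b V i \<longrightarrow> f e = g e"
  have finX: "finite X"
    using assms finite_subset by blast
  obtain S where S: "S \<subseteq> X" "inj_on b S" "induces_forest \<Delta> f S" "max_transversal_forest \<Delta> b X f = card S"
    using max_transversal_forest_witness[OF finX] .
  define S' where "S' = {v \<in> S. b v \<noteq> i}"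
  have finS: "finite S"
    using S(1) finX finite_subset by blast
  have fS': "induces_forest \<Delta> f S'"
    by (rule induces_forest_subset[OF finS _ S(3)]) (auto simp: S'_def)
  have "f e = g e" if e: "e \<in> all_pairs S'" for e
  proof -
    have "Max e \<in> S'"
      using e by (rule Max_edge_mem)
    then have "e \<notin> edge_block b V i"
      by (simp add: S'_def edge_block_def)
    then show ?thesis
      using agree by blast
  qed
  then have "{e \<in> all_pairs S'. f e} = {e \<in> all_pairs S'. g e}"
    by blast
  then have "induces_forest \<Delta> g S'"
    using fS' by (simp add: induces_forest_def)
  moreover have "inj_on b S'" "S' \<subseteq> X"
    using S by (auto simp: S'_def intro: inj_on_subset)
  ultimately have "card S' \<le> max_transversal_forest \<Delta> b X g"
    using finX by (intro max_transversal_forest_ge)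
  moreover have "card S \<le> card S' + 1"
  proof -
    have "card {v \<in> S. b v = i} \<le> 1"
      using S(2) finS by (auto simp: card_le_Suc0_iff_eq inj_on_def)
    moreover have "S = S' \<union> {v \<in> S. b v = i}"
      by (auto simp: S'_def)
    ultimately show ?thesis
      using card_Un_le[of S' "{v \<in> S. b v = i}"] by simp
  qed
  ultimately show "real (max_transversal_forest \<Delta> b X f) \<le> real (max_transversal_forest \<Delta> b X g) + 1"
    using S(4) by simp
qed

text \<open>A transversal forest on \<open>k\<close> vertices shows that the Lipschitz function
  reaches \<open>k\<close>, and this function never exceeds the true maximum. So both events compare
  with tails of the Lipschitz function.\<close>

lemma max_induced_forest_lower_tail:
  fixes p t :: real and b :: "nat \<Rightarrow> nat"
  assumes V: "finite V" "X \<subseteq> V" and b: "\<And>v. v \<in> V \<Longrightarrow> b v < N" and "0 < N" "0 \<le> t"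
  shows "measure_pmf.prob (edge_pmf V p) {f. real (max_induced_forest \<Delta> (graph_of V f)) \<le> real k - t} *
    measure_pmf.prob (edge_pmf V p) {f. \<exists>S\<in>transversals b X k. induces_forest \<Delta> f S} \<le> exp (- (t\<^sup>2 / (2 * real N)))"
proof -
  define F where "F f = real (max_transversal_forest \<Delta> b X f)" for f
  have finX: "finite X"
    using V finite_subset by blast
  have "all_pairs V = (\<Union>i<N. edge_block b V i)"
  proof -
    have "b (Max e) < N" if "e \<in> all_pairs V" for e
      using that by (intro b Max_edge_mem)
    then show ?thesis
      by (auto simp: edge_block_def)
  qed
  then have pmf: "edge_pmf V p = Pi_pmf (\<Union>i<N. edge_block b V i) False (\<lambda>_. bernoulli_pmf p)"
    by (simp add: edge_pmf_def)
  have conc: "measure_pmf.prob (edge_pmf V p) {f. F f \<le> real k - t} * measure_pmf.prob (edge_pmf V p) {f. real k \<le> F f} \<le>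
      exp (- (t\<^sup>2 / (2 * real N)))"
    unfolding pmf
  proof (rule prob_le_lipschitz_blocks)
    show "finite (set_pmf (bernoulli_pmf p))"
      by (rule finite_subset[of _ UNIV]) auto
    show "finite (edge_block b V i)" for i
      using V by (simp add: edge_block_def)
    show "lipschitz_blocks N (edge_block b V) F"
      unfolding F_def using V by (rule lipschitz_max_transversal_forest)
  qed (use assms in \<open>auto simp: edge_block_def\<close>)
  have 1: "measure_pmf.prob (edge_pmf V p) {f. real (max_induced_forest \<Delta> (graph_of V f)) \<le> real k - t} \<le>
      measure_pmf.prob (edge_pmf V p) {f. F f \<le> real k - t}"
  proof (intro measure_pmf.finite_measure_mono)
    have "max_transversal_forest \<Delta> b X f \<le> max_induced_forest \<Delta> (graph_of V f)" for f
    proof -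
      obtain S where "S \<subseteq> X" "induces_forest \<Delta> f S" "max_transversal_forest \<Delta> b X f = card S"
        using max_transversal_forest_witness[OF finX] by metis
      then show ?thesis
        using V by (subst max_induced_forest_ge_iff) auto
    qed
    then show "{f. real (max_induced_forest \<Delta> (graph_of V f)) \<le> real k - t} \<subseteq> {f. F f \<le> real k - t}"
      unfolding F_def by (auto intro: order_trans[OF of_nat_mono])
  qed auto
  have 2: "measure_pmf.prob (edge_pmf V p) {f. \<exists>S\<in>transversals b X k. induces_forest \<Delta> f S} \<le>
      measure_pmf.prob (edge_pmf V p) {f. real k \<le> F f}"
    using max_transversal_forest_ge[OF finX]
    by (intro measure_pmf.finite_measure_mono) (auto simp: F_def transversals_def)
  show ?thesis
    using mult_mono[OF 1 2] conc by simp
qed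

section \<open>Lower tails for dense and for sparse graphs\<close>

lemma power_div_le_exp:
  fixes A :: real
  assumes "0 \<le> A"
  shows "(A / real l) ^ l \<le> exp A"
proof (cases "l = 0")
  case False
  have "fact l \<le> real l ^ l"
    using fact_le_power[of l, where 'a = real] by simp
  then have "A ^ l / real l ^ l \<le> A ^ l / fact l"
    using assms False by (intro divide_left_mono) auto
  also have "\<dots> \<le> exp A"
    by (rule power_div_fact_le_exp[OF assms])
  finally show ?thesis
    by (simp add: power_divide)
qed (use assms in simp)

lemma linear_over_geometric_le:
  fixes \<epsilon> \<delta> :: real
  assumes "0 < \<epsilon>" "\<epsilon> < 1" "0 < \<delta>"
  obtains k1 :: nat where "\<And>k. k1 \<le> k \<Longrightarrow> real k / (\<epsilon> * (1 + \<epsilon> / 2) ^ k) \<le> \<delta> / 2"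
proof -
  have "\<forall>\<^sub>F k in sequentially. real k \<le> \<delta> / 2 * \<epsilon> * exp (ln (1 + \<epsilon> / 2) * real k)"
    using assms by real_asymp
  then obtain k1 where k1: "\<And>k. k1 \<le> k \<Longrightarrow> real k \<le> \<delta> / 2 * \<epsilon> * exp (ln (1 + \<epsilon> / 2) * real k)"
    unfolding eventually_sequentially by blast
  show ?thesis
  proof (rule that[of k1])
    fix k assume "k1 \<le> k"
    from k1[OF this] have "real k \<le> \<delta> / 2 * (\<epsilon> * (1 + \<epsilon> / 2) ^ k)"
      using assms by (simp add: mult.commute[of "ln (1 + \<epsilon> / 2)"] exp_of_nat_mult mult_ac)
    then show "real k / (\<epsilon> * (1 + \<epsilon> / 2) ^ k) \<le> \<delta> / 2"
      using assms by (subst divide_le_eq) (auto intro!: mult_pos_pos zero_less_power)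
  qed
qed

lemma prob_gnp_conv:
  "measure_pmf.prob (gnp n p) A = measure_pmf.prob (edge_pmf {1..n} p) {f. graph_of {1..n} f \<in> A}"
  unfolding gnp_eq_map_edge_pmf measure_map_pmf by (simp add: vimage_def)

text \<open>With \<open>m = 1\<close> every set of \<open>k\<close> vertices is a transversal. The
  small overlaps contribute at most \<open>k * n * d powr (- 7 / 5)\<close>, which tends to 0. Each
  term of the large overlaps is at most 1, so their sum is at most \<open>k\<close>, and it is
  divided by a mean that grows geometrically in \<open>k\<close>.\<close>

lemma dense_lower_tail:
  fixes \<epsilon> :: real
  assumes \<Delta>: "3 \<le> \<Delta>" and \<epsilon>: "0 < \<epsilon>" "\<epsilon> < 1"
  obtains C where "0 < C" "\<And>\<delta>. 0 < \<delta> \<Longrightarrow> \<exists>n0. \<forall>n\<ge>n0. \<forall>p. C / real n \<le> p \<longrightarrow> p \<le> 1 - \<epsilon> \<longrightarrow>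
    real n powr (9 / 10) \<le> real n * p \<longrightarrow>
    measure_pmf.prob (gnp n p)
      {G. int (max_induced_forest \<Delta> G) < \<lfloor>2 * log (1 / (1 - p)) (a_const \<Delta> * real n * p * (1 - \<epsilon>)) + 3\<rfloor>} \<le> \<delta>"
proof -
  obtain D0 k0 where D0: "1 < D0" and main: "\<And>n p m k N d. d = real n * p \<Longrightarrow> D0 \<le> d \<Longrightarrow> 0 < p \<Longrightarrow>
      p \<le> 1 - \<epsilon> \<Longrightarrow> 1 \<le> m \<Longrightarrow> real m \<le> d powr (9 / 10) \<Longrightarrow>
      k = nat \<lfloor>2 * log (1 / (1 - p)) (a_const \<Delta> * real n * p * (1 - \<epsilon>)) + 3\<rfloor> \<Longrightarrow> N = n div m \<Longrightarrow> k0 \<le> k \<Longrightarrow>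
      1 / (1 + (\<Sum>l\<in>{2..k div 2}. (real n * d powr (- 7 / 5) / real l) ^ l)
        + (\<Sum>j\<in>{j. 2 * j < k}. ((real n)\<^sup>2 * d powr (- 12 / 5) / (real j)\<^sup>2) ^ j) / (\<epsilon> * (1 + \<epsilon> / 2) ^ k))
      \<le> measure_pmf.prob (edge_pmf {1..n} p)
          {f. \<exists>S\<in>transversals (block_of N) {1..N * m} k. induces_forest \<Delta> f S}"
    and size: "\<And>n p k d. d = real n * p \<Longrightarrow> D0 \<le> d \<Longrightarrow> 0 < p \<Longrightarrow> p \<le> 1 - \<epsilon> \<Longrightarrow>
      k = nat \<lfloor>2 * log (1 / (1 - p)) (a_const \<Delta> * real n * p * (1 - \<epsilon>)) + 3\<rfloor> \<Longrightarrow>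
      3 \<le> k \<and> real k \<le> real n * d powr (- 9 / 10) \<and> \<epsilon> * ln (real n) \<le> real k"
    by (rule transversal_forest_prob_ge[OF \<Delta> \<epsilon>(1) \<epsilon>]) (rule that)
  show ?thesis
  proof (rule that[of D0])
    show "0 < D0"
      using D0 by simp
    fix \<delta> :: real assume \<delta>: "0 < \<delta>"
    obtain k1 where k1: "\<And>k. k1 \<le> k \<Longrightarrow> real k / (\<epsilon> * (1 + \<epsilon> / 2) ^ k) \<le> \<delta> / 2"
      by (rule linear_over_geometric_le[OF \<epsilon> \<delta>]) (rule that)
    have "\<forall>\<^sub>F n in sequentially. real n powr (- 7 / 100) \<le> \<delta> / 2"
      using \<delta> by real_asymp
    moreover have "\<forall>\<^sub>F n in sequentially. real (max k0 k1) \<le> \<epsilon> * ln (real n)"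
      using \<epsilon> by real_asymp
    ultimately have "\<forall>\<^sub>F n in sequentially. real n powr (- 7 / 100) \<le> \<delta> / 2 \<and> real (max k0 k1) \<le> \<epsilon> * ln (real n)"
      by eventually_elim blast
    then obtain n0 where n0: "\<And>n. n0 \<le> n \<Longrightarrow> real n powr (- 7 / 100) \<le> \<delta> / 2"
      "\<And>n. n0 \<le> n \<Longrightarrow> real (max k0 k1) \<le> \<epsilon> * ln (real n)"
      unfolding eventually_sequentially by blast
    show "\<exists>n0. \<forall>n\<ge>n0. \<forall>p. D0 / real n \<le> p \<longrightarrow> p \<le> 1 - \<epsilon> \<longrightarrow> real n powr (9 / 10) \<le> real n * p \<longrightarrow>
      measure_pmf.prob (gnp n p)
      {G. int (max_induced_forest \<Delta> G) < \<lfloor>2 * log (1 / (1 - p)) (a_const \<Delta> * real n * p * (1 - \<epsilon>)) + 3\<rfloor>} \<le> \<delta>"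
    proof (intro exI[of _ "max n0 1"] allI impI)
      fix n :: nat and p :: real
      assume n: "max n0 1 \<le> n" and p: "D0 / real n \<le> p" "p \<le> 1 - \<epsilon>" "real n powr (9 / 10) \<le> real n * p"
      define d where "d = real n * p"
      define y where "y = 2 * log (1 / (1 - p)) (a_const \<Delta> * real n * p * (1 - \<epsilon>)) + 3"
      define k where "k = nat \<lfloor>y\<rfloor>"
      have npos: "1 \<le> real n" "0 < real n"
        using n by auto
      have "0 < D0 / real n"
        using D0 npos by simp
      then have p0: "0 < p"
        using p(1) by linarith
      have dD0: "D0 \<le> d"
        using p(1) npos by (simp add: d_def divide_le_eq mult.commute)
      have d1: "1 \<le> d"
        using dD0 D0 by simp
      have nd: "real n powr (9 / 10) \<le> d"
        using p(3) by (simp add: d_def)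
      note sz = size[OF d_def dD0 p0 p(2) k_def[unfolded y_def]]
      have "real (max k0 k1) \<le> real k"
        using n0(2)[of n] sz n by auto
      then have kk: "k0 \<le> k" "k1 \<le> k"
        by auto
      have m1: "real 1 \<le> d powr (9 / 10)"
        using d1 by (simp add: ge_one_powr_ge_zero)
      define S1 where "S1 = (\<Sum>l\<in>{2..k div 2}. (real n * d powr (- 7 / 5) / real l) ^ l)"
      define S2 where "S2 = (\<Sum>j\<in>{j. 2 * j < k}. ((real n)\<^sup>2 * d powr (- 12 / 5) / (real j)\<^sup>2) ^ j) / (\<epsilon> * (1 + \<epsilon> / 2) ^ k)"
      have pow_le: "d powr (- r) \<le> real n powr (9 / 10 * (- r))" if "0 \<le> r" for r
      proof -
        have "d powr (- r) \<le> (real n powr (9 / 10)) powr (- r)"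
          using nd npos that by (intro powr_mono2') auto
        then show ?thesis
          by (simp add: powr_powr)
      qed
      have A: "real n * d powr (- 7 / 5) \<le> 1"
      proof -
        have "real n * d powr (- 7 / 5) \<le> real n powr 1 * real n powr (9 / 10 * (- (7 / 5)))"
          using pow_le[of "7 / 5"] npos by (simp add: mult_left_mono)
        also have "\<dots> = real n powr (- 13 / 50)"
          by (simp only: powr_add[symmetric]) simp
        also have "\<dots> \<le> real n powr 0"
          using npos by (intro powr_mono) auto
        finally show ?thesis
          using npos by simp
      qed
      have B: "(real n)\<^sup>2 * d powr (- 12 / 5) \<le> 1"
      proof -
        have "(real n)\<^sup>2 * d powr (- 12 / 5) \<le> real n powr 2 * real n powr (9 / 10 * (- (12 / 5)))"
          using pow_le[of "12 / 5"] npos by (simp add: mult_left_mono)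
        also have "\<dots> = real n powr (- 4 / 25)"
          by (simp only: powr_add[symmetric]) simp
        also have "\<dots> \<le> real n powr 0"
          using npos by (intro powr_mono) auto
        finally show ?thesis
          using npos by simp
      qed
      have "S1 \<le> (\<Sum>l\<in>{2..k div 2}. real n * d powr (- 7 / 5))"
        unfolding S1_def
      proof (rule sum_mono)
        fix l assume l: "l \<in> {2..k div 2}"
        have "real n * d powr (- 7 / 5) / real l \<le> real n * d powr (- 7 / 5) / 1"
          using l by (intro divide_left_mono) auto
        moreover from this have "(real n * d powr (- 7 / 5) / real l) ^ l \<le> (real n * d powr (- 7 / 5) / real l) ^ 1"
          using A l by (intro power_decreasing) auto
        ultimately show "(real n * d powr (- 7 / 5) / real l) ^ l \<le> real n * d powr (- 7 / 5)"
          by simp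
      qed
      also have "\<dots> \<le> real k * (real n * d powr (- 7 / 5))"
        using d1 by (simp add: mult_right_mono)
      also have "\<dots> \<le> (real n * d powr (- 9 / 10)) * (real n * d powr (- 7 / 5))"
        using sz by (intro mult_right_mono) auto
      also have "\<dots> = (real n)\<^sup>2 * (d powr (- 9 / 10) * d powr (- 7 / 5))"
        by (simp add: power2_eq_square)
      also have "d powr (- 9 / 10) * d powr (- 7 / 5) = d powr (- (23 / 10))"
        by (simp flip: powr_add)
      \<comment> \<open>The exponent of \<open>n\<close> becomes 2 - (9/10) (23/10) =
        -7/100.\<close>
      also have "(real n)\<^sup>2 * d powr (- (23 / 10)) \<le> real n powr 2 * real n powr (9 / 10 * (- (23 / 10)))"
        using pow_le[of "23 / 10"] npos by (simp add: mult_left_mono)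
      also have "\<dots> = real n powr (- 7 / 100)"
        by (simp only: powr_add[symmetric]) simp
      also have "\<dots> \<le> \<delta> / 2"
        using n0(1)[of n] n by simp
      finally have S1: "S1 \<le> \<delta> / 2" .
      have "{j. 2 * j < k} \<subseteq> {..<k}"
        by auto
      then have "finite {j. 2 * j < k}" "card {j. 2 * j < k} \<le> k"
        using card_mono[of "{..<k}" "{j. 2 * j < k}"] by (auto intro: finite_subset)
      have "(\<Sum>j\<in>{j. 2 * j < k}. ((real n)\<^sup>2 * d powr (- 12 / 5) / (real j)\<^sup>2) ^ j) \<le> (\<Sum>j\<in>{j. 2 * j < k}. 1)"
      proof (rule sum_mono)
        fix j
        show "((real n)\<^sup>2 * d powr (- 12 / 5) / (real j)\<^sup>2) ^ j \<le> 1"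
        proof (cases "j = 0")
          case False
          then have "1 \<le> (real j)\<^sup>2"
            by simp
          then have "(real n)\<^sup>2 * d powr (- 12 / 5) / (real j)\<^sup>2 \<le> 1"
            using B by (simp add: divide_le_eq)
          then show ?thesis
            by (intro power_le_one) auto
        qed simp
      qed
      also have "\<dots> \<le> real k"
        using \<open>card {j. 2 * j < k} \<le> k\<close> by simp
      finally have "S2 \<le> real k / (\<epsilon> * (1 + \<epsilon> / 2) ^ k)"
        unfolding S2_def using \<epsilon> by (intro divide_right_mono) auto
      then have S2: "S2 \<le> \<delta> / 2"
        using k1[OF kk(2)] by linarith
      have "0 \<le> S1" "0 \<le> S2"
        unfolding S1_def S2_def using \<epsilon> by (auto intro!: sum_nonneg divide_nonneg_nonneg)
      then have "1 - (S1 + S2) \<le> 1 / (1 + S1 + S2)"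
        by (simp add: le_divide_eq algebra_simps)
      also have "\<dots> \<le> measure_pmf.prob (edge_pmf {1..n} p) {f. \<exists>S\<in>transversals (block_of (n div 1)) {1..n div 1 * 1} k. induces_forest \<Delta> f S}"
        unfolding S1_def S2_def
        by (rule main[OF d_def dD0 p0 p(2) _ m1 k_def[unfolded y_def] refl kk(1)]) simp
      also have "\<dots> \<le> measure_pmf.prob (edge_pmf {1..n} p) {f. k \<le> max_induced_forest \<Delta> (graph_of {1..n} f)}"
        by (intro measure_pmf.finite_measure_mono) (auto simp: max_induced_forest_ge_iff transversals_def)
      also have "\<dots> = 1 - measure_pmf.prob (edge_pmf {1..n} p) {f. \<not> k \<le> max_induced_forest \<Delta> (graph_of {1..n} f)}"
        by (subst measure_pmf.prob_compl[symmetric]) (auto simp: Compl_eq_Diff_UNIV[symmetric] Collect_neg_eq)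
      finally have "measure_pmf.prob (edge_pmf {1..n} p) {f. \<not> k \<le> max_induced_forest \<Delta> (graph_of {1..n} f)} \<le> \<delta>"
        using S1 S2 by linarith
      moreover have "{f. graph_of {1..n} f \<in> {G. int (max_induced_forest \<Delta> G) < \<lfloor>y\<rfloor>}} =
          {f. \<not> k \<le> max_induced_forest \<Delta> (graph_of {1..n} f)}"
        by (auto simp: k_def)
      ultimately show "measure_pmf.prob (gnp n p)
        {G. int (max_induced_forest \<Delta> G) < \<lfloor>2 * log (1 / (1 - p)) (a_const \<Delta> * real n * p * (1 - \<epsilon>)) + 3\<rfloor>} \<le> \<delta>"
        unfolding prob_gnp_conv y_def by simp
    qed
  qed
qed

text \<open>The second moment is applied to the larger target given by \<eta> and yields only a
  small success probability \<open>P\<close>. The failure probability is then at most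
  \<open>exp (- (t\<^sup>2 / (2 * N))) / P\<close>, where \<open>t\<close> is the gap between the
  two targets.\<close>

lemma sparse_lower_tail:
  fixes \<epsilon> :: real
  assumes \<Delta>: "3 \<le> \<Delta>" and \<epsilon>: "0 < \<epsilon>" "\<epsilon> < 1"
  obtains C where "0 < C" "\<And>\<delta>. 0 < \<delta> \<Longrightarrow> \<exists>n0. \<forall>n\<ge>n0. \<forall>p. C / real n \<le> p \<longrightarrow> p \<le> 1 - \<epsilon> \<longrightarrow>
    real n * p \<le> real n powr (9 / 10) \<longrightarrow>
    measure_pmf.prob (gnp n p)
      {G. int (max_induced_forest \<Delta> G) < \<lfloor>2 * log (1 / (1 - p)) (a_const \<Delta> * real n * p * (1 - \<epsilon>)) + 3\<rfloor>} \<le> \<delta>"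
proof -
  define \<eta> where "\<eta> = \<epsilon> / 2"
  define a where "a = a_const \<Delta>"
  have a: "1 < a"
    using a_const_gt_1[OF \<Delta>] by (simp add: a_def)
  have \<eta>: "0 < \<eta>" "\<eta> < 1"
    using \<epsilon> by (auto simp: \<eta>_def)
  obtain D0 k0 where D0: "1 < D0" and main: "\<And>n p m k N d. d = real n * p \<Longrightarrow> D0 \<le> d \<Longrightarrow> 0 < p \<Longrightarrow>
      p \<le> 1 - \<epsilon> \<Longrightarrow> 1 \<le> m \<Longrightarrow> real m \<le> d powr (9 / 10) \<Longrightarrow>
      k = nat \<lfloor>2 * log (1 / (1 - p)) (a_const \<Delta> * real n * p * (1 - \<eta>)) + 3\<rfloor> \<Longrightarrow> N = n div m \<Longrightarrow> k0 \<le> k \<Longrightarrow>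
      1 / (1 + (\<Sum>l\<in>{2..k div 2}. (real n * d powr (- 7 / 5) / real l) ^ l)
        + (\<Sum>j\<in>{j. 2 * j < k}. ((real n)\<^sup>2 * d powr (- 12 / 5) / (real j)\<^sup>2) ^ j) / (\<epsilon> * (1 + \<eta> / 2) ^ k))
      \<le> measure_pmf.prob (edge_pmf {1..n} p)
          {f. \<exists>S\<in>transversals (block_of N) {1..N * m} k. induces_forest \<Delta> f S}"
    and size: "\<And>n p k d. d = real n * p \<Longrightarrow> D0 \<le> d \<Longrightarrow> 0 < p \<Longrightarrow> p \<le> 1 - \<epsilon> \<Longrightarrow>
      k = nat \<lfloor>2 * log (1 / (1 - p)) (a_const \<Delta> * real n * p * (1 - \<eta>)) + 3\<rfloor> \<Longrightarrow>
      3 \<le> k \<and> real k \<le> real n * d powr (- 9 / 10) \<and> \<epsilon> * ln (real n) \<le> real k"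
    by (rule transversal_forest_prob_ge[OF \<Delta> \<epsilon>(1) \<eta>]) (rule that)
  have "\<forall>\<^sub>F d in at_top. 2 * d powr (- 1 / 10) \<le> \<epsilon> ^ 4 / 8"
    using \<epsilon> by real_asymp
  moreover have "\<forall>\<^sub>F d in at_top. 1 \<le> a * d * (1 - \<epsilon>)"
    using \<epsilon> a by real_asymp
  ultimately have "\<forall>\<^sub>F d in at_top. 2 * d powr (- 1 / 10) \<le> \<epsilon> ^ 4 / 8 \<and> 1 \<le> a * d * (1 - \<epsilon>)"
    by eventually_elim blast
  then obtain D1 where D1: "\<And>d. D1 \<le> d \<Longrightarrow> 2 * d powr (- 1 / 10) \<le> \<epsilon> ^ 4 / 8"
    "\<And>d. D1 \<le> d \<Longrightarrow> 1 \<le> a * d * (1 - \<epsilon>)"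
    unfolding eventually_at_top_linorder by blast
  show ?thesis
  proof (rule that[of "max D0 D1"])
    show "0 < max D0 D1"
      using D0 by simp
    fix \<delta> :: real assume \<delta>: "0 < \<delta>"
    have "\<forall>\<^sub>F n in sequentially. 3 * real n / \<epsilon> * exp (- (\<epsilon> ^ 4 / 8 * real n powr (1 / 100))) \<le> \<delta>"
      using \<delta> \<epsilon> by real_asymp
    moreover have "\<forall>\<^sub>F n in sequentially. real k0 \<le> \<epsilon> * ln (real n)"
      using \<epsilon> by real_asymp
    ultimately have "\<forall>\<^sub>F n in sequentially. 3 * real n / \<epsilon> * exp (- (\<epsilon> ^ 4 / 8 * real n powr (1 / 100))) \<le> \<delta> \<and> real k0 \<le> \<epsilon> * ln (real n)"
      by eventually_elim blast
    then obtain n0 where n0: "\<And>n. n0 \<le> n \<Longrightarrow> 3 * real n / \<epsilon> * exp (- (\<epsilon> ^ 4 / 8 * real n powr (1 / 100))) \<le> \<delta>"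
      "\<And>n. n0 \<le> n \<Longrightarrow> real k0 \<le> \<epsilon> * ln (real n)"
      unfolding eventually_sequentially by blast
    show "\<exists>n0. \<forall>n\<ge>n0. \<forall>p. max D0 D1 / real n \<le> p \<longrightarrow> p \<le> 1 - \<epsilon> \<longrightarrow> real n * p \<le> real n powr (9 / 10) \<longrightarrow>
      measure_pmf.prob (gnp n p)
      {G. int (max_induced_forest \<Delta> G) < \<lfloor>2 * log (1 / (1 - p)) (a_const \<Delta> * real n * p * (1 - \<epsilon>)) + 3\<rfloor>} \<le> \<delta>"
    proof (intro exI[of _ "max n0 1"] allI impI)
      fix n :: nat and p :: real
      assume n: "max n0 1 \<le> n" and p: "max D0 D1 / real n \<le> p" "p \<le> 1 - \<epsilon>" "real n * p \<le> real n powr (9 / 10)"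
      define d where "d = real n * p"
      define y0 where "y0 = 2 * log (1 / (1 - p)) (a_const \<Delta> * real n * p * (1 - \<epsilon>)) + 3"
      define y where "y = 2 * log (1 / (1 - p)) (a_const \<Delta> * real n * p * (1 - \<eta>)) + 3"
      define k where "k = nat \<lfloor>y\<rfloor>"
      define L where "L = - ln (1 - p)"
      have npos: "1 \<le> real n" "0 < real n"
        using n by auto
      have "0 < max D0 D1 / real n"
        using D0 npos by simp
      then have p0: "0 < p"
        using p(1) by linarith
      have p1: "p < 1"
        using p(2) \<epsilon> by simp
      have "max D0 D1 \<le> d"
        using p(1) npos by (simp add: d_def divide_le_eq mult.commute)
      then have dD0: "D0 \<le> d" and dD1: "D1 \<le> d"
        by auto
      have d1: "1 \<le> d"
        using dD0 D0 by simp
      have dn: "d \<le> real n"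
        unfolding d_def using p1 p0 by (simp add: mult_left_le)
      note sz = size[OF d_def dD0 p0 p(2) k_def[unfolded y_def]]
      have "real k0 \<le> real k"
        using n0(2)[of n] sz n by auto
      then have kk: "k0 \<le> k"
        by auto
      \<comment> \<open>Rounding down loses at most a factor 2, which reappears in the bound for
        \<open>N\<close>.\<close>
      define m where "m = nat \<lfloor>d powr (9 / 10)\<rfloor>"
      define N where "N = n div m"
      have pow1: "1 \<le> d powr (9 / 10)"
        using d1 by (simp add: ge_one_powr_ge_zero)
      have m: "1 \<le> m" "real m \<le> d powr (9 / 10)" "d powr (9 / 10) / 2 \<le> real m"
      proof -
        have "1 \<le> \<lfloor>d powr (9 / 10)\<rfloor>"
          using pow1 by simp
        then have eq: "real m = of_int \<lfloor>d powr (9 / 10)\<rfloor>" and m1: "1 \<le> m"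
          unfolding m_def by (simp, linarith)
        show "1 \<le> m" by (rule m1)
        show "real m \<le> d powr (9 / 10)"
          unfolding eq by simp
        have "d powr (9 / 10) \<le> real m + 1"
          unfolding eq by linarith
        moreover have "1 \<le> real m"
          using m1 by simp
        ultimately show "d powr (9 / 10) / 2 \<le> real m"
          by linarith
      qed
      have "real m \<le> d powr 1"
        using m(2) d1 powr_mono[of "9 / 10" 1 d] by linarith
      then have "real m \<le> real n"
        using dn d1 by simp
      then have Npos: "0 < N"
        using m(1) by (simp add: N_def div_greater_zero_iff)
      have N_le: "real N \<le> 2 * real n * d powr (- 9 / 10)"
      proof -
        have "real N \<le> real n / real m"
          unfolding N_def by (rule of_nat_div_le_of_nat)
        also have "\<dots> \<le> real n / (d powr (9 / 10) / 2)"
          using m pow1 npos by (intro divide_left_mono mult_pos_pos) auto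
        also have "\<dots> = 2 * real n * d powr (- 9 / 10)"
          using d1 by (simp add: powr_minus_divide)
        finally show ?thesis .
      qed
      \<comment> \<open>\<open>z\<close> is the square root of
        \<open>n\<^sup>2 * d powr (- 12 / 5)\<close>. As \<open>(z / j) ^ j \<le> exp z\<close>,
        every term of either sum is at most \<open>exp (2 * z)\<close>.\<close>
      define z where "z = real n * d powr (- 6 / 5)"
      have z: "0 \<le> z"
        by (simp add: z_def)
      define S1 where "S1 = (\<Sum>l\<in>{2..k div 2}. (real n * d powr (- 7 / 5) / real l) ^ l)"
      define S2 where "S2 = (\<Sum>j\<in>{j. 2 * j < k}. ((real n)\<^sup>2 * d powr (- 12 / 5) / (real j)\<^sup>2) ^ j) / (\<epsilon> * (1 + \<eta> / 2) ^ k)"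
      define P where "P = measure_pmf.prob (edge_pmf {1..n} p) {f. \<exists>S\<in>transversals (block_of N) {1..N * m} k. induces_forest \<Delta> f S}"
      have P_ge: "1 / (1 + S1 + S2) \<le> P"
        unfolding S1_def S2_def P_def by (rule main[OF d_def dD0 p0 p(2) m(1,2) k_def[unfolded y_def] N_def kk])
      have kn: "real k \<le> real n"
      proof -
        have "d powr (- 9 / 10) \<le> d powr 0"
          using d1 by (intro powr_mono) auto
        then have "real n * d powr (- 9 / 10) \<le> real n * 1"
          using d1 by (intro mult_left_mono) auto
        then show ?thesis
          using sz by simp
      qed
      have "S1 \<le> (\<Sum>l\<in>{2..k div 2}. exp (2 * z))"
        unfolding S1_def
      proof (rule sum_mono)
        fix l
        have "real n * d powr (- 7 / 5) \<le> z"
          unfolding z_def using d1 by (intro mult_left_mono powr_mono) auto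
        then have "exp (real n * d powr (- 7 / 5)) \<le> exp (2 * z)"
          using z by simp
        moreover have "(real n * d powr (- 7 / 5) / real l) ^ l \<le> exp (real n * d powr (- 7 / 5))"
          by (rule power_div_le_exp) simp
        ultimately show "(real n * d powr (- 7 / 5) / real l) ^ l \<le> exp (2 * z)"
          by linarith
      qed
      also have "\<dots> \<le> real n * exp (2 * z)"
        using kn by (simp add: mult_right_mono)
      finally have S1: "S1 \<le> real n * exp (2 * z)" .
      have "{j. 2 * j < k} \<subseteq> {..<k}"
        by auto
      then have ck: "card {j. 2 * j < k} \<le> k"
        using card_mono[of "{..<k}" "{j. 2 * j < k}"] by auto
      have "(\<Sum>j\<in>{j. 2 * j < k}. ((real n)\<^sup>2 * d powr (- 12 / 5) / (real j)\<^sup>2) ^ j) \<le> (\<Sum>j\<in>{j. 2 * j < k}. exp (2 * z))"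
      proof (rule sum_mono)
        fix j
        have "d powr (- 12 / 5) = d powr (- 6 / 5) * d powr (- 6 / 5)"
          by (simp flip: powr_add)
        then have "(real n)\<^sup>2 * d powr (- 12 / 5) / (real j)\<^sup>2 = (z / real j)\<^sup>2"
          by (simp add: z_def power2_eq_square)
        then have "((real n)\<^sup>2 * d powr (- 12 / 5) / (real j)\<^sup>2) ^ j = ((z / real j) ^ j)\<^sup>2"
          by (simp flip: power_mult add: mult.commute)
        also have "\<dots> \<le> (exp z)\<^sup>2"
          using z by (intro power_mono power_div_le_exp) auto
        finally show "((real n)\<^sup>2 * d powr (- 12 / 5) / (real j)\<^sup>2) ^ j \<le> exp (2 * z)"
          by (simp add: exp_double)
      qed
      also have "\<dots> = real (card {j. 2 * j < k}) * exp (2 * z)"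
        by simp
      also have "\<dots> \<le> real n * exp (2 * z)"
        using ck kn by (intro mult_right_mono) auto
      finally have sum2: "(\<Sum>j\<in>{j. 2 * j < k}. ((real n)\<^sup>2 * d powr (- 12 / 5) / (real j)\<^sup>2) ^ j) \<le> real n * exp (2 * z)" .
      have "S2 \<le> real n * exp (2 * z) / \<epsilon>"
        unfolding S2_def
      proof (rule frac_le[OF _ sum2 \<epsilon>(1)])
        have "1 \<le> (1 + \<eta> / 2) ^ k"
          using \<eta> by (intro one_le_power) auto
        then show "\<epsilon> \<le> \<epsilon> * (1 + \<eta> / 2) ^ k"
          using \<epsilon> by simp
      qed simp
      then have "1 + S1 + S2 \<le> 1 * 1 + real n * exp (2 * z) + real n * exp (2 * z) / \<epsilon>"
        using S1 by linarith
      also have "\<dots> \<le> real n / \<epsilon> * exp (2 * z) + real n / \<epsilon> * exp (2 * z) + real n / \<epsilon> * exp (2 * z)"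
      proof -
        have ge: "1 \<le> real n / \<epsilon>" "real n \<le> real n / \<epsilon>" "1 \<le> exp (2 * z)"
          using \<epsilon> npos z by (auto simp: le_divide_eq intro: order_trans[of _ 1])
        have "1 * 1 \<le> real n / \<epsilon> * exp (2 * z)"
          using ge by (intro mult_mono) auto
        moreover have "real n * exp (2 * z) \<le> real n / \<epsilon> * exp (2 * z)"
          using ge by (intro mult_right_mono) auto
        moreover have "real n * exp (2 * z) / \<epsilon> = real n / \<epsilon> * exp (2 * z)"
          by simp
        ultimately show ?thesis
          by linarith
      qed
      also have "\<dots> = 3 * real n / \<epsilon> * exp (2 * z)"
        by simp
      finally have R_le: "1 + S1 + S2 \<le> 3 * real n / \<epsilon> * exp (2 * z)" .
      have S_nonneg: "0 \<le> S1" "0 \<le> S2"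
        unfolding S1_def S2_def using \<epsilon> \<eta> by (auto intro!: sum_nonneg divide_nonneg_nonneg mult_nonneg_nonneg)
      \<comment> \<open>With this \<open>t\<close> the number \<open>k - t\<close> is the integer
        just below \<open>\<lfloor>y0\<rfloor>\<close>, so the strict inequality of the tail event
        becomes \<open>\<le>\<close>. The \<open>+ 1\<close> also outweighs the rounding, which
        gives \<open>y - y0 \<le> t\<close>.\<close>
      define t where "t = real k - of_int \<lfloor>y0\<rfloor> + 1"
      define D where "D = a * d * (1 - \<epsilon>)"
      have D1': "1 \<le> D"
        using D1(2)[OF dD1] by (simp add: D_def)
      note kb = forest_size_bounds[OF p0 p(2) \<epsilon>(1) D1', folded L_def]
      have t_ge: "\<epsilon>\<^sup>2 / p \<le> t"
      proof -
        \<comment> \<open>The targets differ by twice this logarithmic difference over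
          \<open>L\<close>, hence by at least \<open>\<epsilon> / L\<close>, and
          \<open>L \<le> p / \<epsilon>\<close>.\<close>
        have "\<epsilon> / 2 \<le> ln (1 - \<eta>) - ln (1 - \<epsilon>)"
        proof -
          have "ln ((1 - \<epsilon>) / (1 - \<eta>)) \<le> (1 - \<epsilon>) / (1 - \<eta>) - 1"
            using \<epsilon> \<eta> by (intro ln_le_minus_one) auto
          also have "\<dots> = - (\<eta> / (1 - \<eta>))"
            using \<eta> by (simp add: \<eta>_def field_simps)
          also have "\<dots> \<le> - (\<eta> / 1)"
            using \<eta> by (simp add: le_divide_eq)
          finally show ?thesis
            using \<epsilon> \<eta> by (simp add: ln_div \<eta>_def)
        qed
        then have "2 * (\<epsilon> / 2) / L \<le> 2 * (ln (1 - \<eta>) - ln (1 - \<epsilon>)) / L"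
          using kb(7) by (intro divide_right_mono) auto
        also have "\<dots> = y - y0"
        proof -
          have ln_eq: "ln (a_const \<Delta> * real n * p * (1 - e)) = ln (a * real n * p) + ln (1 - e)" if "e < 1" for e
            using a npos p0 that by (subst ln_mult_pos) (simp_all add: a_def)
          have "ln (1 / (1 - p)) = L"
            using p1 by (simp add: L_def ln_div)
          then show ?thesis
            unfolding y_def y0_def log_def ln_eq[OF \<epsilon>(2)] ln_eq[OF \<eta>(2)]
            by (simp add: add_divide_distrib diff_divide_distrib)
        qed
        also have "\<dots> \<le> t"
        proof -
          have "of_int \<lfloor>y\<rfloor> \<le> real k"
            by (simp add: k_def)
          then show ?thesis
            unfolding t_def by linarith
        qed
        finally have "\<epsilon> / L \<le> t"
          by simp
        moreover have "\<epsilon> / (p / \<epsilon>) \<le> \<epsilon> / L"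
          using kb(7,8) \<epsilon> p0 by (intro divide_left_mono) auto
        ultimately show ?thesis
          by (simp add: power2_eq_square)
      qed
      have t0: "0 \<le> t"
        using t_ge p0 \<epsilon> by (meson divide_nonneg_pos order_trans zero_le_power2)
      define Q where "Q = measure_pmf.prob (edge_pmf {1..n} p) {f. real (max_induced_forest \<Delta> (graph_of {1..n} f)) \<le> real k - t}"
      have QP: "Q * P \<le> exp (- (t\<^sup>2 / (2 * real N)))"
        unfolding Q_def P_def
      proof (rule max_induced_forest_lower_tail)
        show "{1..N * m} \<subseteq> {1..n}"
          by (auto simp: N_def intro: order_trans[OF _ div_times_less_eq_dividend])
        show "block_of N v < N" for v
          using Npos by (simp add: block_of_def)
      qed (use Npos t0 in auto)
      \<comment> \<open>The order of \<open>t\<^sup>2 / N\<close>, since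
        \<open>1 / p = n / d\<close> and \<open>N\<close> is at most
        \<open>2 * n * d powr (- 9 / 10)\<close>. It exceeds \<open>z\<close> by the factor
        \<open>d powr (1 / 10)\<close>, so for \<open>D1 \<le> d\<close> half of the exponent
        remains.\<close>
      define u where "u = real n * d powr (- 11 / 10)"
      have expo: "\<epsilon> ^ 4 / 4 * u \<le> t\<^sup>2 / (2 * real N)"
      proof -
        have "d powr 2 = d * d"
          using d1 by (simp add: power2_eq_square)
        then have "d powr (- 11 / 10) = 1 / (d * d * d powr (- 9 / 10))"
          using powr_minus_divide[of d "11 / 10"] powr_add[of d 2 "- 9 / 10"] by simp
        moreover have "1 / p = real n / d"
          using p0 npos by (simp add: d_def)
        ultimately have "\<epsilon> ^ 4 / 4 * u = (\<epsilon>\<^sup>2 / p)\<^sup>2 / (2 * (2 * real n * d powr (- 9 / 10)))"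
          using npos d1 by (simp add: u_def d_def power2_eq_square power4_eq_xxxx mult_ac)
        also have "\<dots> \<le> t\<^sup>2 / (2 * real N)"
          using t_ge N_le Npos p0 by (intro frac_le power_mono mult_left_mono) auto
        finally show ?thesis .
      qed
      have zu: "2 * z \<le> \<epsilon> ^ 4 / 8 * u"
      proof -
        have "2 * z = 2 * d powr (- 1 / 10) * u"
          by (simp add: z_def u_def flip: powr_add)
        also have "\<dots> \<le> \<epsilon> ^ 4 / 8 * u"
          using D1(1)[OF dD1] by (intro mult_right_mono) (auto simp: u_def)
        finally show ?thesis .
      qed
      \<comment> \<open>The exponent is 1 - (9/10) (11/10) = 1/100.\<close>
      have un: "real n powr (1 / 100) \<le> u"
      proof -
        have "(real n powr (9 / 10)) powr (- 11 / 10) \<le> d powr (- 11 / 10)"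
          using p(3) d1 by (intro powr_mono2') (auto simp: d_def)
        then have "real n powr 1 * real n powr (- 99 / 100) \<le> real n * d powr (- 11 / 10)"
          using npos by (simp add: powr_powr mult_left_mono)
        moreover have "real n powr 1 * real n powr (- 99 / 100) = real n powr (1 / 100)"
          by (simp only: powr_add[symmetric]) simp
        ultimately show ?thesis
          by (simp only: u_def)
      qed
      have Rpos: "0 < 1 + S1 + S2"
        using S_nonneg by linarith
      have "Q * (1 / (1 + S1 + S2)) \<le> Q * P"
        by (rule mult_left_mono[OF P_ge]) (simp add: Q_def)
      also note QP
      finally have "Q \<le> exp (- (t\<^sup>2 / (2 * real N))) * (1 + S1 + S2)"
        using Rpos by (simp add: divide_le_eq)
      also have "\<dots> \<le> exp (- (\<epsilon> ^ 4 / 4 * u)) * (3 * real n / \<epsilon> * exp (2 * z))"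
        using expo R_le Rpos by (intro mult_mono) auto
      also have "\<dots> \<le> exp (- (\<epsilon> ^ 4 / 4 * u)) * (3 * real n / \<epsilon> * exp (\<epsilon> ^ 4 / 8 * u))"
        using zu \<epsilon> by (intro mult_left_mono) auto
      also have "\<dots> = 3 * real n / \<epsilon> * exp (- (\<epsilon> ^ 4 / 8 * u))"
      proof -
        have "exp (- (\<epsilon> ^ 4 / 4 * u)) * exp (\<epsilon> ^ 4 / 8 * u) = exp (- (\<epsilon> ^ 4 / 8 * u))"
          by (simp flip: exp_add)
        then show ?thesis
          by (metis mult.left_commute)
      qed
      also have "\<dots> \<le> 3 * real n / \<epsilon> * exp (- (\<epsilon> ^ 4 / 8 * real n powr (1 / 100)))"
        using un \<epsilon> by (intro mult_left_mono) (auto intro!: mult_left_mono)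
      also have "\<dots> \<le> \<delta>"
        using n0(1)[of n] n by simp
      finally have "Q \<le> \<delta>" .
      moreover have "{f. graph_of {1..n} f \<in> {G. int (max_induced_forest \<Delta> G) < \<lfloor>y0\<rfloor>}} =
          {f. real (max_induced_forest \<Delta> (graph_of {1..n} f)) \<le> real k - t}"
        unfolding t_def by auto
      ultimately show "measure_pmf.prob (gnp n p)
        {G. int (max_induced_forest \<Delta> G) < \<lfloor>2 * log (1 / (1 - p)) (a_const \<Delta> * real n * p * (1 - \<epsilon>)) + 3\<rfloor>} \<le> \<delta>"
        unfolding prob_gnp_conv y0_def[symmetric] Q_def by simp
    qed
  qed
qed

section \<open>Both tails together\<close>

theorem theorem2:
  fixes \<Delta> :: nat and \<epsilon> :: real
  assumes "3 \<le> \<Delta>" and "0 < \<epsilon>"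
  shows "\<exists>C::real. 0 < C \<and>
    (\<forall>p :: nat \<Rightarrow> real.
      (\<forall>\<^sub>F n in sequentially. C / real n \<le> p n \<and> p n \<le> 1 - \<epsilon>) \<longrightarrow>
      (\<lambda>n. measure_pmf.prob (gnp n (p n))
        {G. let q = 1 / (1 - p n) in
            \<lfloor>2 * log q (a_const \<Delta> * real n * p n * (1 - \<epsilon>)) + 3\<rfloor> \<le> int (max_induced_forest \<Delta> G) \<and>
            int (max_induced_forest \<Delta> G) \<le> \<lceil>2 * log q (a_const \<Delta> * real n * p n * (1 + \<epsilon>)) + 3\<rceil>})
      \<longlonglongrightarrow> 1)"
proof (cases "\<epsilon> < 1")
  case False
  \<comment> \<open>For \<open>\<epsilon> \<ge> 1\<close> the hypothesis would give
    \<open>1 / n \<le> p n \<le> 0\<close> for large \<open>n\<close>, so the claim is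
    vacuous.\<close>
  have "\<not> (\<forall>\<^sub>F n in sequentially. 1 / real n \<le> p n \<and> p n \<le> 1 - \<epsilon>)" for p :: "nat \<Rightarrow> real"
  proof
    assume "\<forall>\<^sub>F n in sequentially. 1 / real n \<le> p n \<and> p n \<le> 1 - \<epsilon>"
    moreover have "\<forall>\<^sub>F n in sequentially. 0 < n"
      by (rule eventually_gt_at_top)
    ultimately have "\<forall>\<^sub>F n :: nat in sequentially. False"
    proof eventually_elim
      case (elim n)
      then have "0 < 1 / real n"
        by simp
      then show False
        using elim False by linarith
    qed
    then show False
      by simp
  qed
  then show ?thesis
    by (intro exI[of _ 1]) auto
next
  case True
  note \<epsilon> = \<open>0 < \<epsilon>\<close> True
  define low :: "nat \<Rightarrow> real \<Rightarrow> nat ugraph set"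
    where "low n p = {G. int (max_induced_forest \<Delta> G) < \<lfloor>2 * log (1 / (1 - p)) (a_const \<Delta> * real n * p * (1 - \<epsilon>)) + 3\<rfloor>}"
    for n p
  define high :: "nat \<Rightarrow> real \<Rightarrow> nat ugraph set"
    where "high n p = {G. \<lceil>2 * log (1 / (1 - p)) (a_const \<Delta> * real n * p * (1 + \<epsilon>)) + 3\<rceil> < int (max_induced_forest \<Delta> G)}"
    for n p
  obtain C1 where C1: "0 < C1" "\<And>n p. 0 < n \<Longrightarrow> C1 / real n \<le> p \<Longrightarrow> p \<le> 1 - \<epsilon> \<Longrightarrow>
      measure_pmf.prob (gnp n p) (high n p) \<le> exp (- (\<epsilon> * ln (1 + \<epsilon>) * ln (real n)))"
    by (rule upper_tail_bound[OF assms, folded high_def]) (rule that)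
  obtain C2 where C2: "0 < C2" "\<And>\<delta>. 0 < \<delta> \<Longrightarrow> \<exists>n0. \<forall>n\<ge>n0. \<forall>p. C2 / real n \<le> p \<longrightarrow> p \<le> 1 - \<epsilon> \<longrightarrow>
      real n powr (9 / 10) \<le> real n * p \<longrightarrow> measure_pmf.prob (gnp n p) (low n p) \<le> \<delta>"
    by (rule dense_lower_tail[OF assms(1) \<epsilon>, folded low_def]) (rule that)
  obtain C3 where C3: "0 < C3" "\<And>\<delta>. 0 < \<delta> \<Longrightarrow> \<exists>n0. \<forall>n\<ge>n0. \<forall>p. C3 / real n \<le> p \<longrightarrow> p \<le> 1 - \<epsilon> \<longrightarrow>
      real n * p \<le> real n powr (9 / 10) \<longrightarrow> measure_pmf.prob (gnp n p) (low n p) \<le> \<delta>"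
    by (rule sparse_lower_tail[OF assms(1) \<epsilon>, folded low_def]) (rule that)
  define C where "C = max C1 (max C2 C3)"
  show ?thesis
  proof (intro exI[of _ C] conjI allI impI)
    show "0 < C"
      using C1(1) by (simp add: C_def)
    fix p :: "nat \<Rightarrow> real"
    assume p: "\<forall>\<^sub>F n in sequentially. C / real n \<le> p n \<and> p n \<le> 1 - \<epsilon>"
    let ?E = "\<lambda>n. {G. let q = 1 / (1 - p n) in
            \<lfloor>2 * log q (a_const \<Delta> * real n * p n * (1 - \<epsilon>)) + 3\<rfloor> \<le> int (max_induced_forest \<Delta> G) \<and>
            int (max_induced_forest \<Delta> G) \<le> \<lceil>2 * log q (a_const \<Delta> * real n * p n * (1 + \<epsilon>)) + 3\<rceil>}"
    show "(\<lambda>n. measure_pmf.prob (gnp n (p n)) (?E n)) \<longlonglongrightarrow> 1"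
    proof (rule tendstoI)
      fix \<delta> :: real assume \<delta>: "0 < \<delta>"
      then have "0 < \<delta> / 3"
        by simp
      obtain n2 where n2: "\<And>n p. n2 \<le> n \<Longrightarrow> C2 / real n \<le> p \<Longrightarrow> p \<le> 1 - \<epsilon> \<Longrightarrow>
          real n powr (9 / 10) \<le> real n * p \<Longrightarrow> measure_pmf.prob (gnp n p) (low n p) \<le> \<delta> / 3"
        using C2(2)[OF \<open>0 < \<delta> / 3\<close>] by blast
      obtain n3 where n3: "\<And>n p. n3 \<le> n \<Longrightarrow> C3 / real n \<le> p \<Longrightarrow> p \<le> 1 - \<epsilon> \<Longrightarrow>
          real n * p \<le> real n powr (9 / 10) \<Longrightarrow> measure_pmf.prob (gnp n p) (low n p) \<le> \<delta> / 3"
        using C3(2)[OF \<open>0 < \<delta> / 3\<close>] by blast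
      have "\<forall>\<^sub>F n in sequentially. exp (- (\<epsilon> * ln (1 + \<epsilon>) * ln (real n))) < \<delta> / 3"
      proof -
        have "0 < \<epsilon> * ln (1 + \<epsilon>)"
          using \<epsilon> by simp
        then show ?thesis
          using \<delta> by real_asymp
      qed
      moreover have "\<forall>\<^sub>F n in sequentially. max 1 (max n2 n3) \<le> n"
        by (rule eventually_ge_at_top)
      ultimately show "\<forall>\<^sub>F n in sequentially. dist (measure_pmf.prob (gnp n (p n)) (?E n)) 1 < \<delta>"
        using p
      proof eventually_elim
        case (elim n)
        have n: "0 < n" "n2 \<le> n" "n3 \<le> n"
          using elim by auto
        have CC: "c / real n \<le> p n" if "c \<le> C" for c
          using elim that by (meson divide_right_mono of_nat_0_le_iff order_trans)
        have up: "measure_pmf.prob (gnp n (p n)) (high n (p n)) < \<delta> / 3"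
          using C1(2)[OF n(1) CC] elim by (force simp: C_def)
        \<comment> \<open>The sequence may change between the two ranges infinitely often. As
          \<open>n2\<close> and \<open>n3\<close> are uniform in \<open>p\<close>, the case
          distinction is made for each \<open>n\<close> separately.\<close>
        have lo: "measure_pmf.prob (gnp n (p n)) (low n (p n)) \<le> \<delta> / 3"
          using n2[OF n(2) CC] n3[OF n(3) CC] elim by (cases "real n * p n \<le> real n powr (9 / 10)") (auto simp: C_def)
        have "UNIV = ?E n \<union> (low n (p n) \<union> high n (p n))"
          by (auto simp: low_def high_def Let_def)
        then have "1 = measure_pmf.prob (gnp n (p n)) (?E n \<union> (low n (p n) \<union> high n (p n)))"
          by (metis measure_pmf.prob_space space_measure_pmf)
        also have "\<dots> \<le> measure_pmf.prob (gnp n (p n)) (?E n) +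
            (measure_pmf.prob (gnp n (p n)) (low n (p n)) + measure_pmf.prob (gnp n (p n)) (high n (p n)))"
          by (intro order_trans[OF measure_Un_le] add_mono order_refl measure_Un_le) auto
        finally have "1 - \<delta> < measure_pmf.prob (gnp n (p n)) (?E n)"
          using up lo \<delta> by linarith
        moreover have "measure_pmf.prob (gnp n (p n)) (?E n) \<le> 1"
          by simp
        ultimately show ?case
          using \<delta> unfolding dist_real_def by linarith
      qed
    qed
  qed
qed

end
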